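(* Let $n\ge2$, let $\Omega\subset\mathbb{R}^n$ be a non-empty bounded open set, and let $$F[\psi]=\nabla^2\psi+\alpha(\cdot,\psi)\,\nabla\psi\otimes\nabla\psi-\beta(\cdot,\psi)|\nabla\psi|^2I,$$ where $\alpha,\beta\in C^{0,1}_{loc}(\overline\Omega\times\mathbb{R})$ are real-valued functions such that: (1) the function $L(x,s,p):=\alpha(x,s)\,p\otimes p-\beta(x,s)|p|^2I$ is non-decreasing in $s$ (in the sense of symmetric matrices); (2) either $|\beta(x,s)|>\beta_0>0$ for some constant $\beta_0$, or both $\alpha$ and $\beta$ are constant. Let $U$ be a non-empty open subset of $\mathcal{S}^{n\times n}$ such that (i) if $A\in U$, $B\in\mathcal{S}^{n\times n}$ and $B>0$, then $A+B\in U$; and (ii) if $A\in U$ and $c>0$, then $cA\in U$. Assume that $w\in LSC(\overline\Omega)$ and $v\in USC(\overline\Omega)$ are respectively a viscosity supersolution and a viscosity subsolution of $F[\psi]\in\partial U$ in $\Omega$. (a) If $w\ge v$ in $\Omega$ and $w>v$ on $\partial\Omega$, then $w>v$ in $\Omega$. (b) In case $\alpha$ and $\beta$ are constant, if $w\ge v$ on $\partial\Omega$, then $w\ge v$ in $\Omega$.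
   Context: $\mathcal{S}^{n\times n}$ is the space of real symmetric $n\times n$ matrices; $M\le N$ means $N-M$ is non-negative definite and $B>0$ means $B$ is positive definite; $I$ is the identity matrix, $(p\otimes q)_{ij}=p_iq_j$. For $S\subset\mathbb{R}^n$, $USC(S)$ is the set of functions $\psi:S\to\mathbb{R}\cup\{-\infty\}$, $\psi\not\equiv-\infty$ in $S$, with $\limsup_{x\to\bar x}\psi(x)\le\psi(\bar x)$ for all $\bar x\in S$; $LSC(S)$ is the set of functions $\psi:S\to\mathbb{R}\cup\{+\infty\}$, $\psi\not\equiv+\infty$ in $S$, with $\liminf_{x\to\bar x}\psi(x)\ge\psi(\bar x)$ for all $\bar x\in S$. A function $\psi\in USC(\Omega)$ (resp. $\psi\in LSC(\Omega)$) is a viscosity subsolution (resp. supersolution) of $F[\psi]\in\partial U$ in $\Omega$ if for every $x_0\in\Omega$ and $\varphi\in C^2(\Omega)$ with $(\psi-\varphi)(x_0)=0$ and $\psi-\varphi\le0$ (resp. $\psi-\varphi\ge0$) near $x_0$, one has $F[\varphi](x_0)\in\overline U$ (resp. $F[\varphi](x_0)\in\mathcal{S}^{n\times n}\setminus U$). *)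

theory Defs
  imports "HOL-Analysis.Analysis"
begin

(* The library order on real ^ 'n ^ 'n is componentwise; matrix_le below is the Loewner order. *)

definition sym_matrices :: "(real ^ 'n ^ 'n) set" where
  "sym_matrices = {A. transpose A = A}"

definition nonneg_definite :: "real ^ 'n ^ 'n \<Rightarrow> bool" where
  "nonneg_definite A \<longleftrightarrow> (\<forall>x. 0 \<le> x \<bullet> (A *v x))"

definition pos_definite :: "real ^ 'n ^ 'n \<Rightarrow> bool" where
  "pos_definite A \<longleftrightarrow> (\<forall>x. x \<noteq> 0 \<longrightarrow> 0 < x \<bullet> (A *v x))"

definition matrix_le :: "real ^ 'n ^ 'n \<Rightarrow> real ^ 'n ^ 'n \<Rightarrow> bool" where
  "matrix_le M N \<longleftrightarrow> nonneg_definite (N - M)"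

definition outer_prod :: "real ^ 'n \<Rightarrow> real ^ 'n \<Rightarrow> real ^ 'n ^ 'n" where
  "outer_prod p q = (\<chi> i j. p $ i * q $ j)"

definition usc_on :: "'a::topological_space set \<Rightarrow> ('a \<Rightarrow> ereal) \<Rightarrow> bool" where
  "usc_on S \<psi> \<longleftrightarrow>
     (\<forall>x\<in>S. \<psi> x \<noteq> \<infinity>) \<and> (\<exists>x\<in>S. \<psi> x \<noteq> -\<infinity>) \<and>
     (\<forall>x\<in>S. Limsup (at x within S) \<psi> \<le> \<psi> x)"

definition lsc_on :: "'a::topological_space set \<Rightarrow> ('a \<Rightarrow> ereal) \<Rightarrow> bool" where
  "lsc_on S \<psi> \<longleftrightarrow>
     (\<forall>x\<in>S. \<psi> x \<noteq> -\<infinity>) \<and> (\<exists>x\<in>S. \<psi> x \<noteq> \<infinity>) \<and>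
     (\<forall>x\<in>S. Liminf (at x within S) \<psi> \<ge> \<psi> x)"

(* The class C^{0,1}_loc(S). *)
definition loc_lipschitz_on :: "'a::metric_space set \<Rightarrow> ('a \<Rightarrow> 'b::metric_space) \<Rightarrow> bool" where
  "loc_lipschitz_on S f \<longleftrightarrow> (\<forall>K. compact K \<and> K \<subseteq> S \<longrightarrow> (\<exists>C. C-lipschitz_on K f))"

definition grad :: "(real ^ 'n \<Rightarrow> real) \<Rightarrow> real ^ 'n \<Rightarrow> real ^ 'n" where
  "grad \<phi> x = (THE g. GDERIV \<phi> x :> g)"

definition hess :: "(real ^ 'n \<Rightarrow> real) \<Rightarrow> real ^ 'n \<Rightarrow> real ^ 'n ^ 'n" where
  "hess \<phi> x = jacobian (grad \<phi>) (at x)"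

(* Intended for open \<Omega>: the derivatives are two-sided. *)
definition C2_on :: "(real ^ 'n) set \<Rightarrow> (real ^ 'n \<Rightarrow> real) \<Rightarrow> bool" where
  "C2_on \<Omega> \<phi> \<longleftrightarrow>
     (\<forall>x\<in>\<Omega>. \<phi> differentiable (at x)) \<and>
     (\<forall>x\<in>\<Omega>. grad \<phi> differentiable (at x)) \<and>
     continuous_on \<Omega> (hess \<phi>)"

definition L_op :: "(real ^ 'n \<Rightarrow> real \<Rightarrow> real) \<Rightarrow> (real ^ 'n \<Rightarrow> real \<Rightarrow> real) \<Rightarrow>
    real ^ 'n \<Rightarrow> real \<Rightarrow> real ^ 'n \<Rightarrow> real ^ 'n ^ 'n" where
  "L_op \<alpha> \<beta> x s p =
     \<alpha> x s *\<^sub>R outer_prod p p - (\<beta> x s * (norm p)\<^sup>2) *\<^sub>R mat 1"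

definition F_op :: "(real ^ 'n \<Rightarrow> real \<Rightarrow> real) \<Rightarrow> (real ^ 'n \<Rightarrow> real \<Rightarrow> real) \<Rightarrow>
    (real ^ 'n \<Rightarrow> real) \<Rightarrow> real ^ 'n \<Rightarrow> real ^ 'n ^ 'n" where
  "F_op \<alpha> \<beta> \<phi> x =
     hess \<phi> x + \<alpha> x (\<phi> x) *\<^sub>R outer_prod (grad \<phi> x) (grad \<phi> x)
       - (\<beta> x (\<phi> x) * (norm (grad \<phi> x))\<^sup>2) *\<^sub>R mat 1"

(* The closure of U may be taken in the ambient matrix space, since sym_matrices is closed. *)
definition visc_subsolution ::
  "((real ^ 'n \<Rightarrow> real) \<Rightarrow> real ^ 'n \<Rightarrow> real ^ 'n ^ 'n) \<Rightarrow> (real ^ 'n ^ 'n) set \<Rightarrow>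
   (real ^ 'n) set \<Rightarrow> (real ^ 'n \<Rightarrow> ereal) \<Rightarrow> bool" where
  "visc_subsolution F U \<Omega> \<psi> \<longleftrightarrow> usc_on \<Omega> \<psi> \<and>
     (\<forall>x0\<in>\<Omega>. \<forall>\<phi>. C2_on \<Omega> \<phi> \<and> \<psi> x0 = ereal (\<phi> x0) \<and>
        (\<forall>\<^sub>F x in at x0 within \<Omega>. \<psi> x \<le> ereal (\<phi> x))
        \<longrightarrow> F \<phi> x0 \<in> closure U)"

definition visc_supersolution ::
  "((real ^ 'n \<Rightarrow> real) \<Rightarrow> real ^ 'n \<Rightarrow> real ^ 'n ^ 'n) \<Rightarrow> (real ^ 'n ^ 'n) set \<Rightarrow>
   (real ^ 'n) set \<Rightarrow> (real ^ 'n \<Rightarrow> ereal) \<Rightarrow> bool" where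
  "visc_supersolution F U \<Omega> \<psi> \<longleftrightarrow> lsc_on \<Omega> \<psi> \<and>
     (\<forall>x0\<in>\<Omega>. \<forall>\<phi>. C2_on \<Omega> \<phi> \<and> \<psi> x0 = ereal (\<phi> x0) \<and>
        (\<forall>\<^sub>F x in at x0 within \<Omega>. \<psi> x \<ge> ereal (\<phi> x))
        \<longrightarrow> F \<phi> x0 \<in> sym_matrices - U)"

end

theory Submission
  imports Defs
begin

text \<open>Suppose \<open>v\<close> touches \<open>w\<close> from below at an interior point. Replace \<open>v\<close> by \<open>v + \<mu> exp (\<sigma> C v) + \<nu> |x|\<^sup>2\<close> with
  \<open>\<sigma> = - sgn \<beta>\<close>: this is a strict subsolution, with a gain of order \<open>\<nu> + \<mu> |\<nabla>v|\<^sup>2\<close> where \<open>\<beta>\<close> does not vanish, which absorbs the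
  error \<open>|x - y| |\<nabla>v|\<^sup>2\<close> caused by the dependence of \<open>\<alpha>\<close> and \<open>\<beta>\<close> on \<open>x\<close> and \<open>s\<close>. If \<open>\<beta> = 0\<close> there is no such error and the gain in the direction of the gradient
  suffices. The perturbed function is regularised by a sup-convolution and \<open>w\<close> by an inf-convolution. Tilting their difference
  by small linear functions produces a contact set of positive measure, and at almost all of its points there are second
  order expansions of both functions up to an arbitrarily small error. These carry over to \<open>v\<close> and \<open>w\<close> at nearby points and
  contradict the strictness. Part (b) follows by shifting \<open>v\<close> by the maximum of \<open>v - w\<close>.\<close>

section \<open>Lipschitz functions of one real variable\<close>

text \<open>The obstacle is the gradient term: at two doubled points the coefficients differ by a
  multiple of the distance, and this difference multiplies |p|^2, where the gradient p is not
  controlled by that distance. So the gain must itself be proportional to |p|^2, with a factor fixed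
  before the points are chosen. Replacing the unknown by an increasing function H of it multiplies
  the Hessian by H', whereas the quadratic gradient terms are multiplied by the square of H'. The
  mismatch H'^2 - H' has the sign of \<sigma>, and the matrices are compared after rescaling by H',
  which is legitimate because U is a cone. The values at the doubled points are known to be nearly
  ordered from one side only; monotonicity in s covers the other side. Since a margin of order \<nu>
  remains, the second order expansions may carry an error, and a linear map that depends on the
  tolerated error is enough. Such maps exist almost everywhere by covering arguments and
  Fubini.\<close>

lemma lmeasurable_outer_open:
  fixes S :: "'a::euclidean_space set"
  assumes "S \<in> lmeasurable" "0 < e"
  obtains T where "open T" "S \<subseteq> T" "T \<in> lmeasurable" "measure lebesgue T < measure lebesgue S + e"
proof -
  obtain T where T: "open T" "S \<subseteq> T" "T - S \<in> lmeasurable" "emeasure lebesgue (T - S) < ennreal e"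
    using sets_lebesgue_outer_open[OF fmeasurableD[OF assms(1)] assms(2)] by blast
  have "measure lebesgue (T - S) < e"
    using T \<open>0 < e\<close> by (simp add: emeasure_eq_measure2 ennreal_less_iff)
  moreover have "T \<in> lmeasurable"
    using T assms fmeasurable.Un[of S lebesgue "T - S"] by (simp add: Un_absorb1)
  ultimately show thesis
    using that[of T] T assms by (simp add: measurable_measure_Diff fmeasurableD)
qed

text \<open>Vitali: among the small-slope intervals around points of \<open>A\<close> there is a
  countable disjoint family that covers \<open>A\<close> up to a null set. By monotonicity an
  interval \<open>[s, t]\<close> is mapped into \<open>[f s, f t]\<close>, of length at most
  \<open>a * (t - s)\<close>, and the Lipschitz bound keeps the image of the null set null. All
  intervals stay in an open set only slightly larger than \<open>A\<close>.\<close>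

lemma measure_image_le_of_small_slopes:
  fixes f :: "real \<Rightarrow> real"
  assumes mono: "mono f" and lip: "L-lipschitz_on UNIV f" and "compact A" and "0 \<le> a"
    and slope: "\<And>x d. x \<in> A \<Longrightarrow> 0 < d \<Longrightarrow>
      \<exists>s t. s \<le> x \<and> x \<le> t \<and> s < t \<and> t - s < d \<and> f t - f s \<le> a * (t - s)"
  shows "measure lebesgue (f ` A) \<le> a * measure lebesgue A"
proof (rule field_le_epsilon)
  fix e :: real assume "0 < e"
  let ?\<mu> = "measure lebesgue"
  \<comment> \<open>Dividing by \<open>a + 1\<close> rather than by \<open>a\<close> admits
    \<open>a = 0\<close>.\<close>
  define e' where "e' = e / (a + 1)"
  have "0 < e'" using \<open>0 < e\<close> \<open>0 \<le> a\<close> by (simp add: e'_def)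
  have A: "A \<in> lmeasurable" using \<open>compact A\<close> by (rule lmeasurable_compact)
  obtain T where T: "open T" "A \<subseteq> T" "T \<in> lmeasurable" "?\<mu> T < ?\<mu> A + e'"
    using lmeasurable_outer_open[OF A \<open>0 < e'\<close>] by metis
  define K where "K = {(s, t). s < t \<and> {s..t} \<subseteq> T \<and> f t - f s \<le> a * (t - s)}"
  \<comment> \<open>Intervals are stored as pairs of endpoints; \<open>c\<close> and
    \<open>r\<close> turn them into the balls of the covering theorem.\<close>
  define c r where "c = (\<lambda>p::real \<times> real. (fst p + snd p) / 2)" and "r = (\<lambda>p::real \<times> real. (snd p - fst p) / 2)"
  have cb: "cball (c p) (r p) = {fst p..snd p}" for p
    by (auto simp: cball_eq_atLeastAtMost c_def r_def field_simps)
  obtain C where C: "countable C" "C \<subseteq> K"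
      and pw: "pairwise (\<lambda>i j. disjnt (cball (c i) (r i)) (cball (c j) (r j))) C"
      and neg: "negligible (A - (\<Union>i\<in>C. cball (c i) (r i)))"
  proof (rule Vitali_covering_theorem_cballs[of K r A c])
    show "0 < r i" if "i \<in> K" for i using that by (auto simp: K_def r_def)
    fix x d :: real assume "x \<in> A" "0 < d"
    then obtain k where "0 < k" and k: "ball x k \<subseteq> T"
      using T by (meson openE subsetD)
    obtain s t where st: "s \<le> x" "x \<le> t" "s < t" "t - s < min d k" "f t - f s \<le> a * (t - s)"
      using slope[OF \<open>x \<in> A\<close>, of "min d k"] \<open>0 < d\<close> \<open>0 < k\<close> by auto
    have "{s..t} \<subseteq> T" using st k by (force simp: ball_eq_greaterThanLessThan)
    then have "(s, t) \<in> K" using st by (simp add: K_def)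
    moreover have "x \<in> cball (c (s, t)) (r (s, t))" unfolding cb using st by simp
    moreover have "r (s, t) < d" using st by (simp add: r_def)
    ultimately show "\<exists>i. i \<in> K \<and> x \<in> cball (c i) (r i) \<and> r i < d" by blast
  qed
  have CT: "cball (c p) (r p) \<subseteq> T" if "p \<in> C" for p
  proof -
    have "p \<in> K" using that C(2) by blast
    then show ?thesis unfolding cb by (cases p) (auto simp: K_def)
  qed
  let ?N = "A - (\<Union>i\<in>C. cball (c i) (r i))"
  let ?J = "\<lambda>p. {f (fst p)..f (snd p)}"
  have fN: "negligible (f ` ?N)"
  proof (rule negligible_locally_Lipschitz_image[OF _ neg])
    show "\<exists>T B. open T \<and> x \<in> T \<and> (\<forall>y\<in>?N \<inter> T. norm (f y - f x) \<le> B * norm (y - x))" for x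
      using lipschitz_onD[OF lip] by (intro exI[of _ UNIV] exI[of _ L]) (auto simp: dist_norm)
  qed simp
  have bd: "(\<Sum>p\<in>I. ?\<mu> (?J p)) \<le> a * ?\<mu> T" if "I \<subseteq> C" "finite I" for I
  proof -
    have "(\<Sum>p\<in>I. ?\<mu> (?J p)) \<le> (\<Sum>p\<in>I. a * ?\<mu> (cball (c p) (r p)))"
    proof (rule sum_mono)
      fix p assume "p \<in> I"
      then have "p \<in> K" using that C by blast
      then have "fst p < snd p" "f (snd p) - f (fst p) \<le> a * (snd p - fst p)"
        by (auto simp: K_def)
      then show "?\<mu> (?J p) \<le> a * ?\<mu> (cball (c p) (r p))"
        unfolding cb using monoD[OF mono, of "fst p" "snd p"] by simp
    qed
    also have "\<dots> = a * ?\<mu> (\<Union>p\<in>I. cball (c p) (r p))"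
      unfolding sum_distrib_left[symmetric]
      by (subst measure_UNION') (use that pw in \<open>auto elim: pairwise_mono\<close>)
    also have "\<dots> \<le> a * ?\<mu> T"
      by (intro mult_left_mono \<open>0 \<le> a\<close> measure_mono_fmeasurable)
        (use that CT T in \<open>auto intro!: sets.finite_UN\<close>)
    finally show ?thesis .
  qed
  have bd': "?\<mu> (\<Union>p\<in>I. ?J p) \<le> a * ?\<mu> T" if "I \<subseteq> C" "finite I" for I
    using bd[OF that] measure_UNION_le[of I ?J lebesgue] that by force
  have U: "(\<Union>p\<in>C. ?J p) \<in> lmeasurable" "?\<mu> (\<Union>p\<in>C. ?J p) \<le> a * ?\<mu> T"
    using bd' by (auto intro!: fmeasurable_UN_bound[OF C(1)] measure_UN_bound[OF C(1)])
  have "?\<mu> (f ` A) \<le> ?\<mu> (f ` ?N \<union> (\<Union>p\<in>C. ?J p))"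
  proof (rule measure_mono_fmeasurable)
    show "f ` A \<subseteq> f ` ?N \<union> (\<Union>p\<in>C. ?J p)"
    proof
      fix y assume "y \<in> f ` A"
      then obtain x where x: "x \<in> A" "y = f x" by blast
      show "y \<in> f ` ?N \<union> (\<Union>p\<in>C. ?J p)"
      proof (cases "x \<in> ?N")
        case False
        then obtain p where "p \<in> C" "fst p \<le> x" "x \<le> snd p" using x(1) by (auto simp: cb)
        then have "y \<in> ?J p" using x(2) monoD[OF mono] by simp
        then show ?thesis using \<open>p \<in> C\<close> by blast
      qed (use x in blast)
    qed
    show "f ` A \<in> sets lebesgue"
      by (intro fmeasurableD lmeasurable_compact compact_continuous_image \<open>compact A\<close>
          lipschitz_on_continuous_on[OF lipschitz_on_subset[OF lip]]) auto
    show "f ` ?N \<union> (\<Union>p\<in>C. ?J p) \<in> lmeasurable"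
      using fN U by (auto intro: fmeasurable.Un negligible_imp_measurable)
  qed
  also have "\<dots> \<le> ?\<mu> (\<Union>p\<in>C. ?J p)"
    using measure_Un_le[of "f ` ?N" lebesgue "\<Union>p\<in>C. ?J p"] fN U
    by (auto simp: negligible_imp_measure0 negligible_imp_sets)
  also have "\<dots> \<le> a * ?\<mu> T" by (rule U)
  also have "\<dots> \<le> a * (?\<mu> A + e')" using T \<open>0 \<le> a\<close> by (intro mult_left_mono) auto
  also have "\<dots> \<le> a * ?\<mu> A + e"
    using \<open>0 \<le> a\<close> \<open>0 < e\<close> by (auto simp: e'_def distrib_left field_simps)
  finally show "?\<mu> (f ` A) \<le> a * ?\<mu> A + e" .
qed

text \<open>Inner regularity reduces a measurable set to compact ones, for which image measures can
  be compared. The closed inner approximation may be unbounded and is therefore cut by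
  boxes.\<close>

lemma negligible_if_compact_subsets_negligible:
  fixes S :: "'a::euclidean_space set"
  assumes S: "S \<in> sets lebesgue" and C: "\<And>C. compact C \<Longrightarrow> C \<subseteq> S \<Longrightarrow> negligible C"
  shows "negligible S"
  unfolding negligible_outer_le
proof (intro allI impI)
  fix e :: real assume "0 < e"
  obtain T where T: "closed T" "T \<subseteq> S" "S - T \<in> lmeasurable" "emeasure lebesgue (S - T) < ennreal e"
    using sets_lebesgue_inner_closed[OF S \<open>0 < e\<close>] by blast
  have "negligible T"
    unfolding negligible_on_intervals[of T]
    using T C[OF closed_Int_compact[OF T(1) compact_cbox]] by blast
  moreover have "measure lebesgue (S - T) < e"
    using T \<open>0 < e\<close> by (simp add: emeasure_eq_measure2 ennreal_less_iff)
  moreover have "measure lebesgue (T \<union> (S - T)) \<le> measure lebesgue T + measure lebesgue (S - T)"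
    using \<open>negligible T\<close> T by (intro measure_Un_le) (auto simp: negligible_imp_sets fmeasurableD)
  ultimately have "measure lebesgue (T \<union> (S - T)) \<le> e"
    by (metis add_0 less_imp_le negligible_imp_measure0 order_trans)
  moreover have "T \<union> (S - T) \<in> lmeasurable"
    using fmeasurable.Un[OF negligible_imp_measurable[OF \<open>negligible T\<close>] T(3)] .
  ultimately show "\<exists>U. S \<subseteq> U \<and> U \<in> lmeasurable \<and> measure lebesgue U \<le> e"
    by (intro exI[of _ "T \<union> (S - T)"] conjI) auto
qed

text \<open>Along \<open>e\<close> the lower derivate is at most \<open>a\<close> and the upper one
  at least \<open>b\<close>, with both signs of \<open>t\<close> counted. For a Lipschitz
  \<open>f\<close> the union over rational \<open>a < b\<close> is the set where the directional
  derivative does not exist.\<close>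

definition oscillating_slopes :: "'a::real_vector \<Rightarrow> real \<Rightarrow> real \<Rightarrow> ('a \<Rightarrow> real) \<Rightarrow> 'a set" where
  "oscillating_slopes e a b f = {x.
     (\<forall>d>0. \<exists>t. t \<noteq> 0 \<and> \<bar>t\<bar> < d \<and> (f (x + t *\<^sub>R e) - f x) / t < a) \<and>
     (\<forall>d>0. \<exists>t. t \<noteq> 0 \<and> \<bar>t\<bar> < d \<and> (f (x + t *\<^sub>R e) - f x) / t > b)}"

text \<open>For fixed \<open>t\<close> the slope condition is open in \<open>x\<close>, so an
  arbitrary union over \<open>t\<close> stays open and only the shrinking radius has to be made
  countable.\<close>

lemma borel_oscillating_slopes:
  fixes f :: "'a::real_normed_vector \<Rightarrow> real"
  assumes "continuous_on UNIV f"
  shows "oscillating_slopes e a b f \<in> sets borel"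
proof -
  have op: "open {x. (f (x + t *\<^sub>R e) - f x) / t < a}" "open {x. (f (x + t *\<^sub>R e) - f x) / t > b}"
    if "t \<noteq> 0" for t a b
    by (intro open_Collect_less continuous_intros continuous_on_compose2[OF assms] that; simp add: that)+
  have eq: "(\<forall>d>0. \<exists>t. t \<noteq> 0 \<and> \<bar>t\<bar> < d \<and> P t) \<longleftrightarrow> (\<forall>n::nat. \<exists>t. t \<noteq> 0 \<and> \<bar>t\<bar> < inverse (Suc n) \<and> P t)"
    for P :: "real \<Rightarrow> bool"
  proof (intro iffI allI impI)
    fix d :: real assume *: "\<forall>n::nat. \<exists>t. t \<noteq> 0 \<and> \<bar>t\<bar> < inverse (Suc n) \<and> P t" and "0 < d"
    obtain n where "inverse (real (Suc n)) < d" using reals_Archimedean[OF \<open>0 < d\<close>] by blast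
    then show "\<exists>t. t \<noteq> 0 \<and> \<bar>t\<bar> < d \<and> P t" using * by (meson order_less_trans)
  qed simp
  have "oscillating_slopes e a b f =
    (\<Inter>n::nat. \<Union>t\<in>{t. t \<noteq> 0 \<and> \<bar>t\<bar> < inverse (Suc n)}. {x. (f (x + t *\<^sub>R e) - f x) / t < a}) \<inter>
    (\<Inter>n::nat. \<Union>t\<in>{t. t \<noteq> 0 \<and> \<bar>t\<bar> < inverse (Suc n)}. {x. (f (x + t *\<^sub>R e) - f x) / t > b})"
    unfolding oscillating_slopes_def eq by auto
  also have "\<dots> \<in> sets borel"
    by (rule sets.Int; rule sets.countable_INT''; auto intro!: borel_open open_UN op)
  finally show ?thesis .
qed

text \<open>Adding a large linear function makes \<open>f\<close> a bi-Lipschitz bijection. Its small slopes bound the measure of an image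
  from above, and the small slopes of its inverse bound it from below.\<close>

lemma negligible_oscillating_slopes_real:
  fixes f :: "real \<Rightarrow> real"
  assumes lip: "L-lipschitz_on UNIV f" and "a < b"
  shows "negligible (oscillating_slopes 1 a b f)"
proof (rule negligible_if_compact_subsets_negligible)
  have "continuous_on UNIV f" using lip by (rule lipschitz_on_continuous_on)
  then show "oscillating_slopes 1 a b f \<in> sets lebesgue"
    using borel_oscillating_slopes by (metis sets_completionI_sets sets_lborel)
next
  fix C assume C: "compact C" "C \<subseteq> oscillating_slopes 1 a b f"
  let ?\<mu> = "measure lebesgue"
  have "0 \<le> L" using lip by (rule lipschitz_on_nonneg)
  have lipf: "\<bar>f x - f y\<bar> \<le> L * \<bar>x - y\<bar>" for x y
    using lipschitz_onD[OF lip, of x y] by (simp add: dist_real_def)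
  \<comment> \<open>All slopes of \<open>g\<close> lie between 1 and \<open>2 * L + 1\<close>, so
    its inverse is 1-Lipschitz, and both shifted thresholds are positive once \<open>C\<close> has a
    point.\<close>
  define g where "g = (\<lambda>x. f x + (L + 1) * x)"
  have g_lower: "y - x \<le> g y - g x" if "x \<le> y" for x y
    using lipf[of y x] that by (simp add: g_def algebra_simps abs_le_iff)
  have g_upper: "g y - g x \<le> (2 * L + 1) * (y - x)" if "x \<le> y" for x y
    using lipf[of y x] that by (simp add: g_def algebra_simps abs_le_iff)
  have g_mono: "mono g" using g_lower by (intro monoI) (smt (verit))
  have g_lip: "(2 * L + 1)-lipschitz_on UNIV g"
  proof (rule lipschitz_onI)
    show "dist (g x) (g y) \<le> (2 * L + 1) * dist x y" for x y
      using g_lower[of x y] g_lower[of y x] g_upper[of x y] g_upper[of y x]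
      by (cases "x \<le> y") (auto simp: dist_real_def)
  qed (use \<open>0 \<le> L\<close> in simp)
  have "inj g"
  proof (rule injI)
    show "x = y" if "g x = g y" for x y
      using g_lower[of x y] g_lower[of y x] that by linarith
  qed
  have "surj g"
    unfolding surj_def
  proof
    fix y
    define m where "m = \<bar>y - g 0\<bar>"
    have "g (- m) \<le> y" "y \<le> g m" "- m \<le> m"
      using g_lower[of 0 m] g_lower[of "- m" 0] by (auto simp: m_def)
    then show "\<exists>x. y = g x"
      using IVT'[of g "- m" y m] lipschitz_on_continuous_on[OF lipschitz_on_subset[OF g_lip]] by blast
  qed
  define h where "h = inv g"
  have hg: "h (g x) = x" and gh: "g (h x) = x" for x
    unfolding h_def using \<open>inj g\<close> \<open>surj g\<close> by (auto simp: surj_f_inv_f)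
  have h_mono: "mono h"
  proof (rule monoI)
    show "h x \<le> h y" if "x \<le> y" for x y
      using g_lower[of "h y" "h x"] that unfolding gh by linarith
  qed
  have h_lip: "1-lipschitz_on UNIV h"
  proof (rule lipschitz_onI)
    show "dist (h x) (h y) \<le> 1 * dist x y" for x y
      using g_lower[of "h x" "h y"] g_lower[of "h y" "h x"] unfolding gh
      by (cases "h x \<le> h y") (auto simp: dist_real_def)
  qed simp
  define a' b' where "a' = a + (L + 1)" and "b' = b + (L + 1)"
  have slope_g: "(g (x + t) - g x) / t = (f (x + t) - f x) / t + (L + 1)" if "t \<noteq> 0" for x t
    using that by (simp add: g_def field_simps)
  have lower: "\<exists>t. t \<noteq> 0 \<and> \<bar>t\<bar> < d \<and> (g (x + t) - g x) / t < a'" if "x \<in> C" "0 < d" for x d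
    using C that by (force simp: oscillating_slopes_def a'_def slope_g)
  have upper: "\<exists>t. t \<noteq> 0 \<and> \<bar>t\<bar> < d \<and> (g (x + t) - g x) / t > b'" if "x \<in> C" "0 < d" for x d
    using C that by (force simp: oscillating_slopes_def b'_def slope_g)
  show "negligible C"
  proof (cases "C = {}")
    case False
    then obtain x where "x \<in> C" by blast
    then obtain t where "t \<noteq> 0" and t: "(g (x + t) - g x) / t < a'"
      using lower[of x 1] by auto
    have "1 \<le> (g (x + t) - g x) / t"
      using g_lower[of x "x + t"] g_lower[of "x + t" x] \<open>t \<noteq> 0\<close> by (auto simp: divide_simps)
    then have "0 < a'" using t by simp
    then have "0 < b'" using \<open>a < b\<close> by (simp add: a'_def b'_def)
    have "?\<mu> (g ` C) \<le> a' * ?\<mu> C"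
    proof (rule measure_image_le_of_small_slopes[OF g_mono g_lip C(1)])
      fix x d :: real assume "x \<in> C" "0 < d"
      then obtain t where "t \<noteq> 0" "\<bar>t\<bar> < d" and t': "(g (x + t) - g x) / t < a'" using lower by blast
      show "\<exists>s t. s \<le> x \<and> x \<le> t \<and> s < t \<and> t - s < d \<and> g t - g s \<le> a' * (t - s)"
      proof (cases "0 < t")
        case True
        then show ?thesis using \<open>\<bar>t\<bar> < d\<close> t'
          by (intro exI[of _ x] exI[of _ "x + t"]) (auto simp: pos_divide_less_eq)
      next
        case False
        then show ?thesis using \<open>t \<noteq> 0\<close> \<open>\<bar>t\<bar> < d\<close> t'
          by (intro exI[of _ "x + t"] exI[of _ x]) (auto simp: neg_divide_less_eq)
      qed
    qed (use \<open>0 < a'\<close> in simp)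
    moreover have "?\<mu> (h ` (g ` C)) \<le> inverse b' * ?\<mu> (g ` C)"
    proof (rule measure_image_le_of_small_slopes[OF h_mono h_lip])
      show "compact (g ` C)"
        by (intro compact_continuous_image C lipschitz_on_continuous_on[OF lipschitz_on_subset[OF g_lip]]) auto
      fix y d :: real assume "y \<in> g ` C" "0 < d"
      then obtain x where x: "x \<in> C" "y = g x" by blast
      \<comment> \<open>A slope of \<open>g\<close> above \<open>b'\<close> is a slope of the
        inverse below \<open>inverse b'\<close>; the division by \<open>2 * L + 1\<close> keeps the
        image interval shorter than \<open>d\<close>.\<close>
      obtain t where t: "t \<noteq> 0" "\<bar>t\<bar> < d / (2 * L + 1)" "(g (x + t) - g x) / t > b'"
        using upper[OF x(1), of "d / (2 * L + 1)"] \<open>0 < d\<close> \<open>0 \<le> L\<close> by auto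
      have td: "(2 * L + 1) * \<bar>t\<bar> < d" using t \<open>0 \<le> L\<close> by (simp add: field_simps)
      show "\<exists>s t. s \<le> y \<and> y \<le> t \<and> s < t \<and> t - s < d \<and> h t - h s \<le> inverse b' * (t - s)"
      proof (cases "0 < t")
        case True
        moreover have "t \<le> inverse b' * (g (x + t) - g x)"
          using True t(3) \<open>0 < b'\<close> by (simp add: field_simps)
        ultimately show ?thesis
          using td g_lower[of x "x + t"] g_upper[of x "x + t"]
          by (intro exI[of _ "g x"] exI[of _ "g (x + t)"]) (auto simp: hg x(2))
      next
        case False
        then have "t < 0" using t(1) by simp
        moreover have "- t \<le> inverse b' * (g x - g (x + t))"
          using \<open>t < 0\<close> t(3) \<open>0 < b'\<close> by (simp add: field_simps)
        ultimately show ?thesis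
          using td g_lower[of "x + t" x] g_upper[of "x + t" x]
          by (intro exI[of _ "g (x + t)"] exI[of _ "g x"]) (auto simp: hg x(2))
      qed
    qed (use \<open>0 < b'\<close> in simp)
    ultimately have 1: "?\<mu> (g ` C) \<le> a' * ?\<mu> C" and 2: "?\<mu> C \<le> inverse b' * ?\<mu> (g ` C)"
      by (simp_all add: image_image hg)
    have "b' * ?\<mu> C \<le> ?\<mu> (g ` C)"
      using 2 \<open>0 < b'\<close> by (simp add: field_simps)
    then have "(b' - a') * ?\<mu> C \<le> 0" using 1 by (simp add: left_diff_distrib)
    moreover have "0 < b' - a'" using \<open>a < b\<close> by (simp add: a'_def b'_def)
    ultimately have "?\<mu> C = 0"
      using measure_nonneg[of lebesgue C] by (simp add: mult_le_0_iff)
    then show ?thesis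
      using lmeasurable_compact[OF C(1)] by (simp add: negligible_iff_measure)
  qed simp
qed

section \<open>Almost everywhere approximate differentiability\<close>

text \<open>Fubini applied to \<open>(x, t) \<mapsto> x + t e\<close> together with translation invariance reduces to lines without
  splitting off a coordinate.\<close>

lemma negligible_oscillating_slopes:
  fixes f :: "'a::euclidean_space \<Rightarrow> real"
  assumes lip: "L-lipschitz_on UNIV f" and "a < b"
  shows "negligible (oscillating_slopes e a b f)"
proof -
  define B where "B = oscillating_slopes e a b f"
  have B: "B \<in> sets borel"
    unfolding B_def using lip by (intro borel_oscillating_slopes lipschitz_on_continuous_on)
  \<comment> \<open>The second indicator restricts \<open>t\<close> to an interval of length 1, so
    that the exchanged integral is exactly the measure of \<open>B\<close>.\<close>
  define F where "F = (\<lambda>(x::'a, t::real). indicator B (x + t *\<^sub>R e) * indicator {0..1} t :: ennreal)"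
  have F: "F \<in> borel_measurable (lborel \<Otimes>\<^sub>M lborel)"
  proof -
    have "(\<lambda>p::'a \<times> real. fst p + snd p *\<^sub>R e) \<in> borel_measurable (lborel \<Otimes>\<^sub>M lborel)" by measurable
    from measurable_compose[OF this borel_measurable_indicator[OF B]]
    show ?thesis unfolding F_def case_prod_unfold by measurable
  qed
  have "(\<integral>\<^sup>+ t. F (x, t) \<partial>lborel) = 0" for x
  proof -
    let ?g = "\<lambda>t. f (x + t *\<^sub>R e)"
    have "(L * norm e)-lipschitz_on UNIV ?g"
    proof (rule lipschitz_onI)
      show "dist (?g s) (?g t) \<le> L * norm e * dist s t" for s t
        using lipschitz_onD[OF lip, of "x + s *\<^sub>R e" "x + t *\<^sub>R e"]
        by (simp add: dist_norm mult_ac flip: scaleR_diff_left)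
    qed (use lipschitz_on_nonneg[OF lip] in simp)
    then have neg: "negligible (oscillating_slopes 1 a b ?g)" and
      bor: "oscillating_slopes 1 a b ?g \<in> sets borel"
      using negligible_oscillating_slopes_real[OF _ \<open>a < b\<close>]
        borel_oscillating_slopes[OF lipschitz_on_continuous_on] by blast+
    have "oscillating_slopes 1 a b ?g = {t. x + t *\<^sub>R e \<in> B}"
      by (simp add: oscillating_slopes_def B_def algebra_simps)
    then have "emeasure lborel {t. x + t *\<^sub>R e \<in> B} = 0"
      using neg bor by (simp add: negligible_iff_emeasure0)
    moreover have "{t. x + t *\<^sub>R e \<in> B} \<in> sets borel"
      using bor \<open>_ = {t. x + t *\<^sub>R e \<in> B}\<close> by simp
    ultimately have "AE t in lborel. x + t *\<^sub>R e \<notin> B"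
      by (intro AE_I[of _ _ "{t. x + t *\<^sub>R e \<in> B}"]) auto
    then have "(\<integral>\<^sup>+ t. F (x, t) \<partial>lborel) = (\<integral>\<^sup>+ t. 0 \<partial>(lborel :: real measure))"
      by (intro nn_integral_cong_AE) (auto simp: F_def)
    then show ?thesis by simp
  qed
  then have "0 = (\<integral>\<^sup>+ x. \<integral>\<^sup>+ t. F (x, t) \<partial>lborel \<partial>lborel)" by simp
  also have "\<dots> = (\<integral>\<^sup>+ t. \<integral>\<^sup>+ x. F (x, t) \<partial>lborel \<partial>lborel)"
    by (rule lborel_pair.Fubini'[symmetric]) (use F in simp)
  also have "\<dots> = (\<integral>\<^sup>+ t. emeasure lborel B * indicator {0..1} t \<partial>(lborel :: real measure))"
  proof (rule nn_integral_cong)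
    fix t :: real
    have "emeasure lborel B = emeasure (distr lborel borel ((+) (t *\<^sub>R e))) B"
      by (simp add: lborel_distr_plus)
    also have "\<dots> = (\<integral>\<^sup>+ x. indicator B x \<partial>distr lborel borel ((+) (t *\<^sub>R e)))"
      using B by (intro nn_integral_indicator[symmetric]) simp
    also have "\<dots> = (\<integral>\<^sup>+ x. indicator B (t *\<^sub>R e + x) \<partial>lborel)"
      using B by (intro nn_integral_distr) auto
    finally show "(\<integral>\<^sup>+ x. F (x, t) \<partial>lborel) = emeasure lborel B * indicator {0..1} t"
      by (cases "t \<in> {0..1}") (auto simp: F_def add.commute)
  qed
  also have "\<dots> = emeasure lborel B"
    by (simp add: nn_integral_cmult)
  finally have "emeasure lborel B = 0" by simp
  then show ?thesis
    using B by (simp add: negligible_iff_emeasure0 flip: B_def)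
qed

text \<open>The slope is the upper derivate \<open>s\<close>, the supremum of all \<open>r\<close>
  exceeded at arbitrarily small \<open>t\<close>. Slopes cannot fall below a rational
  \<open>a\<close> between \<open>s - \<eta>\<close> and \<open>s\<close> at arbitrarily small
  \<open>t\<close>: a rational \<open>b\<close> between \<open>a\<close> and \<open>s\<close> is
  exceeded at such \<open>t\<close>, so \<open>x\<close> would lie in an oscillation set.\<close>

lemma approximate_slope_exists:
  fixes f :: "'a::real_normed_vector \<Rightarrow> real"
  assumes lip: "L-lipschitz_on UNIV f" and "0 < \<eta>"
    and x: "\<And>a b. a \<in> \<rat> \<Longrightarrow> b \<in> \<rat> \<Longrightarrow> a < b \<Longrightarrow> x \<notin> oscillating_slopes e a b f"
  shows "\<exists>q d. 0 < d \<and> (\<forall>t. \<bar>t\<bar> < d \<longrightarrow> \<bar>f (x + t *\<^sub>R e) - f x - q * t\<bar> \<le> \<eta> * \<bar>t\<bar>)"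
proof -
  define sl where "sl t = (f (x + t *\<^sub>R e) - f x) / t" for t
  have sl_bound: "\<bar>sl t\<bar> \<le> L * norm e" if "t \<noteq> 0" for t
    using lipschitz_onD[OF lip, of "x + t *\<^sub>R e" x] that
    by (simp add: sl_def dist_norm field_simps)
  define Up where "Up r \<longleftrightarrow> (\<forall>d>0. \<exists>t. t \<noteq> 0 \<and> \<bar>t\<bar> < d \<and> sl t > r)" for r
  have Up_mono: "Up r'" if "Up r" "r' \<le> r" for r r'
    using that unfolding Up_def by (meson le_less_trans)
  define M where "M = L * norm e"
  have Up_low: "Up (- M - 1)"
    unfolding Up_def
  proof (intro allI impI)
    fix d :: real assume "0 < d"
    then show "\<exists>t. t \<noteq> 0 \<and> \<bar>t\<bar> < d \<and> sl t > - M - 1"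
      using sl_bound[of "d / 2"] by (intro exI[of _ "d / 2"]) (auto simp: M_def)
  qed
  have Up_high: "r \<le> M" if "Up r" for r
  proof -
    obtain t where "t \<noteq> 0" "sl t > r" using \<open>Up r\<close> unfolding Up_def by (auto dest!: spec[of _ 1])
    then show ?thesis using sl_bound[of t] by (simp add: M_def)
  qed
  have bdd: "bdd_above {r. Up r}" using Up_high by (intro bdd_aboveI) auto
  define s where "s = Sup {r. Up r}"
  obtain a where a: "a \<in> \<rat>" "s - \<eta> < a" "a < s" using Rats_dense_in_real[of "s - \<eta>" s] \<open>0 < \<eta>\<close> by auto
  obtain b where b: "b \<in> \<rat>" "a < b" "b < s" using Rats_dense_in_real[of a s] a by auto
  obtain r where "Up r" "b < r"
    using less_cSupD[of "{r. Up r}" b] b(3) Up_low unfolding s_def by blast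
  then have "Up b" using Up_mono by simp
  then have "\<not> (\<forall>d>0. \<exists>t. t \<noteq> 0 \<and> \<bar>t\<bar> < d \<and> sl t < a)"
    using x[OF a(1) b(1,2)] unfolding oscillating_slopes_def Up_def sl_def by blast
  then obtain d1 where d1: "0 < d1" "\<And>t. t \<noteq> 0 \<Longrightarrow> \<bar>t\<bar> < d1 \<Longrightarrow> sl t \<ge> a"
    using not_less by blast
  have "\<not> Up (s + \<eta>)"
    using cSup_upper[OF _ bdd, of "s + \<eta>"] \<open>0 < \<eta>\<close> unfolding s_def by force
  then obtain d2 where d2: "0 < d2" "\<And>t. t \<noteq> 0 \<Longrightarrow> \<bar>t\<bar> < d2 \<Longrightarrow> sl t \<le> s + \<eta>"
    unfolding Up_def using not_less by blast
  have "\<bar>f (x + t *\<^sub>R e) - f x - s * t\<bar> \<le> \<eta> * \<bar>t\<bar>" if "\<bar>t\<bar> < min d1 d2" for t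
  proof (cases "t = 0")
    case False
    have "f (x + t *\<^sub>R e) - f x - s * t = (sl t - s) * t"
      using False by (simp add: sl_def field_simps)
    moreover have "\<bar>sl t - s\<bar> \<le> \<eta>"
      using d1(2)[OF False] d2(2)[OF False] that a by auto
    ultimately show ?thesis by (simp add: abs_mult mult_right_mono)
  qed simp
  then show ?thesis using d1(1) d2(1) by (intro exI[of _ s] exI[of _ "min d1 d2"]) auto
qed

text \<open>The negation of porosity: near \<open>x\<close> the holes of \<open>E\<close> have size
  \<open>o(norm h)\<close>. It takes the place of Lebesgue density and makes sense for arbitrary
  sets.\<close>

definition thick_at :: "'a::real_normed_vector set \<Rightarrow> 'a \<Rightarrow> bool" where
  "thick_at E x \<longleftrightarrow> (\<forall>\<sigma>>0. \<exists>d>0. \<forall>h. norm h < d \<longrightarrow> (\<exists>y\<in>E. dist y (x + h) \<le> \<sigma> * norm h))"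

text \<open>Each hole near \<open>x\<close> is a ball outside \<open>E\<close> whose volume is a
  fixed fraction of that of a ball around \<open>x\<close> containing it. A Vitali subfamily has
  disjoint holes inside \<open>T - E\<close>, a set of small measure, so the enlarged balls that
  cover the porous points have small total volume.\<close>

lemma negligible_porous_closed:
  fixes E :: "'a::euclidean_space set"
  assumes "closed E" "0 < \<sigma>" "\<sigma> \<le> 1"
  shows "negligible {x \<in> E. \<forall>d>0. \<exists>h. norm h < d \<and> (\<forall>y\<in>E. \<sigma> * norm h < dist y (x + h))}"
    (is "negligible ?P")
  unfolding negligible_outer_le
proof (intro allI impI)
  fix e :: real assume "0 < e"
  let ?\<mu> = "measure lebesgue" and ?n = "DIM('a)"
  \<comment> \<open>\<open>10 / \<sigma>\<close> is the ratio of the enlarged radius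
    \<open>5 * 2 * norm h\<close> to the radius \<open>\<sigma> * norm h\<close> of the
    hole.\<close>
  define \<iota> where "\<iota> = e * (\<sigma> / 10) ^ ?n"
  have "0 < \<iota>" using \<open>0 < e\<close> \<open>0 < \<sigma>\<close> by (simp add: \<iota>_def)
  obtain T where T: "open T" "E \<subseteq> T" "T - E \<in> lmeasurable" "emeasure lebesgue (T - E) < ennreal \<iota>"
    using sets_lebesgue_outer_open[OF _ \<open>0 < \<iota>\<close>, of E] lebesgue_closedin[of UNIV E] \<open>closed E\<close>
    by auto
  have mT: "?\<mu> (T - E) < \<iota>"
    using T \<open>0 < \<iota>\<close> by (simp add: emeasure_eq_measure2 ennreal_less_iff)
  define K where "K = {(x, h). h \<noteq> 0 \<and> norm h \<le> 1 \<and> cball x (2 * norm h) \<subseteq> T \<and>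
    (\<forall>y\<in>E. \<sigma> * norm h < dist y (x + h))}"
  define r where "r = (\<lambda>p::'a \<times> 'a. 2 * norm (snd p))"
  have r: "0 < r p \<and> r p \<le> 2" if "p \<in> K" for p
    using that by (auto simp: K_def r_def)
  have cov: "?P \<subseteq> (\<Union>p\<in>K. cball (fst p) (r p))"
  proof
    fix x assume x: "x \<in> ?P"
    then have "x \<in> T" using T(2) by auto
    then obtain k where "0 < k" and k: "ball x k \<subseteq> T" using openE[OF T(1)] by metis
    obtain h where h: "norm h < min 1 (k / 2)" "\<forall>y\<in>E. \<sigma> * norm h < dist y (x + h)"
      using x \<open>0 < k\<close> by (auto dest!: spec[of _ "min 1 (k / 2)"])
    have "h \<noteq> 0" using h x by force
    moreover have "cball x (2 * norm h) \<subseteq> T" using h k by (intro order_trans[OF _ k]) (auto simp: subset_iff)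
    ultimately have "(x, h) \<in> K" using h by (simp add: K_def)
    then show "x \<in> (\<Union>p\<in>K. cball (fst p) (r p))" by (force simp: r_def)
  qed
  obtain C where C: "countable C" "C \<subseteq> K"
      and pw: "pairwise (\<lambda>i j. disjnt (cball (fst i) (r i)) (cball (fst j) (r j))) C"
      and PC: "?P \<subseteq> (\<Union>i\<in>C. cball (fst i) (5 * r i))"
    by (rule Vitali_covering_lemma_cballs[OF cov r]) (assumption | rule that)+
  let ?b = "\<lambda>p::'a \<times> 'a. ball (fst p + snd p) (\<sigma> * norm (snd p))"
  have bsub: "?b p \<subseteq> cball (fst p) (r p)" for p
  proof
    fix y assume "y \<in> ?b p"
    then have "dist (fst p) y \<le> norm (snd p) + \<sigma> * norm (snd p)"
      using dist_triangle[of "fst p" y "fst p + snd p"] by (simp add: dist_norm)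
    also have "\<dots> \<le> r p" using \<open>\<sigma> \<le> 1\<close> by (simp add: r_def mult_left_le_one_le \<open>0 < \<sigma>\<close> less_imp_le)
    finally show "y \<in> cball (fst p) (r p)" by simp
  qed
  have bT: "?b p \<subseteq> T - E" if "p \<in> C" for p
  proof -
    have "p \<in> K" using that C by blast
    then have "cball (fst p) (r p) \<subseteq> T" "\<forall>y\<in>E. \<sigma> * norm (snd p) < dist y (fst p + snd p)"
      by (auto simp: K_def r_def)
    then show ?thesis using bsub[of p] by (fastforce simp: dist_commute)
  qed
  have scale: "?\<mu> (cball (fst p) (5 * r p)) = (10 / \<sigma>) ^ ?n * ?\<mu> (?b p)" for p
    using \<open>0 < \<sigma>\<close> by (simp add: content_cball content_ball r_def power_mult_distrib power_divide)
  have bd: "(\<Sum>p\<in>I. ?\<mu> (cball (fst p) (5 * r p))) \<le> e" if "I \<subseteq> C" "finite I" for I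
  proof -
    have "(\<Sum>p\<in>I. ?\<mu> (?b p)) = ?\<mu> (\<Union>p\<in>I. ?b p)"
    proof (rule measure_UNION'[symmetric])
      show "pairwise (\<lambda>i j. disjnt (?b i) (?b j)) I"
      proof (rule pairwiseI)
        fix i j assume "i \<in> I" "j \<in> I" "i \<noteq> j"
        then have "disjnt (cball (fst i) (r i)) (cball (fst j) (r j))"
          using pairwiseD[OF pw] that(1) by blast
        then show "disjnt (?b i) (?b j)"
          using disjnt_subset1[OF disjnt_subset2[OF _ bsub] bsub] by blast
      qed
    qed (use that in auto)
    also have "\<dots> \<le> ?\<mu> (T - E)"
      using that bT T by (intro measure_mono_fmeasurable) (blast, auto intro!: sets.finite_UN)
    finally have "(\<Sum>p\<in>I. ?\<mu> (?b p)) \<le> \<iota>" using mT by simp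
    then have "(\<Sum>p\<in>I. ?\<mu> (cball (fst p) (5 * r p))) \<le> (10 / \<sigma>) ^ ?n * \<iota>"
      unfolding scale sum_distrib_left[symmetric] using \<open>0 < \<sigma>\<close> by (intro mult_left_mono) auto
    also have "\<dots> = e" using \<open>0 < \<sigma>\<close> by (simp add: \<iota>_def power_divide)
    finally show ?thesis .
  qed
  have bd': "?\<mu> (\<Union>p\<in>I. cball (fst p) (5 * r p)) \<le> e" if "I \<subseteq> C" "finite I" for I
    using bd[OF that] measure_UNION_le[of I "\<lambda>p. cball (fst p) (5 * r p)" lebesgue] that by force
  show "\<exists>U. ?P \<subseteq> U \<and> U \<in> lmeasurable \<and> ?\<mu> U \<le> e"
    using PC bd' by (intro exI[of _ "\<Union>p\<in>C. cball (fst p) (5 * r p)"])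
      (auto intro!: fmeasurable_UN_bound[OF C(1)] measure_UN_bound[OF C(1)])
qed

text \<open>A hole of \<open>E\<close> is a hole of its closure with half the radius, since a
  closure point in the smaller ball would have a point of \<open>E\<close> near it in the larger
  one. The radii \<open>inverse (Suc n)\<close> then leave countably many porous subsets of a closed
  set.\<close>

lemma negligible_not_thick_at:
  fixes E :: "'a::euclidean_space set"
  shows "negligible {x \<in> E. \<not> thick_at E x}"
proof -
  let ?P = "\<lambda>n::nat. {x \<in> closure E. \<forall>d>0. \<exists>h. norm h < d \<and> (\<forall>y\<in>closure E. inverse (Suc n) * norm h < dist y (x + h))}"
  have "negligible (\<Union>(range ?P))"
  proof (rule negligible_countable_Union)
    fix S assume "S \<in> range ?P"
    then obtain n where "S = ?P n" by blast
    moreover have "0 < inverse (real (Suc n))" "inverse (real (Suc n)) \<le> 1" by (auto simp: field_simps)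
    ultimately show "negligible S" using negligible_porous_closed[OF closed_closure] by blast
  qed simp
  moreover have "{x \<in> E. \<not> thick_at E x} \<subseteq> \<Union>(range ?P)"
  proof
    fix x assume "x \<in> {x \<in> E. \<not> thick_at E x}"
    then obtain \<sigma> where "x \<in> E" "0 < \<sigma>" and
      \<sigma>: "\<And>d. 0 < d \<Longrightarrow> \<exists>h. norm h < d \<and> (\<forall>y\<in>E. \<sigma> * norm h < dist y (x + h))"
      unfolding thick_at_def by (auto simp: not_le)
    obtain n where n: "inverse (real (Suc n)) < \<sigma> / 2" using reals_Archimedean[of "\<sigma> / 2"] \<open>0 < \<sigma>\<close> by auto
    have "x \<in> ?P n"
    proof (intro CollectI conjI allI impI)
      show "x \<in> closure E" using \<open>x \<in> E\<close> closure_subset by blast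
      fix d :: real assume "0 < d"
      obtain h where h: "norm h < d" "\<forall>y\<in>E. \<sigma> * norm h < dist y (x + h)" using \<sigma>[OF \<open>0 < d\<close>] by blast
      have "h \<noteq> 0" using h \<open>x \<in> E\<close> by force
      have "inverse (Suc n) * norm h < dist y (x + h)" if yE: "y \<in> closure E" for y
      proof -
        have "0 < \<sigma> / 2 * norm h" using \<open>0 < \<sigma>\<close> \<open>h \<noteq> 0\<close> by simp
        then obtain y' where "y' \<in> E" "dist y' y < \<sigma> / 2 * norm h"
          using yE unfolding closure_approachable by blast
        moreover have "\<sigma> * norm h < dist y' (x + h)" using h \<open>y' \<in> E\<close> by blast
        moreover have "inverse (real (Suc n)) * norm h < \<sigma> / 2 * norm h" using n \<open>h \<noteq> 0\<close> by simp
        moreover have "dist y' (x + h) \<le> dist y' y + dist y (x + h)" by (rule dist_triangle)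
        ultimately show ?thesis by (simp add: algebra_simps)
      qed
      then show "\<exists>h. norm h < d \<and> (\<forall>y\<in>closure E. inverse (Suc n) * norm h < dist y (x + h))"
        using h by blast
    qed
    then show "x \<in> \<Union>(range ?P)" by blast
  qed
  ultimately show ?thesis by (rule negligible_subset)
qed

text \<open>Differentiability up to a relative error \<open>\<eta>\<close>: the strictness of the perturbed subsolution
  absorbs such an error.\<close>

definition approx_diff_at :: "real \<Rightarrow> ('a::real_normed_vector \<Rightarrow> 'b::real_normed_vector) \<Rightarrow> 'a \<Rightarrow> bool" where
  "approx_diff_at \<eta> f x \<longleftrightarrow>
     (\<exists>D. linear D \<and> (\<exists>d>0. \<forall>h. norm h < d \<longrightarrow> norm (f (x + h) - f x - D h) \<le> \<eta> * norm h))"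

text \<open>Partial increments are controlled only at points of \<open>E\<close>. Moving one coordinate at a time, each intermediate point
  is replaced by a point of \<open>E\<close> at distance \<open>o(norm h)\<close>.\<close>

lemma approx_diff_at_of_thick:
  fixes f :: "'a::euclidean_space \<Rightarrow> real"
  assumes lip: "L-lipschitz_on UNIV f" and "0 < \<eta>" "0 < r"
    and E: "\<And>y i t. y \<in> E \<Longrightarrow> i \<in> Basis \<Longrightarrow> \<bar>t\<bar> < r \<Longrightarrow> \<bar>f (y + t *\<^sub>R i) - f y - (q \<bullet> i) * t\<bar> \<le> \<eta> * \<bar>t\<bar>"
    and thick: "thick_at E x"  "x \<in> E"
  shows "approx_diff_at (real DIM('a) * (1 + 2 * L) * \<eta>) f x"
proof -
  let ?n = "DIM('a)"
  have "0 \<le> L" using lip by (rule lipschitz_on_nonneg)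
  have lipf: "\<bar>f a - f b\<bar> \<le> L * dist a b" for a b
    using lipschitz_onD[OF lip, of a b] by (simp add: dist_real_def)
  have "0 < \<eta> / ?n" using \<open>0 < \<eta>\<close> by simp
  then obtain d where "0 < d" and d: "\<And>u. norm u < d \<Longrightarrow> \<exists>y\<in>E. dist y (x + u) \<le> \<eta> / ?n * norm u"
    using thick(1) unfolding thick_at_def by blast
  have "norm (f (x + h) - f x - q \<bullet> h) \<le> real ?n * (1 + 2 * L) * \<eta> * norm h"
    if h: "norm h < min (d / ?n) r" for h
  proof -
    define u where "u F = (\<Sum>i\<in>F. (h \<bullet> i) *\<^sub>R i)" for F
    have nu: "norm (u F) \<le> ?n * norm h" if "F \<subseteq> Basis" for F
    proof -
      have "norm (u F) \<le> (\<Sum>i\<in>F. norm ((h \<bullet> i) *\<^sub>R i))" unfolding u_def by (rule norm_sum)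
      also have "\<dots> \<le> (\<Sum>i\<in>F. norm h)"
        using that by (intro sum_mono) (auto simp: Basis_le_norm subset_iff)
      also have "\<dots> \<le> ?n * norm h"
        using card_mono[OF finite_Basis that] by (simp add: mult_right_mono)
      finally show ?thesis .
    qed
    have "\<bar>f (x + u F) - f x - q \<bullet> u F\<bar> \<le> card F * ((1 + 2 * L) * \<eta> * norm h)"
      if "finite F" "F \<subseteq> Basis" for F
      using that
    proof (induction F rule: finite_induct)
      case empty
      show ?case by (simp add: u_def)
    next
      case (insert i F)
      have "norm (u F) < d"
        using nu[of F] insert h by (auto simp: field_simps)
      then obtain y where y: "y \<in> E" "dist y (x + u F) \<le> \<eta> / ?n * norm (u F)" using d by blast
      have "\<eta> / ?n * norm (u F) \<le> \<eta> * norm h"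
        using nu[of F] insert \<open>0 < \<eta>\<close> by (simp add: field_simps)
      then have yd: "dist y (x + u F) \<le> \<eta> * norm h" using y by simp
      let ?t = "h \<bullet> i"
      have t: "\<bar>?t\<bar> \<le> norm h" using insert by (simp add: Basis_le_norm)
      have *: "\<bar>f (y + ?t *\<^sub>R i) - f y - (q \<bullet> i) * ?t\<bar> \<le> \<eta> * \<bar>?t\<bar>"
        using E[OF y(1), of i ?t] insert t h by simp
      have ui: "u (insert i F) = u F + ?t *\<^sub>R i" using insert by (simp add: u_def)
      have 1: "\<bar>f (x + u F) - f y\<bar> \<le> L * (\<eta> * norm h)"
        using lipf[of "x + u F" y] mult_left_mono[OF yd \<open>0 \<le> L\<close>] by (simp add: dist_commute)
      have 2: "\<bar>f (x + u (insert i F)) - f (y + ?t *\<^sub>R i)\<bar> \<le> L * (\<eta> * norm h)"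
        using lipf[of "x + u (insert i F)" "y + ?t *\<^sub>R i"] mult_left_mono[OF yd \<open>0 \<le> L\<close>]
        by (simp add: ui dist_norm norm_minus_commute algebra_simps)
      have 3: "\<eta> * \<bar>?t\<bar> \<le> \<eta> * norm h" using t \<open>0 < \<eta>\<close> by simp
      have 4: "\<bar>f (x + u F) - f x - q \<bullet> u F\<bar> \<le> card F * ((1 + 2 * L) * \<eta> * norm h)"
        using insert by blast
      have 5: "q \<bullet> u (insert i F) = q \<bullet> u F + (q \<bullet> i) * ?t"
        by (simp add: ui inner_add_right)
      \<comment> \<open>The factor \<open>1 + 2 * L\<close> is one partial increment at a point of
        \<open>E\<close> plus the Lipschitz cost of moving both of its ends there.\<close>
      have 6: "card (insert i F) * ((1 + 2 * L) * \<eta> * norm h) =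
          card F * ((1 + 2 * L) * \<eta> * norm h) + (\<eta> * norm h + 2 * (L * (\<eta> * norm h)))"
        using insert by (simp add: algebra_simps)
      show ?case unfolding 5 6 using * 1 2 3 4 by linarith
    qed
    from this[of Basis] have "\<bar>f (x + u Basis) - f x - q \<bullet> u Basis\<bar> \<le> ?n * ((1 + 2 * L) * \<eta> * norm h)" by simp
    then show ?thesis by (simp add: u_def euclidean_representation mult.assoc)
  qed
  moreover have "linear (\<lambda>h. q \<bullet> h)" by (simp add: linear_iff inner_add_right)
  moreover have "0 < min (d / ?n) r" using \<open>0 < d\<close> \<open>0 < r\<close> by simp
  ultimately show ?thesis unfolding approx_diff_at_def by blast
qed

text \<open>\<open>E (q, k)\<close> collects the points whose partial slopes agree with the
  coordinates of \<open>q\<close> up to \<open>\<theta>\<close> at all scales below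
  \<open>inverse (Suc k)\<close>. With \<open>q\<close> from a countable dense set there are
  countably many such sets, they cover all points that have approximate partial slopes, and almost
  every point of each is thick in it.\<close>

theorem negligible_not_approx_diff_real:
  fixes f :: "'a::euclidean_space \<Rightarrow> real"
  assumes lip: "L-lipschitz_on UNIV f" and "0 < \<eta>"
  shows "negligible {x. \<not> approx_diff_at \<eta> f x}"
proof -
  have "0 \<le> L" using lip by (rule lipschitz_on_nonneg)
  define \<theta> where "\<theta> = \<eta> / (real DIM('a) * (1 + 2 * L))"
  have "0 < \<theta>" using \<open>0 < \<eta>\<close> \<open>0 \<le> L\<close> by (simp add: \<theta>_def)
  have \<theta>: "real DIM('a) * (1 + 2 * L) * \<theta> = \<eta>" using \<open>0 \<le> L\<close> by (simp add: \<theta>_def)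
  obtain Q :: "'a set" where Q: "countable Q" "\<And>X. open X \<Longrightarrow> X \<noteq> {} \<Longrightarrow> \<exists>q\<in>Q. q \<in> X"
    by (rule countable_dense_setE) blast
  define E where "E = (\<lambda>(q, k::nat). {x. \<forall>i\<in>Basis. \<forall>t. \<bar>t\<bar> < inverse (Suc k) \<longrightarrow>
    \<bar>f (x + t *\<^sub>R i) - f x - (q \<bullet> i) * t\<bar> \<le> \<theta> * \<bar>t\<bar>})"
  define I where "I = {(i::'a, a::real, b::real). i \<in> Basis \<and> a \<in> \<rat> \<and> b \<in> \<rat> \<and> a < b}"
  define osc where "osc = (\<lambda>(i, a, b). oscillating_slopes i a b f)"
  define Bad where "Bad = \<Union>(osc ` I) \<union> \<Union>((\<lambda>p. {x \<in> E p. \<not> thick_at (E p) x}) ` (Q \<times> UNIV))"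
  have "countable (Basis \<times> \<rat> \<times> \<rat> :: ('a \<times> real \<times> real) set)"
    by (intro countable_SIGMA countable_rat countable_finite finite_Basis)
  then have "countable I" by (rule countable_subset[rotated]) (auto simp: I_def)
  then have "negligible (\<Union>(osc ` I))"
    by (intro negligible_countable_Union) (auto simp: I_def osc_def intro: negligible_oscillating_slopes[OF lip])
  moreover have "negligible (\<Union>((\<lambda>p. {x \<in> E p. \<not> thick_at (E p) x}) ` (Q \<times> UNIV)))"
    using Q(1) by (intro negligible_countable_Union) (auto intro: negligible_not_thick_at)
  ultimately have "negligible Bad" unfolding Bad_def by (rule negligible_Un)
  moreover have "{x. \<not> approx_diff_at \<eta> f x} \<subseteq> Bad"
  proof
    fix x assume bad: "x \<in> {x. \<not> approx_diff_at \<eta> f x}"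
    show "x \<in> Bad"
    proof (rule ccontr)
      assume neg: "x \<notin> Bad"
      \<comment> \<open>Half of the tolerance is spent on the partial slopes, the other half on
        moving their vector \<open>p\<close> to the dense set.\<close>
      have "\<exists>q d. 0 < d \<and> (\<forall>t. \<bar>t\<bar> < d \<longrightarrow> \<bar>f (x + t *\<^sub>R i) - f x - q * t\<bar> \<le> \<theta> / 2 * \<bar>t\<bar>)"
        if "i \<in> Basis" for i
        using neg that \<open>0 < \<theta>\<close>
        by (intro approximate_slope_exists[OF lip]) (auto simp: Bad_def I_def osc_def)
      then obtain q d where qd: "\<And>i. i \<in> Basis \<Longrightarrow> 0 < d i"
        "\<And>i t. i \<in> Basis \<Longrightarrow> \<bar>t\<bar> < d i \<Longrightarrow> \<bar>f (x + t *\<^sub>R i) - f x - q i * t\<bar> \<le> \<theta> / 2 * \<bar>t\<bar>"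
        by metis
      obtain k where k: "inverse (real (Suc k)) < Min (d ` Basis)"
        using reals_Archimedean[of "Min (d ` Basis)"] qd(1) by auto
      define p where "p = (\<Sum>i\<in>Basis. q i *\<^sub>R i)"
      obtain p' where p': "p' \<in> Q" "p' \<in> ball p (\<theta> / 2)"
        using Q(2)[of "ball p (\<theta> / 2)"] \<open>0 < \<theta>\<close> by auto
      have "x \<in> E (p', k)"
        unfolding E_def mem_Collect_eq case_prod_conv
      proof (intro ballI allI impI)
        fix i :: 'a and t :: real assume i: "i \<in> Basis" and t: "\<bar>t\<bar> < inverse (real (Suc k))"
        have "Min (d ` Basis) \<le> d i" using i by (intro Min_le) auto
        then have "\<bar>t\<bar> < d i" using t k by linarith
        then have 1: "\<bar>f (x + t *\<^sub>R i) - f x - q i * t\<bar> \<le> \<theta> / 2 * \<bar>t\<bar>" by (rule qd(2)[OF i])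
        have "p \<bullet> i = q i" using i by (simp add: p_def inner_sum_left inner_Basis if_distrib cong: if_cong)
        then have "\<bar>q i - p' \<bullet> i\<bar> \<le> \<theta> / 2"
          using Basis_le_norm[OF i, of "p - p'"] p' by (simp add: inner_diff_left dist_norm)
        then have "\<bar>(q i - p' \<bullet> i) * t\<bar> \<le> \<theta> / 2 * \<bar>t\<bar>"
          unfolding abs_mult by (rule mult_right_mono) simp
        moreover have "f (x + t *\<^sub>R i) - f x - (p' \<bullet> i) * t = (f (x + t *\<^sub>R i) - f x - q i * t) + (q i - p' \<bullet> i) * t"
          by (simp add: algebra_simps)
        ultimately show "\<bar>f (x + t *\<^sub>R i) - f x - (p' \<bullet> i) * t\<bar> \<le> \<theta> * \<bar>t\<bar>" using 1 by linarith
      qed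
      moreover from this have "thick_at (E (p', k)) x" using neg p' unfolding Bad_def by blast
      ultimately have "approx_diff_at (real DIM('a) * (1 + 2 * L) * \<theta>) f x"
        by (intro approx_diff_at_of_thick[OF lip \<open>0 < \<theta>\<close>, of "inverse (Suc k)" "E (p', k)" p']) (auto simp: E_def)
      then show False using bad by (simp add: \<theta>)
    qed
  qed
  ultimately show ?thesis by (rule negligible_subset)
qed

theorem negligible_not_approx_diff:
  fixes f :: "'a::euclidean_space \<Rightarrow> 'b::euclidean_space"
  assumes lip: "L-lipschitz_on UNIV f" and "0 < \<eta>"
  shows "negligible {x. \<not> approx_diff_at \<eta> f x}"
proof -
  let ?\<theta> = "\<eta> / DIM('b)"
  have "0 < ?\<theta>" using \<open>0 < \<eta>\<close> by simp
  have lipi: "L-lipschitz_on UNIV (\<lambda>x. f x \<bullet> i)" if "i \<in> Basis" for i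
  proof (rule lipschitz_onI)
    show "dist (f x \<bullet> i) (f y \<bullet> i) \<le> L * dist x y" for x y
      using lipschitz_onD[OF lip, of x y] Basis_le_norm[OF that, of "f x - f y"]
      by (simp add: dist_norm inner_diff_left)
  qed (rule lipschitz_on_nonneg[OF lip])
  have "negligible (\<Union>i\<in>Basis. {x. \<not> approx_diff_at ?\<theta> (\<lambda>x. f x \<bullet> i) x})"
    by (intro negligible_Union) (auto intro!: negligible_not_approx_diff_real[OF lipi \<open>0 < ?\<theta>\<close>])
  moreover have "{x. \<not> approx_diff_at \<eta> f x} \<subseteq> (\<Union>i\<in>Basis. {x. \<not> approx_diff_at ?\<theta> (\<lambda>x. f x \<bullet> i) x})"
  proof (rule ccontr)
    assume "\<not> ?thesis"
    then obtain x where x: "\<not> approx_diff_at \<eta> f x" "\<And>i. i \<in> Basis \<Longrightarrow> approx_diff_at ?\<theta> (\<lambda>x. f x \<bullet> i) x"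
      by blast
    obtain D d where D: "\<And>i. i \<in> Basis \<Longrightarrow> linear (D i)" "\<And>i. i \<in> Basis \<Longrightarrow> 0 < d i"
      "\<And>i h. i \<in> Basis \<Longrightarrow> norm h < d i \<Longrightarrow> norm (f (x + h) \<bullet> i - f x \<bullet> i - D i h) \<le> ?\<theta> * norm h"
      using x(2) unfolding approx_diff_at_def by metis
    let ?D = "\<lambda>h. \<Sum>i\<in>Basis. D i h *\<^sub>R i"
    have "linear ?D"
      using D(1) by (intro linear_compose_sum ballI linear_compose_scale_right[where f="\<lambda>h. D _ h", unfolded o_def]) (auto simp: linear_iff algebra_simps)
    moreover have "norm (f (x + h) - f x - ?D h) \<le> \<eta> * norm h" if "norm h < Min (d ` Basis)" for h
    proof -
      have "norm (f (x + h) - f x - ?D h) \<le> (\<Sum>i\<in>Basis. \<bar>(f (x + h) - f x - ?D h) \<bullet> i\<bar>)"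
        by (rule norm_le_l1)
      also have "\<dots> \<le> (\<Sum>i\<in>(Basis::'b set). ?\<theta> * norm h)"
      proof (rule sum_mono)
        fix i :: 'b assume i: "i \<in> Basis"
        have "Min (d ` Basis) \<le> d i" using i by (intro Min_le) auto
        then show "\<bar>(f (x + h) - f x - ?D h) \<bullet> i\<bar> \<le> ?\<theta> * norm h"
          using D(3)[OF i, of h] that i
          by (simp add: inner_diff_left inner_sum_left inner_Basis if_distrib cong: if_cong)
      qed
      also have "\<dots> = \<eta> * norm h" by simp
      finally show ?thesis .
    qed
    moreover have "0 < Min (d ` Basis)" using D(2) by simp
    ultimately show False using x(1) unfolding approx_diff_at_def by blast
  qed
  ultimately show ?thesis by (rule negligible_subset)
qed

section \<open>Second order expansions on contact sets\<close>

text \<open>McShane's infimum of cones. The contact gradient is Lipschitz only on the contact set,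
  while the almost everywhere result concerns maps on the whole space.\<close>

lemma lipschitz_extension_real:
  fixes f :: "'a::metric_space \<Rightarrow> real"
  assumes lip: "L-lipschitz_on K f"
  shows "\<exists>F. L-lipschitz_on UNIV F \<and> (\<forall>x\<in>K. F x = f x)"
proof (cases "K = {}")
  case True
  then show ?thesis
    using lipschitz_on_nonneg[OF lip] by (intro exI[of _ "\<lambda>_. 0"]) (auto intro!: lipschitz_onI)
next
  case False
  then obtain y0 where y0: "y0 \<in> K" by blast
  have "0 \<le> L" using lip by (rule lipschitz_on_nonneg)
  have lipf: "f y \<le> f z + L * dist y z" if "y \<in> K" "z \<in> K" for y z
    using lipschitz_onD[OF lip that] by (simp add: dist_real_def)
  define F where "F x = (INF y\<in>K. f y + L * dist x y)" for x
  have tri: "L * dist x y \<le> L * dist x z + L * dist z y" for x y z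
    using mult_left_mono[OF dist_triangle[of x y z] \<open>0 \<le> L\<close>] by (simp add: distrib_left)
  have bdd: "bdd_below ((\<lambda>y. f y + L * dist x y) ` K)" for x
  proof (rule bdd_belowI2)
    show "f y0 - L * dist x y0 \<le> f y + L * dist x y" if "y \<in> K" for y
      using lipf[OF y0 that] tri[of y0 y x] by (simp add: dist_commute)
  qed
  have le: "F x \<le> F z + L * dist x z" for x z
  proof -
    have "F x - L * dist x z \<le> F z"
      unfolding F_def[of z]
    proof (rule cINF_greatest[OF False])
      fix y assume "y \<in> K"
      then have "F x \<le> f y + L * dist x y" unfolding F_def by (intro cINF_lower bdd)
      then show "F x - L * dist x z \<le> f y + L * dist z y" using tri[of x y z] by linarith
    qed
    then show ?thesis by simp
  qed
  have "L-lipschitz_on UNIV F"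
  proof (rule lipschitz_onI)
    show "dist (F x) (F y) \<le> L * dist x y" for x y
      using le[of x y] le[of y x] by (simp add: dist_real_def dist_commute abs_le_iff)
  qed fact
  moreover have "F x = f x" if "x \<in> K" for x
  proof (rule antisym)
    show "F x \<le> f x" unfolding F_def using cINF_lower[OF bdd[of x] that] by simp
    show "f x \<le> F x" unfolding F_def by (rule cINF_greatest[OF False]) (use lipf that in auto)
  qed
  ultimately show ?thesis by blast
qed

lemma lipschitz_extension_euclidean:
  fixes f :: "'a::metric_space \<Rightarrow> 'b::euclidean_space"
  assumes lip: "L-lipschitz_on K f"
  shows "\<exists>F M. M-lipschitz_on UNIV F \<and> (\<forall>x\<in>K. F x = f x)"
proof -
  have "\<exists>G. L-lipschitz_on UNIV G \<and> (\<forall>x\<in>K. G x = f x \<bullet> i)" if "i \<in> Basis" for i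
  proof (rule lipschitz_extension_real, rule lipschitz_onI)
    show "dist (f x \<bullet> i) (f y \<bullet> i) \<le> L * dist x y" if "x \<in> K" "y \<in> K" for x y
      using lipschitz_onD[OF lip that] Basis_le_norm[OF \<open>i \<in> Basis\<close>, of "f x - f y"]
      by (simp add: dist_norm inner_diff_left)
  qed (rule lipschitz_on_nonneg[OF lip])
  then obtain G where G: "\<And>i. i \<in> Basis \<Longrightarrow> L-lipschitz_on UNIV (G i)"
    "\<And>i x. i \<in> Basis \<Longrightarrow> x \<in> K \<Longrightarrow> G i x = f x \<bullet> i"
    by metis
  define F where "F x = (\<Sum>i\<in>Basis. G i x *\<^sub>R i)" for x
  have "(real DIM('b) * L)-lipschitz_on UNIV F"
  proof (rule lipschitz_onI)
    fix x y
    have "dist (F x) (F y) = norm (\<Sum>i\<in>Basis. (G i x - G i y) *\<^sub>R i)"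
      by (simp add: F_def dist_norm scaleR_diff_left sum_subtractf)
    also have "\<dots> \<le> (\<Sum>i\<in>(Basis::'b set). L * dist x y)"
    proof (rule sum_norm_le)
      fix i :: 'b assume i: "i \<in> Basis"
      show "norm ((G i x - G i y) *\<^sub>R i) \<le> L * dist x y"
        using lipschitz_onD[OF G(1)[OF i], of x y] i by (simp add: dist_real_def)
    qed
    finally show "dist (F x) (F y) \<le> real DIM('b) * L * dist x y" by simp
  qed (use lipschitz_on_nonneg[OF lip] in simp)
  moreover have "F x = f x" if "x \<in> K" for x
    using G(2) that by (simp add: F_def euclidean_representation)
  ultimately show ?thesis by blast
qed

text \<open>Three expansions are compared: from \<open>x\<close> by \<open>d\<close> and by
  \<open>d + h\<close>, and from \<open>y\<close> by \<open>h\<close>. With \<open>h\<close> as long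
  as \<open>d\<close> and parallel to \<open>q x - q y\<close>, the linear parts leave exactly
  \<open>norm d * norm g\<close>, and the errors add up to \<open>C + C + 4 * C\<close> times the
  square of \<open>norm d\<close>.\<close>

lemma lipschitz_on_contact_gradient:
  fixes f :: "'a::real_inner \<Rightarrow> real"
  assumes "0 \<le> C" and f: "\<And>x h. x \<in> K \<Longrightarrow> \<bar>f (x + h) - f x - q x \<bullet> h\<bar> \<le> C * (norm h)^2"
  shows "(6 * C)-lipschitz_on K q"
proof (rule lipschitz_onI)
  fix x y assume x: "x \<in> K" and y: "y \<in> K"
  define d where "d = y - x"
  show "dist (q x) (q y) \<le> 6 * C * dist x y"
  proof (cases "q x = q y \<or> x = y")
    case False
    define g where "g = q x - q y"
    define h where "h = (norm d / norm g) *\<^sub>R g"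
    have "norm g > 0" "norm d > 0" using False by (auto simp: g_def d_def)
    have nh: "norm h = norm d" using \<open>norm g > 0\<close> by (simp add: h_def)
    have "norm (d + h) \<le> 2 * norm d" using norm_triangle_ineq[of d h] nh by simp
    then have dh: "C * (norm (d + h))^2 \<le> C * (4 * (norm d)^2)"
      using power_mono[of "norm (d + h)" "2 * norm d" 2] \<open>0 \<le> C\<close> by (intro mult_left_mono) auto
    have "g \<bullet> h = norm d * norm g"
      using \<open>norm g > 0\<close> by (simp add: h_def power2_norm_eq_inner[symmetric] power2_eq_square)
    moreover have "g \<bullet> h = (f (y + h) - f y - q y \<bullet> h) + (f (x + d) - f x - q x \<bullet> d)
        - (f (x + (d + h)) - f x - q x \<bullet> (d + h))"
      by (simp add: g_def d_def inner_add_right inner_diff_left)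
    ultimately have "norm d * norm g \<le> 6 * C * (norm d)^2"
      using f[OF y, of h] f[OF x, of d] f[OF x, of "d + h"] dh unfolding nh by linarith
    then have "norm g \<le> 6 * C * norm d"
      using \<open>norm d > 0\<close> by (simp add: power2_eq_square)
    then show ?thesis by (simp add: g_def d_def dist_norm norm_minus_commute)
  qed (use \<open>0 \<le> C\<close> in auto)
qed (use \<open>0 \<le> C\<close> in simp)

text \<open>A Riemann sum replaces integration of the gradient along the segment, because
  \<open>Q\<close> is the gradient of \<open>f\<close> only at points of \<open>K\<close>. Each of
  the \<open>N\<close> increments is expanded about a point of \<open>K\<close> near its left end;
  the \<open>N\<close> errors of size \<open>C * (norm h / N)^2\<close> add up to order
  \<open>1 / N\<close>, so a large fixed \<open>N\<close> makes them small.\<close>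

lemma second_order_expansion_of_thick:
  fixes f :: "'a::euclidean_space \<Rightarrow> real"
  assumes "0 \<le> C" and f: "\<And>y h. y \<in> K \<Longrightarrow> \<bar>f (y + h) - f y - Q y \<bullet> h\<bar> \<le> C * (norm h)^2"
    and x: "x \<in> K" "thick_at K x" and "approx_diff_at \<eta> Q x" "0 < \<eta>"
  shows "\<exists>D. linear D \<and> (\<exists>d>0. \<forall>h. norm h < d \<longrightarrow>
     \<bar>f (x + h) - f x - Q x \<bullet> h - (h \<bullet> D h) / 2\<bar> \<le> 5 * \<eta> * (norm h)^2)"
proof -
  obtain D d2 where "linear D" "0 < d2" and
    D: "\<And>h. norm h < d2 \<Longrightarrow> norm (Q (x + h) - Q x - D h) \<le> \<eta> * norm h"
    using \<open>approx_diff_at \<eta> Q x\<close> unfolding approx_diff_at_def by blast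
  obtain B where "0 < B" and B: "\<And>h. norm (D h) \<le> B * norm h"
    using linear_bounded_pos[OF \<open>linear D\<close>] by blast
  \<comment> \<open>\<open>N\<close> controls two errors of order \<open>1 / N\<close>: the
    paraboloids contribute \<open>5 * C\<close>, the defect of the left Riemann sum at most
    \<open>B\<close>.\<close>
  obtain N :: nat where N: "(B + 5 * C) / \<eta> < N" using reals_Archimedean2 by blast
  have "0 < (B + 5 * C) / \<eta>" using \<open>0 < B\<close> \<open>0 \<le> C\<close> \<open>0 < \<eta>\<close> by simp
  then have "0 < real N" using N by linarith
  have BC: "B + 5 * C \<le> \<eta> * N" using N \<open>0 < \<eta>\<close> by (simp add: field_simps)
  \<comment> \<open>The first bound puts the substitute point within one step of the node, the
    second keeps the resulting change of \<open>D\<close> below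
    \<open>\<eta> * norm h\<close>.\<close>
  define \<sigma> where "\<sigma> = min (1 / N) (\<eta> / B)"
  have \<sigma>: "0 < \<sigma>" "\<sigma> \<le> 1 / N" "B * \<sigma> \<le> \<eta>"
    using \<open>0 < real N\<close> \<open>0 < \<eta>\<close> \<open>0 < B\<close> by (auto simp: \<sigma>_def min_def field_simps)
  obtain d1 where "0 < d1" and d1: "\<And>h. norm h < d1 \<Longrightarrow> \<exists>y\<in>K. dist y (x + h) \<le> \<sigma> * norm h"
    using x(2) \<sigma>(1) unfolding thick_at_def by blast
  have "\<bar>f (x + h) - f x - Q x \<bullet> h - (h \<bullet> D h) / 2\<bar> \<le> 5 * \<eta> * (norm h)^2"
    if h: "norm h < min d1 (d2 / 2)" for h
  proof -
    define X where "X i = x + (real i / N) *\<^sub>R h" for i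
    define \<Delta> where "\<Delta> i = f (X (Suc i)) - f (X i) - (Q x \<bullet> h) / N - real i / N^2 * (h \<bullet> D h)" for i
    define rem where "rem = f (x + h) - f x - Q x \<bullet> h - (h \<bullet> D h) / 2"
    have step: "\<bar>\<Delta> i\<bar>
        \<le> (3 * \<eta> / N + 5 * C / N^2) * (norm h)^2" if "i < N" for i
    proof -
      define u where "u = (real i / N) *\<^sub>R h"
      have "real i / N \<le> 1" using that by simp
      then have nu: "norm u \<le> norm h" using mult_right_mono[of "real i / N" 1 "norm h"] by (simp add: u_def)
      then obtain y where y: "y \<in> K" "dist y (x + u) \<le> \<sigma> * norm u" using d1[of u] h by auto
      then have yu: "norm (y - (x + u)) \<le> \<sigma> * norm h"
        using mult_left_mono[OF nu less_imp_le[OF \<sigma>(1)]] unfolding dist_norm by linarith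
      define k where "k = y - x"
      have ku: "norm (k - u) \<le> \<sigma> * norm h" using yu by (simp add: k_def algebra_simps)
      have "1 / real N \<le> 1" using \<open>0 < real N\<close> by (simp add: field_simps)
      then have "\<sigma> * norm h \<le> norm h" using \<sigma> by (intro mult_left_le_one_le) auto
      then have nk: "norm k \<le> 2 * norm h" using norm_triangle_ineq[of "k - u" u] ku nu by simp
      have 1: "norm (Q y - Q x - D k) \<le> 2 * \<eta> * norm h"
      proof -
        have "norm (Q (x + k) - Q x - D k) \<le> \<eta> * norm k" using D[of k] nk h by simp
        also have "\<dots> \<le> \<eta> * (2 * norm h)" using nk \<open>0 < \<eta>\<close> by (intro mult_left_mono) auto
        finally show ?thesis by (simp add: k_def)
      qed
      have 2: "norm (D k - D u) \<le> \<eta> * norm h"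
      proof -
        have "norm (D (k - u)) \<le> B * (\<sigma> * norm h)"
          using B[of "k - u"] mult_left_mono[OF ku less_imp_le[OF \<open>0 < B\<close>]] by linarith
        also have "\<dots> \<le> \<eta> * norm h" using mult_right_mono[OF \<sigma>(3), of "norm h"] by (simp add: mult.assoc)
        finally show ?thesis by (simp add: linear_diff[OF \<open>linear D\<close>])
      qed
      define E where "E = Q y - Q x - D u"
      have "norm E \<le> 3 * \<eta> * norm h"
        using norm_triangle_ineq[of "Q y - Q x - D k" "D k - D u"] 1 2 by (simp add: E_def)
      then have Eh: "\<bar>E \<bullet> h\<bar> \<le> 3 * \<eta> * (norm h)^2"
        using Cauchy_Schwarz_ineq2[of E h] mult_right_mono[of "norm E" "3 * \<eta> * norm h" "norm h"]
        by (simp add: power2_eq_square mult.assoc)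
      have Qh: "Q y \<bullet> h = Q x \<bullet> h + real i / N * (h \<bullet> D h) + E \<bullet> h"
        by (simp add: E_def u_def linear_scale[OF \<open>linear D\<close>] inner_diff_left inner_commute[of "D h"])
      \<comment> \<open>Expanding both ends about the same \<open>y\<close> cancels
        \<open>f y\<close>, and \<open>a - b\<close> is exactly one step.\<close>
      define a b where "a = X (Suc i) - y" and "b = X i - y"
      have b: "norm b \<le> norm h / N"
      proof -
        have "norm b = norm (y - (x + u))" by (simp add: b_def X_def u_def norm_minus_commute)
        then show ?thesis using yu mult_right_mono[OF \<sigma>(2) norm_ge_zero[of h]] by simp
      qed
      have ab: "a = b + (1 / N) *\<^sub>R h"
        by (simp add: a_def b_def X_def add_divide_distrib scaleR_add_left)
      then have a: "norm a \<le> 2 * norm h / N" using b norm_triangle_ineq[of b "(1 / N) *\<^sub>R h"] by simp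
      have a2: "C * (norm a)^2 \<le> 4 * C / N^2 * (norm h)^2"
        using mult_left_mono[OF power_mono[OF a, of 2] \<open>0 \<le> C\<close>] by (simp add: power_divide power_mult_distrib mult_ac)
      have b2: "C * (norm b)^2 \<le> C / N^2 * (norm h)^2"
        using mult_left_mono[OF power_mono[OF b, of 2] \<open>0 \<le> C\<close>] by (simp add: power_divide power_mult_distrib)
      have fa: "\<bar>f (X (Suc i)) - f y - Q y \<bullet> a\<bar> \<le> C * (norm a)^2" using f[OF y(1), of a] by (simp add: a_def)
      have fb: "\<bar>f (X i) - f y - Q y \<bullet> b\<bar> \<le> C * (norm b)^2" using f[OF y(1), of b] by (simp add: b_def)
      have "Q y \<bullet> a - Q y \<bullet> b = (Q x \<bullet> h) / N + real i / N^2 * (h \<bullet> D h) + (E \<bullet> h) / N"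
        unfolding ab using Qh by (simp add: inner_add_right add_divide_distrib power2_eq_square)
      moreover have "\<bar>s' - s - t1 - t2\<bar> \<le> \<bar>t3\<bar> + A + B"
        if "qa - qb = t1 + t2 + t3" "\<bar>s' - z - qa\<bar> \<le> A" "\<bar>s - z - qb\<bar> \<le> B"
        for s' s z qa qb t1 t2 t3 A B :: real
        using that by linarith
      ultimately have "\<bar>\<Delta> i\<bar>
        \<le> \<bar>(E \<bullet> h) / N\<bar> + C * (norm a)^2 + C * (norm b)^2"
        unfolding \<Delta>_def using fa fb by blast
      also have "\<bar>(E \<bullet> h) / N\<bar> \<le> 3 * \<eta> / N * (norm h)^2"
        using divide_right_mono[OF Eh, of N] \<open>0 < real N\<close> by simp
      finally have "\<bar>\<Delta> i\<bar>
        \<le> 3 * \<eta> / N * (norm h)^2 + 4 * C / N^2 * (norm h)^2 + C / N^2 * (norm h)^2"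
        using a2 b2 by linarith
      also have "\<dots> = (3 * \<eta> / N + 5 * C / N^2) * (norm h)^2"
        by (simp add: field_simps)
      finally show ?thesis .
    qed
    \<comment> \<open>Divided by \<open>N^2\<close> this is 1/2 minus \<open>1 / (2 * N)\<close>:
      the left Riemann sum misses the quadratic term by
      \<open>(h \<bullet> D h) / (2 * N)\<close>.\<close>
    have gauss: "(\<Sum>i<N. real i) = real N * (real N - 1) / 2"
      by (induction N) (auto simp: field_simps)
    have "(\<Sum>i<N. \<Delta> i)
        = (f (X N) - f (X 0)) - Q x \<bullet> h - (\<Sum>i<N. real i) / N^2 * (h \<bullet> D h)"
      using \<open>0 < real N\<close> sum_lessThan_telescope[of "\<lambda>i. f (X i)" N]
      by (simp add: \<Delta>_def sum_subtractf sum_distrib_right sum_divide_distrib)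
    also have "\<dots> = rem + (h \<bullet> D h) / (2 * N)"
      unfolding gauss using \<open>0 < real N\<close> by (simp add: X_def rem_def power2_eq_square field_simps)
    finally have eq: "(\<Sum>i<N. \<Delta> i)
        = rem + (h \<bullet> D h) / (2 * N)" .
    have "\<bar>rem + (h \<bullet> D h) / (2 * N)\<bar>
        \<le> (\<Sum>i<N. (3 * \<eta> / N + 5 * C / N^2) * (norm h)^2)"
      unfolding eq[symmetric] by (intro order_trans[OF sum_abs] sum_mono step) simp
    also have "\<dots> = (3 * \<eta> + 5 * C / N) * (norm h)^2"
      using \<open>0 < real N\<close> by (simp add: power2_eq_square field_simps)
    finally have 1: "\<bar>rem + (h \<bullet> D h) / (2 * N)\<bar>
        \<le> (3 * \<eta> + 5 * C / N) * (norm h)^2" .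
    have "\<bar>h \<bullet> D h\<bar> \<le> B * (norm h)^2"
      using Cauchy_Schwarz_ineq2[of h "D h"] mult_left_mono[OF B[of h], of "norm h"]
      by (simp add: power2_eq_square mult_ac)
    then have 2: "\<bar>(h \<bullet> D h) / (2 * N)\<bar> \<le> B / N * (norm h)^2"
    proof -
      have "\<bar>(h \<bullet> D h) / (2 * N)\<bar> \<le> \<bar>h \<bullet> D h\<bar> / N" using \<open>0 < real N\<close> by (simp add: field_simps)
      also have "\<dots> \<le> B * (norm h)^2 / N" using \<open>_ \<le> B * (norm h)^2\<close> by (intro divide_right_mono) auto
      finally show ?thesis by simp
    qed
    have "(5 * C / N + B / N) * (norm h)^2 \<le> \<eta> * (norm h)^2"
      using BC \<open>0 < real N\<close> by (intro mult_right_mono) (auto simp: field_simps)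
    then have "(3 * \<eta> + 5 * C / N) * (norm h)^2 + B / N * (norm h)^2 \<le> 5 * \<eta> * (norm h)^2"
      using \<open>0 < \<eta>\<close> by (simp add: distrib_right) (smt (verit) mult_nonneg_nonneg zero_le_power2)
    then show ?thesis using 1 2 unfolding rem_def by linarith
  qed
  moreover have "0 < min d1 (d2 / 2)" using \<open>0 < d1\<close> \<open>0 < d2\<close> by simp
  ultimately show ?thesis using \<open>linear D\<close> by blast
qed

lemma zero_if_inner_le_norm_square:
  fixes v :: "'a::real_inner"
  assumes "\<And>h. v \<bullet> h \<le> c * (norm h)^2"
  shows "v = 0"
proof (rule ccontr)
  assume "v \<noteq> 0"
  define t where "t = inverse (\<bar>c\<bar> + 1)"
  have "0 < t" by (simp add: t_def)
  have ct: "c * t < 1" by (simp add: t_def field_simps)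
  have "v \<bullet> (t *\<^sub>R v) = t * (norm v)^2" by (simp add: power2_norm_eq_inner)
  moreover have "c * (norm (t *\<^sub>R v))^2 = c * t * (t * (norm v)^2)"
    by (simp add: power_mult_distrib power2_eq_square)
  ultimately have "t * (norm v)^2 \<le> c * t * (t * (norm v)^2)"
    using assms[of "t *\<^sub>R v"] by metis
  then have "1 \<le> c * t"
    using \<open>0 < t\<close> \<open>v \<noteq> 0\<close> by simp
  then show False using ct by simp
qed

text \<open>This takes the place of the theorem on sums. On the contact set \<open>f\<close> is squeezed between paraboloids, so its gradient
  there is Lipschitz; the set is not negligible since \<open>x \<mapsto> p\<close> maps it onto a ball. Only \<open>f\<close> needs an expansion: the one-sided
  bound for \<open>g\<close> follows from the contact inequality.\<close>

theorem contact_second_order_expansion: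
  fixes f g :: "'a::euclidean_space \<Rightarrow> real"
  assumes "0 \<le> C"
    and f: "\<And>x. \<exists>q. \<forall>h. f x + q \<bullet> h - C * (norm h)^2 \<le> f (x + h)"
    and g: "\<And>x. \<exists>q. \<forall>h. g x + q \<bullet> h - C * (norm h)^2 \<le> g (x + h)"
    and "0 < \<delta>" and attained: "\<And>p. norm p \<le> \<delta> \<Longrightarrow> \<exists>x. \<forall>y. f y + g y - p \<bullet> y \<le> f x + g x - p \<bullet> x"
    and "0 < \<eta>"
  obtains x p q D d where "norm p \<le> \<delta>" "\<And>y. f y + g y - p \<bullet> y \<le> f x + g x - p \<bullet> x"
    "linear D" "0 < d"
    "\<And>h. norm h < d \<Longrightarrow> f (x + h) \<le> f x + q \<bullet> h + (h \<bullet> D h) / 2 + \<eta> * (norm h)^2"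
    "\<And>h. norm h < d \<Longrightarrow> g (x + h) \<le> g x + (p - q) \<bullet> h - (h \<bullet> D h) / 2 + \<eta> * (norm h)^2"
proof -
  define is_max where "is_max p x \<longleftrightarrow> (\<forall>y. f y + g y - p \<bullet> y \<le> f x + g x - p \<bullet> x)" for p x
  define K where "K = {x. \<exists>p. norm p \<le> \<delta> \<and> is_max p x}"
  define P where "P x = (SOME p. norm p \<le> \<delta> \<and> is_max p x)" for x
  have P: "norm (P x) \<le> \<delta>" "is_max (P x) x" if "x \<in> K" for x
    using that someI_ex[of "\<lambda>p. norm p \<le> \<delta> \<and> is_max p x"] unfolding K_def P_def by blast+
  obtain q where q: "\<And>x h. f x + q x \<bullet> h - C * (norm h)^2 \<le> f (x + h)" using f by metis
  obtain r where r: "\<And>x h. g x + r x \<bullet> h - C * (norm h)^2 \<le> g (x + h)" using g by metis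
  have upper: "f (x + h) + g (x + h) \<le> f x + g x + p \<bullet> h" if "is_max p x" for p x h
    using that[unfolded is_max_def, rule_format, of "x + h"] by (simp add: inner_add_right)
  \<comment> \<open>From below \<open>f + g\<close> has slope \<open>q x + r x\<close> up to a
    quadratic error, from above it has slope \<open>p\<close>, so the two agree. Hence both
    functions are differentiable at contact points and \<open>P\<close> is the only admissible
    choice.\<close>
  have qr: "q x + r x = p" if "is_max p x" for p x
  proof -
    have "(q x + r x - p) \<bullet> h \<le> (2 * C) * (norm h)^2" for h
      using upper[OF that, of h] q[of x h] r[of x h] by (simp add: inner_add_left inner_diff_left)
    then show ?thesis using zero_if_inner_le_norm_square[of "q x + r x - p" "2 * C"] by simp
  qed
  have f_two_sided: "\<bar>f (x + h) - f x - q x \<bullet> h\<bar> \<le> C * (norm h)^2" if "x \<in> K" for x h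
  proof -
    have "r x = P x - q x" using qr[OF P(2)[OF that]] by (simp add: algebra_simps)
    then have "g x + P x \<bullet> h - q x \<bullet> h - C * (norm h)^2 \<le> g (x + h)"
      using r[of x h] by (simp add: inner_diff_left)
    then show ?thesis using q[of x h] upper[OF P(2)[OF that], of h] by linarith
  qed
  have fg_two_sided: "\<bar>(f (x + h) + g (x + h)) - (f x + g x) - P x \<bullet> h\<bar> \<le> (2 * C) * (norm h)^2" if "x \<in> K" for x h
  proof -
    have "P x \<bullet> h = q x \<bullet> h + r x \<bullet> h"
      using qr[OF P(2)[OF that]] by (simp flip: inner_add_left)
    moreover have "0 \<le> C * (norm h)^2" using \<open>0 \<le> C\<close> by simp
    ultimately show ?thesis using q[of x h] r[of x h] upper[OF P(2)[OF that], of h] by linarith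
  qed
  have P_lip: "(6 * (2 * C))-lipschitz_on K P"
    by (rule lipschitz_on_contact_gradient[where f="\<lambda>x. f x + g x"]) (use fg_two_sided \<open>0 \<le> C\<close> in auto)
  have "\<not> negligible K"
  proof
    assume "negligible K"
    have "negligible (P ` K)"
    proof (rule negligible_locally_Lipschitz_image[OF _ \<open>negligible K\<close>])
      show "\<exists>T B. open T \<and> x \<in> T \<and> (\<forall>y\<in>K \<inter> T. norm (P y - P x) \<le> B * norm (y - x))" if "x \<in> K" for x
        using lipschitz_on_normD[OF P_lip _ that] by (intro exI[of _ UNIV] exI) auto
    qed simp
    moreover have "cball 0 \<delta> \<subseteq> P ` K"
    proof
      fix p :: 'a assume "p \<in> cball 0 \<delta>"
      then obtain x where x: "is_max p x" "norm p \<le> \<delta>" using attained unfolding is_max_def by auto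
      then have "x \<in> K" by (auto simp: K_def)
      then have "P x = p" using qr[OF P(2)] qr[OF x(1)] by metis
      then show "p \<in> P ` K" using \<open>x \<in> K\<close> by blast
    qed
    ultimately have "negligible (cball (0::'a) \<delta>)" by (rule negligible_subset)
    then have "negligible (ball (0::'a) \<delta>)" by (rule negligible_subset) (rule ball_subset_cball)
    then show False using \<open>0 < \<delta>\<close> open_not_negligible[of "ball (0::'a) \<delta>"] by simp
  qed
  obtain Q M where Q: "M-lipschitz_on UNIV Q" "\<And>x. x \<in> K \<Longrightarrow> Q x = q x"
    using lipschitz_extension_euclidean[OF lipschitz_on_contact_gradient[OF \<open>0 \<le> C\<close> f_two_sided]] by metis
  \<comment> \<open>The tolerance is \<open>\<eta> / 5\<close> because the passage from the gradient
    to the function loses a factor 5.\<close>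
  have "negligible ({x \<in> K. \<not> thick_at K x} \<union> {x. \<not> approx_diff_at (\<eta> / 5) Q x})"
    using negligible_not_thick_at negligible_not_approx_diff[OF Q(1)] \<open>0 < \<eta>\<close> by (intro negligible_Un) auto
  then have "\<not> K \<subseteq> {x \<in> K. \<not> thick_at K x} \<union> {x. \<not> approx_diff_at (\<eta> / 5) Q x}"
    using \<open>\<not> negligible K\<close> negligible_subset by blast
  then obtain x where x: "x \<in> K" "thick_at K x" "approx_diff_at (\<eta> / 5) Q x" by blast
  have "\<bar>f (y + h) - f y - Q y \<bullet> h\<bar> \<le> C * (norm h)^2" if "y \<in> K" for y h
    using f_two_sided[OF that] Q(2)[OF that] by simp
  from second_order_expansion_of_thick[OF \<open>0 \<le> C\<close> this x] \<open>0 < \<eta>\<close>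
  obtain D d where D: "linear D" "0 < d" and
    exp: "\<And>h. norm h < d \<Longrightarrow> \<bar>f (x + h) - f x - Q x \<bullet> h - (h \<bullet> D h) / 2\<bar> \<le> \<eta> * (norm h)^2"
    by auto
  show thesis
  proof (rule that[OF P(1)[OF x(1)] _ D])
    show "f y + g y - P x \<bullet> y \<le> f x + g x - P x \<bullet> x" for y
      using P(2)[OF x(1)] by (simp add: is_max_def)
    show "f (x + h) \<le> f x + Q x \<bullet> h + (h \<bullet> D h) / 2 + \<eta> * (norm h)^2" if "norm h < d" for h
      using exp[OF that] by linarith
    show "g (x + h) \<le> g x + (P x - Q x) \<bullet> h - (h \<bullet> D h) / 2 + \<eta> * (norm h)^2" if "norm h < d" for h
      using exp[OF that] upper[OF P(2)[OF x(1)], of h] unfolding inner_diff_left by linarith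
  qed
qed

section \<open>Semicontinuous functions\<close>

text \<open>Formulated with neighbourhoods and for any linear order, so that it serves extended real
  functions, their real truncations and, after a change of sign, lower semicontinuous
  functions.\<close>

definition usc_map :: "'a::topological_space set \<Rightarrow> ('a \<Rightarrow> 'b::linorder) \<Rightarrow> bool" where
  "usc_map S f \<longleftrightarrow> (\<forall>x\<in>S. \<forall>c>f x. \<exists>T. open T \<and> x \<in> T \<and> (\<forall>y\<in>T \<inter> S. f y < c))"

lemma usc_mapD:
  assumes "usc_map S f" "x \<in> S" "f x < c"
  shows "\<exists>T. open T \<and> x \<in> T \<and> (\<forall>y\<in>T \<inter> S. f y < c)"
  using assms unfolding usc_map_def by simp

lemma usc_map_subset:
  assumes "usc_map S f" "T \<subseteq> S"
  shows "usc_map T f"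
  unfolding usc_map_def
proof (intro ballI allI impI)
  fix x c assume "x \<in> T" "f x < c"
  have "x \<in> S" using \<open>x \<in> T\<close> assms(2) by (rule subsetD[rotated])
  obtain U where U: "open U" "x \<in> U" "\<forall>y\<in>U \<inter> S. f y < c"
    using usc_mapD[OF assms(1) \<open>x \<in> S\<close> \<open>f x < c\<close>] by (elim exE conjE)
  have "\<forall>y\<in>U \<inter> T. f y < c" using U(3) subsetD[OF assms(2)] by simp
  then show "\<exists>U. open U \<and> x \<in> U \<and> (\<forall>y\<in>U \<inter> T. f y < c)"
    using U(1,2) by (intro exI conjI)
qed

lemma usc_map_sublevel_open:
  assumes "usc_map S f"
  shows "\<exists>T. open T \<and> T \<inter> S = {x \<in> S. f x < c}"
proof (intro exI conjI)
  let ?T = "\<Union>{T. open T \<and> (\<forall>y\<in>T \<inter> S. f y < c)}"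
  show "open ?T" by auto
  show "?T \<inter> S = {x \<in> S. f x < c}"
  proof
    show "?T \<inter> S \<subseteq> {x \<in> S. f x < c}" by auto
    show "{x \<in> S. f x < c} \<subseteq> ?T \<inter> S"
    proof
      fix x assume x: "x \<in> {x \<in> S. f x < c}"
      then have "x \<in> S" "f x < c" by auto
      then obtain U where U: "open U" "x \<in> U" "\<forall>y\<in>U \<inter> S. f y < c"
        using usc_mapD[OF assms] by blast
      then have "U \<in> {T. open T \<and> (\<forall>y\<in>T \<inter> S. f y < c)}" by simp
      then show "x \<in> ?T \<inter> S" using U(2) \<open>x \<in> S\<close> by (meson IntI UnionI)
    qed
  qed
qed

lemma usc_map_attains_max:
  assumes "compact S" "S \<noteq> {}" "usc_map S f"
  shows "\<exists>x\<in>S. \<forall>y\<in>S. f y \<le> f x"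
proof (rule ccontr)
  assume "\<not> ?thesis"
  then have no_max: "\<exists>y\<in>S. f x < f y" if "x \<in> S" for x using that not_le by blast
  have "\<forall>c. \<exists>T. open T \<and> T \<inter> S = {x \<in> S. f x < c}"
    using usc_map_sublevel_open[OF assms(3)] by simp
  from choice[OF this] obtain T where T: "\<And>c. open (T c)" "\<And>c. T c \<inter> S = {x \<in> S. f x < c}"
    by auto
  have "S \<subseteq> (\<Union>y\<in>S. T (f y))"
  proof
    fix x assume "x \<in> S"
    then obtain y where "y \<in> S" "f x < f y" using no_max by blast
    then have "x \<in> T (f y) \<inter> S" using T(2)[of "f y"] \<open>x \<in> S\<close> by simp
    then show "x \<in> (\<Union>y\<in>S. T (f y))" using \<open>y \<in> S\<close> by blast
  qed
  then obtain C where C: "C \<subseteq> S" "finite C" "S \<subseteq> (\<Union>y\<in>C. T (f y))"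
    using compactE_image[OF assms(1), of S "\<lambda>y. T (f y)"] T(1) by metis
  then have "C \<noteq> {}" using assms(2) by auto
  have "Max (f ` C) \<in> f ` C" using C(2) \<open>C \<noteq> {}\<close> by (intro Max_in) auto
  then obtain z where z: "z \<in> C" "Max (f ` C) = f z" by blast
  then obtain y where "y \<in> C" "z \<in> T (f y)" using C by blast
  then have "f z < f y" using T(2)[of "f y"] z(1) C(1) by blast
  moreover have "f y \<le> f z" using z(2) C(2) \<open>y \<in> C\<close> by (metis Max_ge finite_imageI imageI)
  ultimately show False by simp
qed

lemma usc_map_add:
  fixes f g :: "'a::topological_space \<Rightarrow> real"
  assumes "usc_map S f" "usc_map S g"
  shows "usc_map S (\<lambda>x. f x + g x)"
  unfolding usc_map_def
proof (intro ballI allI impI)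
  fix x c assume "x \<in> S" "f x + g x < c"
  define e where "e = (c - f x - g x) / 2"
  have "f x < f x + e" "g x < g x + e" using \<open>f x + g x < c\<close> by (auto simp: e_def)
  then obtain T U where "open T" "x \<in> T" "\<forall>y\<in>T \<inter> S. f y < f x + e" "open U" "x \<in> U" "\<forall>y\<in>U \<inter> S. g y < g x + e"
    using usc_mapD[OF assms(1) \<open>x \<in> S\<close>, of "f x + e"] usc_mapD[OF assms(2) \<open>x \<in> S\<close>, of "g x + e"]
    by blast
  moreover have "f x + e + (g x + e) = c" by (simp add: e_def field_simps)
  ultimately show "\<exists>T. open T \<and> x \<in> T \<and> (\<forall>y\<in>T \<inter> S. f y + g y < c)"
    by (intro exI[of _ "T \<inter> U"]) (auto simp: open_Int intro: add_strict_mono[THEN less_le_trans])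
qed

lemma usc_map_continuous:
  fixes f :: "'a::topological_space \<Rightarrow> real"
  assumes "continuous_on S f"
  shows "usc_map S f"
  unfolding usc_map_def
proof (intro ballI allI impI)
  fix x c assume "x \<in> S" "f x < c"
  obtain T where T: "open T" "T \<inter> S = f -` {..<c} \<inter> S"
    using assms open_lessThan unfolding continuous_on_open_invariant by blast
  have "x \<in> T" using T(2) \<open>x \<in> S\<close> \<open>f x < c\<close> by blast
  moreover have "f y < c" if "y \<in> T \<inter> S" for y using T(2) that by blast
  ultimately show "\<exists>T. open T \<and> x \<in> T \<and> (\<forall>y\<in>T \<inter> S. f y < c)" using T(1) by blast
qed

lemma usc_map_compose:
  assumes f: "usc_map S f" and \<phi>: "continuous_on UNIV \<phi>" "\<phi> ` T \<subseteq> S"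
  shows "usc_map T (\<lambda>x. f (\<phi> x))"
  unfolding usc_map_def
proof (intro ballI allI impI)
  fix x c assume "x \<in> T" "f (\<phi> x) < c"
  then obtain V where V: "open V" "\<phi> x \<in> V" "\<forall>y\<in>V \<inter> S. f y < c"
    using usc_mapD[OF f] \<phi>(2) by blast
  have "open (\<phi> -` V)" using \<phi>(1) V(1) by (simp add: open_vimage)
  moreover have "\<forall>y\<in>\<phi> -` V \<inter> T. f (\<phi> y) < c" using V(3) \<phi>(2) by auto
  ultimately show "\<exists>V. open V \<and> x \<in> V \<and> (\<forall>y\<in>V \<inter> T. f (\<phi> y) < c)"
    using V(2) by (intro exI[of _ "\<phi> -` V"]) simp
qed

lemma usc_map_fst: "usc_map S f \<Longrightarrow> usc_map (S \<times> S') (\<lambda>p. f (fst p))"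
  by (rule usc_map_compose) (auto intro: continuous_intros)

lemma usc_map_snd: "usc_map S' f \<Longrightarrow> usc_map (S \<times> S') (\<lambda>p. f (snd p))"
  by (rule usc_map_compose) (auto intro: continuous_intros)

text \<open>Monotonicity is asked only on a set containing the values, since the exponential
  perturbation is known to increase only on a bounded range.\<close>

lemma usc_map_compose_mono:
  fixes f :: "'a::topological_space \<Rightarrow> real" and H :: "real \<Rightarrow> real"
  assumes f: "usc_map S f" and H: "continuous_on UNIV H" "mono_on A H" and "f ` S \<subseteq> A"
  shows "usc_map S (\<lambda>x. H (f x))"
  unfolding usc_map_def
proof (intro ballI allI impI)
  fix x c assume "x \<in> S" "H (f x) < c"
  have "open (H -` {..<c})" using H(1) by (simp add: open_vimage)
  then obtain e where "0 < e" and e: "ball (f x) e \<subseteq> H -` {..<c}"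
    using \<open>H (f x) < c\<close> by (metis lessThan_iff openE vimage_eq)
  obtain T where T: "open T" "x \<in> T" "\<forall>y\<in>T \<inter> S. f y < f x + e"
    using usc_mapD[OF f \<open>x \<in> S\<close>, of "f x + e"] \<open>0 < e\<close> by auto
  have "H (f y) < c" if "y \<in> T \<inter> S" for y
  proof (cases "f y \<le> f x")
    case True
    then have "H (f y) \<le> H (f x)" using H(2) assms(4) that \<open>x \<in> S\<close> by (auto intro: mono_onD)
    then show ?thesis using \<open>H (f x) < c\<close> by simp
  next
    case False
    moreover have "f y < f x + e" using T(3) that by blast
    ultimately have "f y \<in> ball (f x) e" by (simp add: dist_real_def)
    then show ?thesis using e by blast
  qed
  then show "\<exists>T. open T \<and> x \<in> T \<and> (\<forall>y\<in>T \<inter> S. H (f y) < c)" using T by blast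
qed

text \<open>The part of \<open>T\<close> where the bound fails is compact and misses the diagonal,
  so the distance of the two components has a positive minimum on it. A set \<open>T\<close> that is
  not a product allows pairs with one component in a frontier.\<close>

lemma usc_map_less_near_diagonal:
  fixes F :: "'a::metric_space \<times> 'a \<Rightarrow> real"
  assumes "compact T" "usc_map T F" and diag: "\<And>x. (x, x) \<in> T \<Longrightarrow> F (x, x) < c"
  shows "\<exists>\<rho>>0. \<forall>x y. (x, y) \<in> T \<longrightarrow> dist x y < \<rho> \<longrightarrow> F (x, y) < c"
proof -
  obtain O' where O': "open O'" "O' \<inter> T = {p \<in> T. F p < c}" using usc_map_sublevel_open[OF assms(2), of c] by (elim exE conjE)
  define T' where "T' = T - O'"
  have "compact T'" unfolding T'_def using assms(1) O'(1) by (rule compact_diff)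
  have T': "p \<in> T' \<longleftrightarrow> p \<in> T \<and> c \<le> F p" for p unfolding T'_def using O'(2) by force
  show ?thesis
  proof (cases "T' = {}")
    case True
    then show ?thesis using T' by (intro exI[of _ 1]) force
  next
    case False
    have "continuous_on T' (\<lambda>p. dist (fst p) (snd p))" by (intro continuous_intros)
    from continuous_attains_inf[OF \<open>compact T'\<close> False this]
    obtain p where p: "p \<in> T'" "\<forall>p'\<in>T'. dist (fst p) (snd p) \<le> dist (fst p') (snd p')"
      by (elim bexE)
    have "fst p \<noteq> snd p"
    proof
      assume "fst p = snd p"
      then have "p = (fst p, fst p)" by (simp add: prod_eq_iff)
      then show False using p(1) T'[of p] diag[of "fst p"] by simp
    qed
    moreover have "F (x, y) < c" if "(x, y) \<in> T" "dist x y < dist (fst p) (snd p)" for x y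
      using bspec[OF p(2), of "(x, y)"] that T'[of "(x, y)"] by (auto simp: not_less[symmetric])
    ultimately show ?thesis by (intro exI[of _ "dist (fst p) (snd p)"]) auto
  qed
qed

section \<open>Sup-convolutions and doubled contact points\<close>

text \<open>Completing the square. The last summand no longer contains \<open>x\<close>, so
  maximising over all \<open>x\<close> leaves a problem for pairs \<open>(a, b)\<close>, and the
  optimal \<open>x\<close> is the midpoint shifted by a multiple of \<open>p\<close>.\<close>

lemma sum_square_dist_midpoint:
  fixes x a b p :: "'a::real_inner"
  assumes "c \<noteq> 0"
  shows "c * (norm (x - a))^2 + c * (norm (x - b))^2 + p \<bullet> x =
     2 * c * (norm (x - ((1/2) *\<^sub>R (a + b) - (1 / (4 * c)) *\<^sub>R p)))^2 +
     (c / 2 * (norm (a - b))^2 + p \<bullet> ((1/2) *\<^sub>R (a + b)) - (norm p)^2 / (8 * c))"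
proof -
  define u where "u = x - (1/2) *\<^sub>R (a + b)"
  define e where "e = (1/2) *\<^sub>R (a - b)"
  have ua: "x - a = u - e" and ub: "x - b = u + e"
    by (simp_all add: u_def e_def algebra_simps flip: scaleR_add_left)
  have x: "x = u + (1/2) *\<^sub>R (a + b)" by (simp add: u_def)
  have ab: "a - b = 2 *\<^sub>R e" by (simp add: e_def)
  have first: "x - ((1/2) *\<^sub>R (a + b) - (1 / (4 * c)) *\<^sub>R p) = u + (1 / (4 * c)) *\<^sub>R p" by (simp add: u_def)
  have "2 * c * (norm (u + (1 / (4 * c)) *\<^sub>R p))^2 = 2 * c * (norm u)^2 + p \<bullet> u + (norm p)^2 / (8 * c)"
    unfolding power2_norm_eq_inner using assms
    by (simp add: inner_add_left inner_add_right inner_commute field_simps power2_eq_square)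
  moreover have "c * (norm (u - e))^2 + c * (norm (u + e))^2 = 2 * c * (norm u)^2 + 2 * c * (norm e)^2"
    unfolding power2_norm_eq_inner
    by (simp add: inner_add_left inner_add_right inner_diff_left inner_diff_right algebra_simps)
  moreover have "c / 2 * (norm (2 *\<^sub>R e))^2 = 2 * c * (norm e)^2"
    by (simp add: power_mult_distrib)
  moreover have "p \<bullet> x = p \<bullet> u + p \<bullet> ((1/2) *\<^sub>R (a + b))" unfolding x by (simp add: inner_add_right)
  ultimately show ?thesis unfolding first ua ub ab by linarith
qed

lemma sup_convolution_exists:
  fixes f :: "'a::euclidean_space \<Rightarrow> real"
  assumes "compact S" "S \<noteq> {}" "usc_map S f"
  shows "\<exists>U Z. \<forall>x. Z x \<in> S \<and> U x = f (Z x) - c * (norm (x - Z x))^2 \<and>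
    (\<forall>z\<in>S. f z - c * (norm (x - z))^2 \<le> U x)"
proof -
  have "\<exists>z\<in>S. \<forall>y\<in>S. f y + - c * (norm (x - y))^2 \<le> f z + - c * (norm (x - z))^2" for x
    by (intro usc_map_attains_max assms usc_map_add usc_map_continuous continuous_intros)
  then have "\<forall>x. \<exists>z. z \<in> S \<and> (\<forall>y\<in>S. f y - c * (norm (x - y))^2 \<le> f z - c * (norm (x - z))^2)"
    by auto
  from choice[OF this] obtain Z where Z: "\<forall>x. Z x \<in> S \<and>
      (\<forall>y\<in>S. f y - c * (norm (x - y))^2 \<le> f (Z x) - c * (norm (x - Z x))^2)"
    by (elim exE)
  then show ?thesis
    by (intro exI[of _ "\<lambda>x. f (Z x) - c * (norm (x - Z x))^2"] exI[of _ Z]) simp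
qed

text \<open>\<open>U\<close> is a supremum of paraboloids of equal opening; the one that is active
  at \<open>x\<close> touches there from below and supplies the slope.\<close>

lemma sup_convolution_supported_below:
  fixes f :: "'a::real_inner \<Rightarrow> real"
  assumes "\<And>x. Z x \<in> S" "\<And>x. U x = f (Z x) - c * (norm (x - Z x))^2"
    "\<And>x z. z \<in> S \<Longrightarrow> f z - c * (norm (x - z))^2 \<le> U x"
  shows "\<exists>q. \<forall>h. U x + q \<bullet> h - c * (norm h)^2 \<le> U (x + h)"
proof (intro exI allI)
  fix h
  have "(norm (x + h - Z x))^2 = (norm (x - Z x))^2 + 2 * ((x - Z x) \<bullet> h) + (norm h)^2"
    unfolding power2_norm_eq_inner
    by (simp add: inner_add_left inner_add_right inner_diff_left inner_diff_right inner_commute)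
  then have "c * (norm (x + h - Z x))^2 = c * (norm (x - Z x))^2 + c * (2 * ((x - Z x) \<bullet> h)) + c * (norm h)^2"
    by (simp add: distrib_left)
  then show "U x + ((- 2 * c) *\<^sub>R (x - Z x)) \<bullet> h - c * (norm h)^2 \<le> U (x + h)"
    using assms(3)[OF assms(1), of x "x + h"] assms(2)[of x] by simp
qed

text \<open>The paraboloid centred at \<open>z + h\<close>, read at \<open>x + h\<close>, shows that
  \<open>f1 (z + h)\<close> minus a constant lies below \<open>U1 (x + h)\<close>, with equality for
  \<open>h = 0\<close>. So the expansions at the single contact point \<open>x\<close> translate to
  \<open>z\<close> and \<open>y\<close>. The opening \<open>c\<close> stays fixed: it only has to
  force \<open>dist z y < \<rho>\<close>.\<close>

theorem doubled_contact:
  fixes f1 f2 :: "'a::euclidean_space \<Rightarrow> real"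
  assumes "compact S" and usc: "usc_map S f1" "usc_map S f2"
    and B: "\<And>x. x \<in> S \<Longrightarrow> \<bar>f1 x\<bar> \<le> B" "\<And>x. x \<in> S \<Longrightarrow> \<bar>f2 x\<bar> \<le> B" and "x0 \<in> S"
    and pos: "0 < \<rho>" "0 < \<gamma>" "0 < \<delta>0" "0 < \<eta>"
  obtains z y p q D d where "z \<in> S" "y \<in> S" "norm p \<le> \<delta>0" "dist z y < \<rho>" "f1 x0 + f2 x0 - \<gamma> < f1 z + f2 y"
    "linear D" "0 < d"
    "\<And>h. norm h < d \<Longrightarrow> z + h \<in> S \<Longrightarrow> f1 (z + h) \<le> f1 z + q \<bullet> h + (h \<bullet> D h) / 2 + \<eta> * (norm h)^2"
    "\<And>h. norm h < d \<Longrightarrow> y + h \<in> S \<Longrightarrow> f2 (y + h) \<le> f2 y + (p - q) \<bullet> h - (h \<bullet> D h) / 2 + \<eta> * (norm h)^2"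
proof -
  have "0 \<le> B" using B(1)[OF \<open>x0 \<in> S\<close>] by simp
  obtain R where "0 < R" and R: "\<And>x. x \<in> S \<Longrightarrow> norm x \<le> R"
    using compact_imp_bounded[OF \<open>compact S\<close>] unfolding bounded_pos by blast
  \<comment> \<open>The two penalties together stay below \<open>4 * B + \<gamma>\<close>, and the
    square of \<open>dist z y\<close> is at most twice the sum of the squared distances to
    \<open>x\<close>. The final 1 gives \<open>1 \<le> c\<close>.\<close>
  define c where "c = 2 * (4 * B + \<gamma>) / \<rho>^2 + 1"
  have c1: "1 \<le> c" using \<open>0 \<le> B\<close> pos by (simp add: c_def)
  then have "0 < c" by simp
  have c\<rho>: "2 * (4 * B + \<gamma>) < c * \<rho>^2" using pos by (simp add: c_def field_simps)
  \<comment> \<open>The tilt may change values by less than \<open>\<gamma>\<close>: contact points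
    have norm at most \<open>R + 1\<close> and hence lie within \<open>2 * R + 1\<close> of
    \<open>x0\<close>.\<close>
  define \<delta> where "\<delta> = min (min \<delta>0 1) (\<gamma> / (2 * (2 * R + 1)))"
  have \<delta>: "0 < \<delta>" "\<delta> \<le> \<delta>0" "\<delta> \<le> 1" using pos \<open>0 < R\<close> by (auto simp: \<delta>_def)
  have "\<delta> \<le> \<gamma> / (2 * (2 * R + 1))" by (simp add: \<delta>_def)
  then have "\<delta> * (2 * R + 1) \<le> \<gamma> / 2" using \<open>0 < R\<close> by (simp add: field_simps)
  then have \<delta>R: "\<delta> * (2 * R + 1) < \<gamma>" using pos by linarith
  have "S \<noteq> {}" using \<open>x0 \<in> S\<close> by blast
  obtain U1 Z1 where conv1: "\<forall>x. Z1 x \<in> S \<and> U1 x = f1 (Z1 x) - c * (norm (x - Z1 x))^2 \<and>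
      (\<forall>z\<in>S. f1 z - c * (norm (x - z))^2 \<le> U1 x)"
    using sup_convolution_exists[OF \<open>compact S\<close> \<open>S \<noteq> {}\<close> usc(1), of c] by (elim exE)
  have Z1: "Z1 x \<in> S" and U1: "U1 x = f1 (Z1 x) - c * (norm (x - Z1 x))^2" for x
    using spec[OF conv1, of x] by blast+
  have le1: "f1 z - c * (norm (x - z))^2 \<le> U1 x" if "z \<in> S" for x z
    using spec[OF conv1, of x] that by blast
  obtain U2 Z2 where conv2: "\<forall>x. Z2 x \<in> S \<and> U2 x = f2 (Z2 x) - c * (norm (x - Z2 x))^2 \<and>
      (\<forall>z\<in>S. f2 z - c * (norm (x - z))^2 \<le> U2 x)"
    using sup_convolution_exists[OF \<open>compact S\<close> \<open>S \<noteq> {}\<close> usc(2), of c] by (elim exE)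
  have Z2: "Z2 x \<in> S" and U2: "U2 x = f2 (Z2 x) - c * (norm (x - Z2 x))^2" for x
    using spec[OF conv2, of x] by blast+
  have le2: "f2 z - c * (norm (x - z))^2 \<le> U2 x" if "z \<in> S" for x z
    using spec[OF conv2, of x] that by blast
  define X where "X p a b = (1/2) *\<^sub>R (a + b) - (1 / (4 * c)) *\<^sub>R p" for p a b :: 'a
  define m where "m p a b = c / 2 * (norm (a - b))^2 + p \<bullet> ((1/2) *\<^sub>R (a + b)) - (norm p)^2 / (8 * c)" for p a b :: 'a
  have split: "c * (norm (x - a))^2 + c * (norm (x - b))^2 + p \<bullet> x = 2 * c * (norm (x - X p a b))^2 + m p a b" for x a b p
    unfolding X_def m_def by (rule sum_square_dist_midpoint) (use \<open>0 < c\<close> in simp)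
  \<comment> \<open>The convolutions live on the whole space, where a maximum is not automatic;
    eliminating \<open>x\<close> by the square identity moves the problem to the compact
    \<open>S \<times> S\<close>.\<close>
  have attained: "\<exists>x. \<forall>y. U1 y + U2 y - p \<bullet> y \<le> U1 x + U2 x - p \<bullet> x" for p
  proof -
    have "\<exists>ab\<in>S \<times> S. \<forall>ab'\<in>S \<times> S. f1 (fst ab') + f2 (snd ab') + - m p (fst ab') (snd ab')
        \<le> f1 (fst ab) + f2 (snd ab) + - m p (fst ab) (snd ab)"
      unfolding m_def
      by (intro usc_map_attains_max usc_map_add usc_map_fst usc_map_snd usc usc_map_continuous
          continuous_intros compact_Times \<open>compact S\<close>) (use \<open>S \<noteq> {}\<close> \<open>0 < c\<close> in auto)
    then obtain a b where ab: "a \<in> S" "b \<in> S"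
      and max: "\<And>a' b'. a' \<in> S \<Longrightarrow> b' \<in> S \<Longrightarrow> f1 a' + f2 b' - m p a' b' \<le> f1 a + f2 b - m p a b"
      by auto
    have "U1 y + U2 y - p \<bullet> y \<le> U1 (X p a b) + U2 (X p a b) - p \<bullet> X p a b" for y
    proof -
      have "0 \<le> 2 * c * (norm (y - X p (Z1 y) (Z2 y)))^2" using \<open>0 < c\<close> by simp
      then have "U1 y + U2 y - p \<bullet> y \<le> f1 (Z1 y) + f2 (Z2 y) - m p (Z1 y) (Z2 y)"
        using split[of y "Z1 y" "Z2 y" p] U1[of y] U2[of y] by linarith
      also have "\<dots> \<le> f1 a + f2 b - m p a b" by (rule max[OF Z1 Z2])
      also have "\<dots> \<le> U1 (X p a b) + U2 (X p a b) - p \<bullet> X p a b"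
        using split[of "X p a b" a b p] le1[OF ab(1), of "X p a b"] le2[OF ab(2), of "X p a b"] by simp
      finally show ?thesis .
    qed
    then show ?thesis by blast
  qed
  show thesis
  proof (rule contact_second_order_expansion[of c U1 U2 \<delta> \<eta>])
    show "\<exists>q. \<forall>h. U1 x + q \<bullet> h - c * (norm h)^2 \<le> U1 (x + h)" for x
      by (rule sup_convolution_supported_below[of Z1 S U1 f1, OF Z1 U1 le1])
    show "\<exists>q. \<forall>h. U2 x + q \<bullet> h - c * (norm h)^2 \<le> U2 (x + h)" for x
      by (rule sup_convolution_supported_below[of Z2 S U2 f2, OF Z2 U2 le2])
    fix x p q D d assume p: "norm p \<le> \<delta>" and max: "\<And>y. U1 y + U2 y - p \<bullet> y \<le> U1 x + U2 x - p \<bullet> x"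
      and D: "linear D" "0 < d"
      and exp1: "\<And>h. norm h < d \<Longrightarrow> U1 (x + h) \<le> U1 x + q \<bullet> h + (h \<bullet> D h) / 2 + \<eta> * (norm h)^2"
      and exp2: "\<And>h. norm h < d \<Longrightarrow> U2 (x + h) \<le> U2 x + (p - q) \<bullet> h - (h \<bullet> D h) / 2 + \<eta> * (norm h)^2"
    define z y where "z = Z1 x" and "y = Z2 x"
    have zy: "z \<in> S" "y \<in> S" using Z1 Z2 by (auto simp: z_def y_def)
    have Ux: "U1 x = f1 z - c * (norm (x - z))^2" "U2 x = f2 y - c * (norm (x - y))^2"
      using U1[of x] U2[of x] by (auto simp: z_def y_def)
    \<comment> \<open>The maximal value is attained with the pair \<open>(z, y)\<close>, for which
      \<open>X p z y\<close> is the only optimal point. This locates \<open>x\<close>, which may lie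
      outside \<open>S\<close>.\<close>
    have "x = X p z y"
    proof -
      let ?x = "X p z y"
      have "U1 ?x + U2 ?x - p \<bullet> ?x \<le> U1 x + U2 x - p \<bullet> x" by (rule max)
      then have "2 * c * (norm (x - ?x))^2 \<le> 0"
        using split[of ?x z y p] split[of x z y p] le1[OF zy(1), of ?x] le2[OF zy(2), of ?x] Ux by simp
      then have "(norm (x - ?x))^2 \<le> 0" using \<open>0 < c\<close> by (simp add: mult_le_0_iff)
      then show ?thesis by simp
    qed
    have "norm x \<le> R + 1"
    proof -
      have "norm x \<le> norm ((1/2) *\<^sub>R (z + y)) + norm ((1 / (4 * c)) *\<^sub>R p)"
        by (subst \<open>x = X p z y\<close>) (simp only: X_def norm_triangle_ineq4)
      moreover have "norm ((1/2) *\<^sub>R (z + y)) \<le> R"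
        using norm_triangle_ineq[of z y] R[OF zy(1)] R[OF zy(2)] by simp
      moreover have "norm ((1 / (4 * c)) *\<^sub>R p) \<le> 1"
      proof -
        have "norm p \<le> 1" using p \<delta>(3) by linarith
        then have "norm p \<le> 4 * c" using c1 by linarith
        then show ?thesis using \<open>0 < c\<close> by simp
      qed
      ultimately show ?thesis by linarith
    qed
    have "norm (x0 - x) \<le> 2 * R + 1"
      using norm_triangle_ineq4[of x0 x] \<open>norm x \<le> R + 1\<close> R[OF \<open>x0 \<in> S\<close>] by linarith
    then have "norm p * norm (x0 - x) \<le> \<delta> * (2 * R + 1)"
      using p \<delta>(1) by (intro mult_mono) auto
    then have "\<bar>p \<bullet> (x0 - x)\<bar> < \<gamma>"
      using Cauchy_Schwarz_ineq2[of p "x0 - x"] \<delta>R by linarith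
    then have "p \<bullet> x0 - p \<bullet> x < \<gamma>" by (simp add: inner_diff_right)
    then have key: "f1 x0 + f2 x0 - \<gamma> < f1 z + f2 y - c * (norm (x - z))^2 - c * (norm (x - y))^2"
      using max[of x0] Ux le1[OF \<open>x0 \<in> S\<close>, of x0] le2[OF \<open>x0 \<in> S\<close>, of x0] by simp
    have "0 \<le> c * (norm (x - z))^2" "0 \<le> c * (norm (x - y))^2" using \<open>0 < c\<close> by auto
    then have close_value: "f1 x0 + f2 x0 - \<gamma> < f1 z + f2 y" using key by linarith
    have "2 * (c * (norm (x - z))^2 + c * (norm (x - y))^2) < 2 * (4 * B + \<gamma>)"
    proof -
      have "c * (norm (x - z))^2 + c * (norm (x - y))^2 < 4 * B + \<gamma>"
      using key B(1)[OF \<open>x0 \<in> S\<close>] B(2)[OF \<open>x0 \<in> S\<close>] B(1)[OF zy(1)] B(2)[OF zy(2)] by linarith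
      then show ?thesis by simp
    qed
    moreover have "(norm (z - y))^2 \<le> 2 * (norm (x - z))^2 + 2 * (norm (x - y))^2"
    proof -
      have "(norm (z - y))^2 \<le> (norm (x - z) + norm (x - y))^2"
        using norm_triangle_ineq4[of "x - y" "x - z"] by (intro power_mono) auto
      also have "\<dots> \<le> 2 * (norm (x - z))^2 + 2 * (norm (x - y))^2"
        using sum_squares_bound[of "norm (x - z)" "norm (x - y)"] by (simp add: power2_sum)
      finally show ?thesis .
    qed
    then have "c * (norm (z - y))^2 \<le> 2 * (c * (norm (x - z))^2 + c * (norm (x - y))^2)"
      using mult_left_mono[of _ _ c] \<open>0 < c\<close> by (fastforce simp: algebra_simps)
    ultimately have "c * (norm (z - y))^2 < c * \<rho>^2" using c\<rho> by (meson le_less_trans less_trans)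
    then have "(norm (z - y))^2 < \<rho>^2" using \<open>0 < c\<close> by simp
    then have "norm (z - y) < \<rho>" using pos(1) by (simp add: power_less_imp_less_base)
    then have close: "dist z y < \<rho>" by (simp add: dist_norm)
    show thesis
    proof (rule that[OF zy _ close close_value D])
      show "norm p \<le> \<delta>0" using p \<delta>(2) by linarith
      show "f1 (z + h) \<le> f1 z + q \<bullet> h + (h \<bullet> D h) / 2 + \<eta> * (norm h)^2" if "norm h < d" "z + h \<in> S" for h
        using le1[OF that(2), of "x + h"] exp1[OF that(1)] Ux(1) by simp
      show "f2 (y + h) \<le> f2 y + (p - q) \<bullet> h - (h \<bullet> D h) / 2 + \<eta> * (norm h)^2" if "norm h < d" "y + h \<in> S" for h
        using le2[OF that(2), of "x + h"] exp2[OF that(1)] Ux(2) by simp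
    qed
  qed (use \<open>0 < c\<close> \<delta>(1) pos attained in auto)
qed

section \<open>Quadratic test functions and jets\<close>

lemma quadratic_form_outer_prod:
  fixes y :: "real ^ 'n"
  shows "y \<bullet> (outer_prod p p *v y) = (p \<bullet> y)^2"
proof -
  have "outer_prod p p *v y = (p \<bullet> y) *\<^sub>R p"
    by (simp add: vec_eq_iff outer_prod_def matrix_vector_mult_def inner_vec_def sum_distrib_left mult_ac)
  then show ?thesis by (simp add: power2_eq_square inner_commute)
qed

lemma quadratic_form_add:
  fixes y :: "real ^ 'n"
  shows "y \<bullet> ((A + B) *v y) = y \<bullet> (A *v y) + y \<bullet> (B *v y)"
  by (simp add: matrix_vector_mult_add_rdistrib inner_add_right)

lemma quadratic_form_diff:
  fixes y :: "real ^ 'n"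
  shows "y \<bullet> ((A - B) *v y) = y \<bullet> (A *v y) - y \<bullet> (B *v y)"
  by (simp add: matrix_vector_mult_diff_rdistrib inner_diff_right)

lemma quadratic_form_scaleR:
  fixes y :: "real ^ 'n"
  shows "y \<bullet> ((c *\<^sub>R A) *v y) = c * (y \<bullet> (A *v y))"
  by (simp flip: scaleR_matrix_vector_assoc)

lemma quadratic_form_mat_1:
  fixes y :: "real ^ 'n"
  shows "y \<bullet> (mat 1 *v y) = (norm y)^2"
  by (simp add: power2_norm_eq_inner)

lemma quadratic_form_L_op:
  fixes y :: "real ^ 'n"
  shows "y \<bullet> (L_op \<alpha> \<beta> x s p *v y) = \<alpha> x s * (p \<bullet> y)^2 - \<beta> x s * (norm p)^2 * (norm y)^2"
  unfolding L_op_def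
  by (simp only: quadratic_form_diff quadratic_form_scaleR quadratic_form_outer_prod quadratic_form_mat_1)

lemmas quadratic_form_simps = quadratic_form_add quadratic_form_diff quadratic_form_scaleR
  quadratic_form_outer_prod quadratic_form_mat_1 quadratic_form_L_op

lemma sym_matrices_closed_ops:
  "A \<in> sym_matrices \<Longrightarrow> B \<in> sym_matrices \<Longrightarrow> A + B \<in> sym_matrices"
  "A \<in> sym_matrices \<Longrightarrow> B \<in> sym_matrices \<Longrightarrow> A - B \<in> sym_matrices"
  "A \<in> sym_matrices \<Longrightarrow> c *\<^sub>R A \<in> sym_matrices"
  "outer_prod p p \<in> sym_matrices" "mat 1 \<in> sym_matrices"
  by (auto simp: sym_matrices_def transpose_def vec_eq_iff outer_prod_def mat_def mult.commute)

text \<open>The linear map of an expansion need not be symmetric, but only its quadratic form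
  enters, so it can be symmetrised to serve as a Hessian.\<close>

lemma symmetric_matrix_of_linear:
  fixes D :: "real ^ 'n \<Rightarrow> real ^ 'n"
  assumes "linear D"
  shows "\<exists>X\<in>sym_matrices. \<forall>h. h \<bullet> (X *v h) = h \<bullet> D h"
proof
  let ?X = "(1/2) *\<^sub>R (matrix D + transpose (matrix D))"
  show "?X \<in> sym_matrices"
    by (auto simp: sym_matrices_def transpose_def vec_eq_iff add.commute)
  have "h \<bullet> (transpose (matrix D) *v h) = h \<bullet> (matrix D *v h)" for h
    by (simp add: dot_lmul_matrix[symmetric] inner_commute)
  moreover have "matrix D *v h = D h" for h using assms by (simp add: matrix_works)
  ultimately show "\<forall>h. h \<bullet> (?X *v h) = h \<bullet> D h"
    by (simp only: quadratic_form_simps) simp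
qed

section \<open>Quadratic polynomials as test functions\<close>

lemma grad_eqI:
  assumes "GDERIV \<phi> x :> g"
  shows "grad \<phi> x = g"
  unfolding grad_def
proof (rule the_equality)
  show "GDERIV \<phi> x :> g" by (rule assms)
  fix g' assume "GDERIV \<phi> x :> g'"
  then have "(\<lambda>h. h \<bullet> g') = (\<lambda>h. h \<bullet> g)"
    using assms unfolding gderiv_def by (rule has_derivative_unique)
  then have "(g' - g) \<bullet> g' = (g' - g) \<bullet> g" by (rule fun_cong)
  then have "(g' - g) \<bullet> (g' - g) = 0" by (simp add: inner_diff_right)
  then show "g' = g" by simp
qed

context
  fixes s :: real and q z :: "real ^ 'n" and A :: "real ^ 'n ^ 'n" and \<phi> :: "real ^ 'n \<Rightarrow> real"
  assumes sym: "A \<in> sym_matrices"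
    and \<phi>: "\<phi> = (\<lambda>y. s + q \<bullet> (y - z) + ((y - z) \<bullet> (A *v (y - z))) / 2)"
begin

lemma quadratic_GDERIV: "GDERIV \<phi> x :> q + A *v (x - z)"
proof -
  have symm: "(x - z) \<bullet> (A *v h) = h \<bullet> (A *v (x - z))" for h
    using sym dot_lmul_matrix[of "x - z" A h] by (simp add: sym_matrices_def inner_commute transpose_matrix_vector[symmetric])
  have 1: "((\<lambda>y. y - z) has_derivative (\<lambda>h. h)) (at x)"
    by (auto intro!: derivative_eq_intros)
  have 2: "((\<lambda>y. A *v (y - z)) has_derivative (\<lambda>h. A *v h)) (at x)"
    by (rule bounded_linear.has_derivative[OF matrix_vector_mul_bounded_linear 1])
  have 3: "((\<lambda>y. (y - z) \<bullet> (A *v (y - z))) has_derivative (\<lambda>h. (x - z) \<bullet> (A *v h) + h \<bullet> (A *v (x - z)))) (at x)"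
    by (rule has_derivative_inner[OF 1 2])
  have 4: "((\<lambda>y. q \<bullet> (y - z)) has_derivative (\<lambda>h. q \<bullet> h)) (at x)"
    by (rule bounded_linear.has_derivative[OF bounded_linear_inner_right 1])
  have "(\<phi> has_derivative (\<lambda>h. 0 + q \<bullet> h + ((x - z) \<bullet> (A *v h) + h \<bullet> (A *v (x - z))) / 2)) (at x)"
    unfolding \<phi>
    by (intro has_derivative_add has_derivative_const 4 bounded_linear.has_derivative[OF bounded_linear_divide 3])
  moreover have "(\<lambda>h. 0 + q \<bullet> h + ((x - z) \<bullet> (A *v h) + h \<bullet> (A *v (x - z))) / 2) = (\<lambda>h. h \<bullet> (q + A *v (x - z)))"
    unfolding symm by (simp add: inner_add_right inner_commute)
  ultimately show ?thesis unfolding gderiv_def by simp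
qed

lemma quadratic_grad: "grad \<phi> = (\<lambda>x. q + A *v (x - z))"
  using grad_eqI[OF quadratic_GDERIV] by blast

lemma quadratic_grad_has_derivative: "(grad \<phi> has_derivative ((*v) A)) (at x)"
proof -
  have 1: "((\<lambda>y. y - z) has_derivative (\<lambda>h. h)) (at x)"
    by (auto intro!: derivative_eq_intros)
  have "((\<lambda>y. q + A *v (y - z)) has_derivative (\<lambda>h. 0 + A *v h)) (at x)"
    by (intro has_derivative_add has_derivative_const bounded_linear.has_derivative[OF matrix_vector_mul_bounded_linear 1])
  then show ?thesis by (simp add: quadratic_grad)
qed

lemma quadratic_hess: "hess \<phi> x = A"
  unfolding hess_def jacobian_def
  using frechet_derivative_at[OF quadratic_grad_has_derivative[of x], symmetric] by simp

lemma quadratic_C2_on: "C2_on \<Omega> \<phi>"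
  unfolding C2_on_def quadratic_hess[abs_def]
  using quadratic_GDERIV quadratic_grad_has_derivative unfolding gderiv_def differentiable_def by auto

lemma quadratic_F_op: "F_op \<alpha> \<beta> \<phi> z = A + L_op \<alpha> \<beta> z s q"
  unfolding F_op_def L_op_def quadratic_hess quadratic_grad by (simp add: \<phi>)

end

text \<open>The jet inequality makes a quadratic polynomial an admissible test function whose
  derivatives at the centre can be read off. From here on the viscosity conditions are used only in
  this form.\<close>

lemma visc_subsolution_jet:
  assumes "visc_subsolution (F_op \<alpha> \<beta>) U \<Omega> v" "z \<in> \<Omega>" "A \<in> sym_matrices" "v z = ereal s" "0 < d"
    and jet: "\<And>h. norm h < d \<Longrightarrow> z + h \<in> \<Omega> \<Longrightarrow> v (z + h) \<le> ereal (s + q \<bullet> h + (h \<bullet> (A *v h)) / 2)"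
  shows "A + L_op \<alpha> \<beta> z s q \<in> closure U"
proof -
  define \<phi> where "\<phi> = (\<lambda>y. s + q \<bullet> (y - z) + ((y - z) \<bullet> (A *v (y - z))) / 2)"
  have "v y \<le> ereal (\<phi> y)" if "y \<in> \<Omega>" "dist y z < d" for y
    using jet[of "y - z"] that by (simp add: \<phi>_def dist_norm)
  then have "\<forall>\<^sub>F y in at z within \<Omega>. v y \<le> ereal (\<phi> y)"
    unfolding eventually_at using \<open>0 < d\<close> by blast
  moreover have "v z = ereal (\<phi> z)" using assms(4) by (simp add: \<phi>_def)
  ultimately have "F_op \<alpha> \<beta> \<phi> z \<in> closure U"
    using assms(1,2) quadratic_C2_on[OF assms(3) \<phi>_def] unfolding visc_subsolution_def by blast
  then show ?thesis by (simp add: quadratic_F_op[OF assms(3) \<phi>_def])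
qed

lemma visc_supersolution_jet:
  assumes "visc_supersolution (F_op \<alpha> \<beta>) U \<Omega> w" "z \<in> \<Omega>" "A \<in> sym_matrices" "w z = ereal s" "0 < d"
    and jet: "\<And>h. norm h < d \<Longrightarrow> z + h \<in> \<Omega> \<Longrightarrow> ereal (s + q \<bullet> h + (h \<bullet> (A *v h)) / 2) \<le> w (z + h)"
  shows "A + L_op \<alpha> \<beta> z s q \<in> sym_matrices - U"
proof -
  define \<phi> where "\<phi> = (\<lambda>y. s + q \<bullet> (y - z) + ((y - z) \<bullet> (A *v (y - z))) / 2)"
  have "ereal (\<phi> y) \<le> w y" if "y \<in> \<Omega>" "dist y z < d" for y
    using jet[of "y - z"] that by (simp add: \<phi>_def dist_norm)
  then have "\<forall>\<^sub>F y in at z within \<Omega>. ereal (\<phi> y) \<le> w y"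
    unfolding eventually_at using \<open>0 < d\<close> by blast
  moreover have "w z = ereal (\<phi> z)" using assms(4) by (simp add: \<phi>_def)
  ultimately have "F_op \<alpha> \<beta> \<phi> z \<in> sym_matrices - U"
    using assms(1,2) quadratic_C2_on[OF assms(3) \<phi>_def] unfolding visc_supersolution_def by blast
  then show ?thesis by (simp add: quadratic_F_op[OF assms(3) \<phi>_def])
qed

section \<open>Jets under the exponential change of the unknown\<close>

lemma exp_lower_quadratic:
  fixes x :: real
  assumes "\<bar>x\<bar> \<le> 1"
  shows "1 + x + x^2 / 2 - 2 * \<bar>x\<bar> ^ 3 \<le> exp x"
proof -
  have "\<bar>exp x - (1 + x + x^2 / 2)\<bar> \<le> exp \<bar>x\<bar> * \<bar>x\<bar> ^ 3 / 2"
    using Taylor_exp_field[of x 2] by (simp add: numeral_eq_Suc field_simps)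
  moreover have "exp \<bar>x\<bar> \<le> 3" using exp_le assms by (meson exp_le_cancel_iff order_trans)
  then have "exp \<bar>x\<bar> * \<bar>x\<bar> ^ 3 / 2 \<le> 2 * \<bar>x\<bar> ^ 3"
    using mult_right_mono[of "exp \<bar>x\<bar>" 4 "\<bar>x\<bar> ^ 3"] by simp
  ultimately show ?thesis by linarith
qed

text \<open>The hypotheses on \<open>a\<close> and \<open>b\<close> are the chain rule for
  \<open>H (v) + \<nu> |x|^2\<close>, with a surplus of \<open>4 * \<eta>\<close> in
  \<open>b\<close>. Instead of inverting \<open>H\<close>, suppose that \<open>v (z + h)\<close>
  exceeds the candidate: then \<open>H\<close> of the candidate lies below the bound of the given
  jet, while a second order lower bound for the exponential puts it above. Half the surplus,
  \<open>2 * \<eta>\<close>, enters the candidate: \<open>\<eta>\<close> pays for the error of the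
  given jet, \<open>\<eta>\<close> for the cubic terms.\<close>

lemma jet_of_exponential_perturbation:
  fixes v :: "'a::real_inner \<Rightarrow> real" and b m :: "'a \<Rightarrow> real" and \<mu> k :: real
  defines "H \<equiv> \<lambda>t. t + \<mu> * exp (k * t)"
  assumes "0 < \<mu>" "0 < \<eta>" "0 < d"
    and mono: "\<And>t t'. l \<le> t \<Longrightarrow> t < t' \<Longrightarrow> t' \<le> r \<Longrightarrow> H t < H t'"
    and range: "\<And>h. z + h \<in> S \<Longrightarrow> v (z + h) \<le> r" and "l < v z" "v z < r"
    and jet: "\<And>h. norm h < d \<Longrightarrow> z + h \<in> S \<Longrightarrow>
       H (v (z + h)) + \<nu> * (norm (z + h))^2 \<le> H (v z) + \<nu> * (norm z)^2 + q \<bullet> h + m h / 2 + \<eta> * (norm h)^2"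
    and a: "(1 + \<mu> * k * exp (k * v z)) *\<^sub>R a = q - (2 * \<nu>) *\<^sub>R z"
    and b: "\<And>h. (1 + \<mu> * k * exp (k * v z)) * b h = m h + 4 * \<eta> * (norm h)^2 - 2 * \<nu> * (norm h)^2 - \<mu> * k^2 * exp (k * v z) * (a \<bullet> h)^2"
    and b_bound: "\<And>h. \<bar>b h\<bar> \<le> b' * (norm h)^2"
    and "0 \<le> b'"
  shows "\<exists>d'>0. \<forall>h. norm h < d' \<longrightarrow> z + h \<in> S \<longrightarrow> v (z + h) \<le> v z + a \<bullet> h + b h / 2"
proof -
  define s e where "s = v z" and "e = exp (k * s)"
  have "0 < e" by (simp add: e_def)
  define c where "c = norm a + b'"
  have "0 \<le> c" using \<open>0 \<le> b'\<close> by (simp add: c_def)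
  define M where "M = \<mu> * k^2 * e * c * b' + 2 * \<mu> * e * \<bar>k\<bar> ^ 3 * c ^ 3"
  have "0 \<le> M" using \<open>0 < \<mu>\<close> \<open>0 < e\<close> \<open>0 \<le> c\<close> \<open>0 \<le> b'\<close> by (simp add: M_def)
  define d' where "d' = Min {d, 1, (s - l) / (c + 1), (r - s) / (c + 1), 1 / (\<bar>k\<bar> * c + 1), \<eta> / (M + 1)}"
  have kc: "0 < \<bar>k\<bar> * c + 1" using \<open>0 \<le> c\<close> by (simp add: add_nonneg_pos)
  have "0 < d'"
    using kc \<open>0 < d\<close> \<open>0 < \<eta>\<close> \<open>0 \<le> M\<close> \<open>0 \<le> c\<close> \<open>l < v z\<close> \<open>v z < r\<close> by (simp add: d'_def s_def)
  moreover have "v (z + h) \<le> s + a \<bullet> h + b h / 2" if h: "norm h < d'" "z + h \<in> S" for h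
  proof (rule ccontr)
    assume neg: "\<not> ?thesis"
    define n where "n = norm h"
    define \<kappa> where "\<kappa> = a \<bullet> h + b h / 2"
    have big: "s + \<kappa> < v (z + h)" using neg by (simp add: \<kappa>_def)
    have "0 \<le> n" "n < 1" "n < d" and n3: "n < (s - l) / (c + 1)" "n < (r - s) / (c + 1)"
      "n < 1 / (\<bar>k\<bar> * c + 1)" "n < \<eta> / (M + 1)"
      using h(1) by (auto simp: d'_def n_def)
    have n2: "n^2 \<le> n" using \<open>0 \<le> n\<close> \<open>n < 1\<close> by (simp add: power2_eq_square mult_left_le_one_le)
    have ah: "\<bar>a \<bullet> h\<bar> \<le> norm a * n" unfolding n_def by (rule Cauchy_Schwarz_ineq2)
    have bh: "\<bar>b h\<bar> \<le> b' * n^2" unfolding n_def by (rule b_bound)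
    have bh': "b' * n^2 \<le> b' * n" using n2 \<open>0 \<le> b'\<close> by (rule mult_left_mono)
    have \<kappa>n: "\<bar>\<kappa>\<bar> \<le> c * n"
      using ah bh bh' unfolding \<kappa>_def c_def by (simp add: distrib_right)
    have n4: "n * (c + 1) < s - l" "n * (c + 1) < r - s" "n * (\<bar>k\<bar> * c + 1) < 1" "n * (M + 1) < \<eta>"
      using n3 kc \<open>0 \<le> c\<close> \<open>0 \<le> M\<close> by (simp_all add: pos_less_divide_eq)
    then have cn: "c * n < s - l" "c * n < r - s" "\<bar>k\<bar> * (c * n) < 1" and Mn: "M * n \<le> \<eta>"
      using \<open>0 \<le> n\<close> by (auto simp: algebra_simps)
    have "\<bar>k * \<kappa>\<bar> \<le> 1"
      using mult_left_mono[OF \<kappa>n abs_ge_zero[of k]] cn(3) by (simp add: abs_mult)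
    have "l \<le> s + \<kappa>" using \<kappa>n cn(1) by linarith
    then have HH: "H (s + \<kappa>) < H (v (z + h))" using mono[OF _ big range[OF h(2)]] by simp
    have "exp (k * (s + \<kappa>)) = e * exp (k * \<kappa>)" by (simp add: e_def distrib_left exp_add)
    moreover have "e * (1 + k * \<kappa> + (k * \<kappa>)^2 / 2 - 2 * \<bar>k * \<kappa>\<bar> ^ 3) \<le> e * exp (k * \<kappa>)"
      using exp_lower_quadratic[OF \<open>\<bar>k * \<kappa>\<bar> \<le> 1\<close>] \<open>0 < e\<close> by (intro mult_left_mono) auto
    ultimately have "\<mu> * (e * (1 + k * \<kappa> + (k * \<kappa>)^2 / 2 - 2 * \<bar>k * \<kappa>\<bar> ^ 3)) \<le> \<mu> * exp (k * (s + \<kappa>))"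
      using \<open>0 < \<mu>\<close> by (intro mult_left_mono) auto
    moreover have "\<mu> * (e * (1 + k * \<kappa> + (k * \<kappa>)^2 / 2 - 2 * \<bar>k * \<kappa>\<bar> ^ 3)) =
      \<mu> * e + \<mu> * k * e * \<kappa> + \<mu> * k^2 * e * \<kappa>^2 / 2 - 2 * \<mu> * e * (\<bar>k\<bar> ^ 3 * \<bar>\<kappa>\<bar> ^ 3)"
      by (simp add: algebra_simps power_mult_distrib abs_mult)
    moreover have "H (s + \<kappa>) = s + \<kappa> + \<mu> * exp (k * (s + \<kappa>))" "H s = s + \<mu> * e"
      by (simp_all add: H_def e_def)
    moreover have "(1 + \<mu> * k * e) * \<kappa> = \<kappa> + \<mu> * k * e * \<kappa>" by (simp add: distrib_right)
    ultimately have low: "H s + (1 + \<mu> * k * e) * \<kappa> + \<mu> * k^2 * e * \<kappa>^2 / 2 - 2 * \<mu> * e * (\<bar>k\<bar> ^ 3 * \<bar>\<kappa>\<bar> ^ 3) \<le> H (s + \<kappa>)"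
      by linarith
    have lin: "(1 + \<mu> * k * e) * \<kappa> = q \<bullet> h - 2 * \<nu> * (z \<bullet> h) + m h / 2 + 2 * \<eta> * n^2 - \<nu> * n^2 - \<mu> * k^2 * e * (a \<bullet> h)^2 / 2"
    proof -
      have "(1 + \<mu> * k * e) * (a \<bullet> h) = q \<bullet> h - 2 * \<nu> * (z \<bullet> h)"
        using arg_cong[OF a, of "\<lambda>x. x \<bullet> h"] by (simp add: inner_diff_left e_def s_def)
      moreover have "(1 + \<mu> * k * e) * b h = m h + 4 * \<eta> * n^2 - 2 * \<nu> * n^2 - \<mu> * k^2 * e * (a \<bullet> h)^2"
        using b[of h] by (simp add: e_def s_def n_def)
      ultimately show ?thesis by (simp add: \<kappa>_def distrib_left)
    qed
    have sq: "(a \<bullet> h)^2 - c * b' * n ^ 3 \<le> \<kappa>^2"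
    proof -
      have "\<kappa>^2 = (a \<bullet> h)^2 + (a \<bullet> h) * b h + (b h / 2)^2"
        by (simp add: \<kappa>_def power2_sum)
      moreover have "\<bar>(a \<bullet> h) * b h\<bar> \<le> (norm a * n) * (b' * n^2)"
        unfolding abs_mult using ah bh \<open>0 \<le> n\<close> by (intro mult_mono) auto
      moreover have "(norm a * n) * (b' * n^2) \<le> c * b' * n ^ 3"
      proof -
        have "(norm a * n) * (b' * n^2) = norm a * (b' * n ^ 3)" by (simp add: power2_eq_square power3_eq_cube)
        also have "\<dots> \<le> c * (b' * n ^ 3)" using \<open>0 \<le> b'\<close> \<open>0 \<le> n\<close> by (intro mult_right_mono) (auto simp: c_def)
        finally show ?thesis by simp
      qed
      ultimately show ?thesis using zero_le_power2[of "b h / 2"] by linarith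
    qed
    have "\<mu> * k^2 * e / 2 * ((a \<bullet> h)^2 - c * b' * n ^ 3) \<le> \<mu> * k^2 * e / 2 * \<kappa>^2"
      using sq \<open>0 < \<mu>\<close> \<open>0 < e\<close> by (intro mult_left_mono) auto
    moreover have "0 \<le> \<mu> * k^2 * e * c * b' * n ^ 3"
      using \<open>0 < \<mu>\<close> \<open>0 < e\<close> \<open>0 \<le> c\<close> \<open>0 \<le> b'\<close> \<open>0 \<le> n\<close> by simp
    moreover have "2 * \<mu> * e * (\<bar>k\<bar> ^ 3 * \<bar>\<kappa>\<bar> ^ 3) \<le> 2 * \<mu> * e * (\<bar>k\<bar> ^ 3 * (c * n) ^ 3)"
      using power_mono[OF \<kappa>n, of 3] \<open>0 < \<mu>\<close> \<open>0 < e\<close> by (intro mult_left_mono) auto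
    ultimately have rem: "\<mu> * k^2 * e * (a \<bullet> h)^2 / 2 - M * n ^ 3 \<le> \<mu> * k^2 * e * \<kappa>^2 / 2 - 2 * \<mu> * e * (\<bar>k\<bar> ^ 3 * \<bar>\<kappa>\<bar> ^ 3)"
      by (simp add: M_def algebra_simps power_mult_distrib)
    have "M * n ^ 3 \<le> \<eta> * n^2"
      using mult_right_mono[OF Mn, of "n^2"] by (simp add: power2_eq_square power3_eq_cube mult.assoc)
    moreover have "(norm (z + h))^2 = (norm z)^2 + 2 * (z \<bullet> h) + n^2"
      unfolding n_def power2_norm_eq_inner by (simp add: inner_add_left inner_add_right inner_commute)
    then have "\<nu> * (norm (z + h))^2 = \<nu> * (norm z)^2 + 2 * \<nu> * (z \<bullet> h) + \<nu> * n^2"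
      by (simp add: distrib_left)
    moreover have "H (v (z + h)) + \<nu> * (norm (z + h))^2 \<le> H s + \<nu> * (norm z)^2 + q \<bullet> h + m h / 2 + \<eta> * n^2"
      using jet[of h] h(2) \<open>n < d\<close> by (simp add: n_def s_def)
    ultimately show False using HH low lin rem by linarith
  qed
  ultimately show ?thesis by (auto simp: s_def)
qed

text \<open>\<open>A\<close> and \<open>X\<close> stand for \<open>a \<bullet> u\<close> and
  \<open>\<epsilon> \<bullet> u\<close>. Since \<open>H^2 - H = H * \<sigma> * g\<close>, the
  rescaled \<alpha>-terms differ by at most \<open>3/2 * A0\<close> times \<open>g * A^2\<close>,
  plus a term in \<open>X^2\<close> and a cross term, which Young's inequality bounds by one more
  \<open>g * A^2\<close> and a multiple of \<open>X^2\<close>. Hence the condition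
  \<open>2 * A0 + 1 \<le> C\<close>.\<close>

lemma gain_rank_one:
  fixes A X g H \<alpha> A0 \<sigma> C :: real
  assumes "\<bar>\<alpha>\<bar> \<le> A0" "0 < g0" "g0 \<le> g" "\<bar>\<sigma>\<bar> = 1" "H = 1 + \<sigma> * g" "1/2 \<le> H" "H \<le> 3/2" "2 * A0 + 1 \<le> C"
  shows "- (9 * A0^2 / (4 * g0) + A0) * X^2 \<le> C * g * A^2 + \<alpha> * ((H * A + X)^2 - H * A^2)"
proof -
  have "0 \<le> A0" "0 < g" using assms by auto
  have H2: "H^2 = H + H * \<sigma> * g" using assms(5) by (simp add: power2_eq_square algebra_simps)
  have "(H * A + X)^2 = H^2 * A^2 + 2 * H * (A * X) + X^2"
    by (simp add: power2_eq_square algebra_simps)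
  then have "\<alpha> * ((H * A + X)^2 - H * A^2) = (\<alpha> * H * \<sigma>) * (g * A^2) + 2 * (\<alpha> * H) * (A * X) + \<alpha> * X^2"
    unfolding H2 by (simp add: algebra_simps)
  moreover have aH: "\<bar>\<alpha> * H\<bar> \<le> 3/2 * A0"
  proof -
    have "\<bar>\<alpha>\<bar> * \<bar>H\<bar> \<le> A0 * (3/2)" using assms(1,6,7) \<open>0 \<le> A0\<close> by (intro mult_mono) auto
    then show ?thesis by (simp add: abs_mult)
  qed
  moreover have "- (3/2 * A0) * (g * A^2) \<le> (\<alpha> * H * \<sigma>) * (g * A^2)"
  proof (rule mult_right_mono)
    have "\<bar>\<alpha> * H * \<sigma>\<bar> \<le> 3/2 * A0" using aH assms(4) by (simp add: abs_mult)
    then show "- (3/2 * A0) \<le> \<alpha> * H * \<sigma>" by linarith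
  qed (use \<open>0 < g\<close> in simp)
  moreover have "(2 * A0 + 1) * (g * A^2) \<le> C * (g * A^2)"
    using assms(8) \<open>0 < g\<close> by (intro mult_right_mono) auto
  moreover have "- (3 * A0 * (\<bar>A\<bar> * \<bar>X\<bar>)) \<le> 2 * (\<alpha> * H) * (A * X)"
  proof -
    have "\<bar>2 * (\<alpha> * H) * (A * X)\<bar> = 2 * \<bar>\<alpha> * H\<bar> * (\<bar>A\<bar> * \<bar>X\<bar>)" by (simp add: abs_mult)
    also have "\<dots> \<le> 2 * (3/2 * A0) * (\<bar>A\<bar> * \<bar>X\<bar>)" using aH by (intro mult_right_mono mult_left_mono) auto
    finally show ?thesis by simp
  qed
  moreover have "3 * A0 * (\<bar>A\<bar> * \<bar>X\<bar>) \<le> g * A^2 + 9 * A0^2 / (4 * g) * X^2"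
  proof -
    have "0 \<le> (2 * g * \<bar>A\<bar> - 3 * A0 * \<bar>X\<bar>)^2" by simp
    then have "12 * g * (A0 * (\<bar>A\<bar> * \<bar>X\<bar>)) \<le> 4 * g^2 * A^2 + 9 * A0^2 * X^2"
      by (simp add: power2_diff power_mult_distrib algebra_simps)
    then show ?thesis using \<open>0 < g\<close> by (simp add: field_simps power2_eq_square)
  qed
  moreover have "9 * A0^2 / (4 * g) * X^2 \<le> 9 * A0^2 / (4 * g0) * X^2"
    using assms by (intro mult_right_mono divide_left_mono) auto
  moreover have "- A0 * X^2 \<le> \<alpha> * X^2" using assms(1) by (intro mult_right_mono) auto
  moreover have "0 \<le> A0 * (g * A^2)" using \<open>0 \<le> A0\<close> \<open>0 < g\<close> by simp
  ultimately show ?thesis by (simp add: algebra_simps)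
qed

text \<open>\<open>N\<close>, \<open>E\<close> and \<open>x\<close> stand for \<open>norm a\<close>,
  \<open>norm \<epsilon>\<close> and \<open>a \<bullet> \<epsilon>\<close>. The sign of \<sigma>
  turns \<open>- \<beta> * (H^2 - H)\<close> into \<open>\<bar>\<beta>\<bar> * H * g\<close>, which
  is at least half of \<open>\<bar>\<beta>\<bar> * g\<close>; Young's inequality spends half of this
  gain on the cross term.\<close>

lemma gain_isotropic:
  fixes N E x g H \<beta> A0 \<sigma> :: real
  assumes "\<bar>\<beta>\<bar> \<le> A0" "0 < g0" "g0 \<le> g" "\<bar>\<sigma>\<bar> = 1" "H = 1 + \<sigma> * g" "1/2 \<le> H" "H \<le> 3/2"
    and b0: "0 \<le> b0" "b0 \<le> - \<sigma> * \<beta>" and "\<bar>x\<bar> \<le> N * E" "0 \<le> N" "0 \<le> E"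
  shows "b0 * g0 / 4 * N^2 - (9 * A0 / g0 + A0) * E^2 \<le> - \<beta> * ((H^2 * N^2 + 2 * H * x + E^2) - H * N^2)"
proof -
  define b where "b = - \<sigma> * \<beta>"
  have "0 < g" "0 \<le> b" using assms by (auto simp: b_def)
  have "\<sigma> = 1 \<or> \<sigma> = - 1" using assms(4) by linarith
  then have \<beta>: "\<bar>\<beta>\<bar> = b" and "\<beta> * \<sigma> = - b" using \<open>0 \<le> b\<close> by (auto simp: b_def)
  have H2: "H^2 = H + H * \<sigma> * g" using assms(5) by (simp add: power2_eq_square algebra_simps)
  have "- \<beta> * ((H^2 * N^2 + 2 * H * x + E^2) - H * N^2) = - (\<beta> * \<sigma>) * H * (g * N^2) - 2 * (\<beta> * H) * x - \<beta> * E^2"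
    unfolding H2 by (simp add: algebra_simps)
  then have eq: "- \<beta> * ((H^2 * N^2 + 2 * H * x + E^2) - H * N^2) = b * H * (g * N^2) - 2 * (\<beta> * H) * x - \<beta> * E^2"
    using \<open>\<beta> * \<sigma> = - b\<close> by simp
  have "b * (1/2) * (g * N^2) \<le> b * H * (g * N^2)"
    using assms \<open>0 \<le> b\<close> \<open>0 < g\<close> by (intro mult_right_mono mult_left_mono) auto
  moreover have "\<bar>2 * (\<beta> * H) * x\<bar> \<le> 3 * b * (N * E)"
  proof -
    have "\<bar>2 * (\<beta> * H) * x\<bar> = 2 * b * H * \<bar>x\<bar>" using assms(6) by (simp add: abs_mult \<beta>)
    also have "\<dots> \<le> 2 * b * (3/2) * (N * E)" using assms \<open>0 \<le> b\<close> by (intro mult_mono) auto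
    finally show ?thesis by simp
  qed
  moreover have "3 * b * (N * E) \<le> b * g / 4 * N^2 + 9 * b / g * E^2"
  proof -
    have "0 \<le> b * (g * N - 6 * E)^2" using \<open>0 \<le> b\<close> by simp
    then have "12 * g * (b * (N * E)) \<le> b * g^2 * N^2 + 36 * b * E^2"
      by (simp add: power2_diff power_mult_distrib algebra_simps)
    then show ?thesis using \<open>0 < g\<close> by (simp add: field_simps power2_eq_square)
  qed
  moreover have "9 * b / g * E^2 \<le> 9 * A0 / g0 * E^2"
    using assms \<open>0 \<le> b\<close> \<beta> by (intro mult_right_mono frac_le) auto
  moreover have "\<beta> * E^2 \<le> A0 * E^2" using assms(1) by (intro mult_right_mono) auto
  moreover have "b0 * g0 / 4 * N^2 \<le> b * g / 4 * N^2"
    using assms unfolding b_def by (intro mult_right_mono divide_right_mono mult_mono) auto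
  ultimately show ?thesis unfolding eq by (simp add: algebra_simps)
qed

section \<open>Absence of touching points\<close>

text \<open>The sum of the two gains. The term with \<open>l\<close> is the cost of comparing
  coefficients at different points; \<open>(norm p)^2\<close> is bounded by multiples of
  \<open>(norm a)^2\<close> and \<open>(norm \<epsilon>)^2\<close>, so the isotropic gain pays for
  the first part. If \<open>b0 = 0\<close>, the hypotheses force \<open>l = 0\<close>. What remains
  is quadratic in \<epsilon>.\<close>

lemma perturbed_form_gap:
  fixes a \<epsilon> u :: "'a::real_inner"
  assumes "\<bar>\<alpha>\<bar> \<le> A0" "\<bar>\<beta>\<bar> \<le> A0" "0 < g0" "g0 \<le> g" "\<bar>\<sigma>\<bar> = 1" "H = 1 + \<sigma> * g" "1/2 \<le> H" "H \<le> 3/2"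
    and "2 * A0 + 1 \<le> C" "0 \<le> b0" "b0 \<le> - \<sigma> * \<beta>" "0 \<le> l" "l \<le> 1" "9/2 * l \<le> b0 * g0 / 4"
  defines "p \<equiv> H *\<^sub>R a + \<epsilon>"
  shows "- (9 * A0^2 / (4 * g0) + 9 * A0 / g0 + 2 * A0 + 2) * (norm \<epsilon>)^2 * (norm u)^2 \<le>
    C * g * (a \<bullet> u)^2 + (\<alpha> * (p \<bullet> u)^2 - \<beta> * (norm p)^2 * (norm u)^2) - l * (norm p)^2 * (norm u)^2
    - H * (\<alpha> * (a \<bullet> u)^2 - \<beta> * (norm a)^2 * (norm u)^2)"
proof -
  have "0 \<le> A0" using assms(1) by linarith
  have pu: "p \<bullet> u = H * (a \<bullet> u) + \<epsilon> \<bullet> u" by (simp add: p_def inner_add_left)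
  have pn: "(norm p)^2 = H^2 * (norm a)^2 + 2 * H * (a \<bullet> \<epsilon>) + (norm \<epsilon>)^2"
    unfolding p_def power2_norm_eq_inner
    by (simp add: inner_add_left inner_add_right inner_commute power2_eq_square algebra_simps)
  have "- (9 * A0^2 / (4 * g0) + A0) * (\<epsilon> \<bullet> u)^2 \<le>
      C * g * (a \<bullet> u)^2 + \<alpha> * ((H * (a \<bullet> u) + \<epsilon> \<bullet> u)^2 - H * (a \<bullet> u)^2)"
    by (rule gain_rank_one) (use assms in auto)
  moreover have "(9 * A0^2 / (4 * g0) + A0) * (\<epsilon> \<bullet> u)^2 \<le> (9 * A0^2 / (4 * g0) + A0) * ((norm \<epsilon>)^2 * (norm u)^2)"
    using power_mono[OF Cauchy_Schwarz_ineq2[of \<epsilon> u], of 2] \<open>0 \<le> A0\<close> \<open>0 < g0\<close>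
    by (intro mult_left_mono) (auto simp: power_mult_distrib)
  ultimately have 1: "- (9 * A0^2 / (4 * g0) + A0) * ((norm \<epsilon>)^2 * (norm u)^2) \<le>
      C * g * (a \<bullet> u)^2 + \<alpha> * (p \<bullet> u)^2 - H * \<alpha> * (a \<bullet> u)^2"
    unfolding pu by (simp add: algebra_simps)
  have "b0 * g0 / 4 * (norm a)^2 - (9 * A0 / g0 + A0) * (norm \<epsilon>)^2 \<le>
      - \<beta> * ((H^2 * (norm a)^2 + 2 * H * (a \<bullet> \<epsilon>) + (norm \<epsilon>)^2) - H * (norm a)^2)"
    by (rule gain_isotropic) (use assms in \<open>auto simp: Cauchy_Schwarz_ineq2\<close>)
  then have iso: "b0 * g0 / 4 * (norm a)^2 - (9 * A0 / g0 + A0) * (norm \<epsilon>)^2 \<le>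
      H * \<beta> * (norm a)^2 - \<beta> * (norm p)^2"
    unfolding pn[symmetric] by (simp add: algebra_simps)
  have "(norm p)^2 \<le> 9/2 * (norm a)^2 + 2 * (norm \<epsilon>)^2"
  proof -
    have "norm p \<le> 3/2 * norm a + norm \<epsilon>"
      using norm_triangle_ineq[of "H *\<^sub>R a" \<epsilon>] mult_right_mono[of H "3/2" "norm a"] assms(7,8)
      by (simp add: p_def)
    then have "(norm p)^2 \<le> (3/2 * norm a + norm \<epsilon>)^2" by (intro power_mono) auto
    also have "\<dots> \<le> 9/2 * (norm a)^2 + 2 * (norm \<epsilon>)^2"
      using sum_squares_bound[of "3/2 * norm a" "norm \<epsilon>"] by (simp add: power2_sum power_mult_distrib power_divide)
    finally show ?thesis .
  qed
  then have "l * (norm p)^2 \<le> l * (9/2 * (norm a)^2 + 2 * (norm \<epsilon>)^2)"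
    using assms by (intro mult_left_mono)
  moreover have "9/2 * l * (norm a)^2 \<le> b0 * g0 / 4 * (norm a)^2" using assms by (intro mult_right_mono) auto
  moreover have "l * (2 * (norm \<epsilon>)^2) \<le> 2 * (norm \<epsilon>)^2" using assms by (intro mult_left_le_one_le) auto
  ultimately have "l * (norm p)^2 \<le> b0 * g0 / 4 * (norm a)^2 + 2 * (norm \<epsilon>)^2"
    by (simp add: distrib_left mult_ac)
  with iso have "- (9 * A0 / g0 + A0 + 2) * (norm \<epsilon>)^2 \<le> H * \<beta> * (norm a)^2 - \<beta> * (norm p)^2 - l * (norm p)^2"
    by (simp add: algebra_simps)
  then have "- (9 * A0 / g0 + A0 + 2) * (norm \<epsilon>)^2 * (norm u)^2 \<le>
      (H * \<beta> * (norm a)^2 - \<beta> * (norm p)^2 - l * (norm p)^2) * (norm u)^2"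
    by (intro mult_right_mono) auto
  with 1 show ?thesis by (simp add: algebra_simps)
qed

text \<open>On the compact \<open>F\<close> the gap has a positive minimum, and half of it survives
  for nearby pairs with one point in \<open>F\<close>. This keeps the doubled contact points off the
  frontier.\<close>

lemma gap_near_frontier:
  fixes v w :: "'a::euclidean_space \<Rightarrow> real"
  assumes "compact S" "compact F" "F \<subseteq> S" "usc_map S v" "usc_map S (\<lambda>x. - w x)"
    and "\<And>x. x \<in> F \<Longrightarrow> v x < w x"
  shows "\<exists>\<gamma>>0. \<exists>\<rho>>0. \<forall>z\<in>S. \<forall>y\<in>S. z \<in> F \<or> y \<in> F \<longrightarrow> dist z y < \<rho> \<longrightarrow> v z - w y < - \<gamma>"
proof (cases "F = {}")
  case True
  then show ?thesis by (auto intro: gt_ex)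
next
  case False
  have "usc_map F (\<lambda>x. v x + - w x)"
    using usc_map_add[OF assms(4,5)] assms(3) by (rule usc_map_subset)
  from usc_map_attains_max[OF assms(2) False this]
  obtain x1 where x1: "x1 \<in> F" "\<forall>y\<in>F. v y + - w y \<le> v x1 + - w x1" by (elim bexE)
  define \<gamma> where "\<gamma> = (w x1 - v x1) / 2"
  have "0 < \<gamma>" using assms(6)[OF x1(1)] by (simp add: \<gamma>_def)
  define T where "T = F \<times> S \<union> S \<times> F"
  have "compact T" unfolding T_def using assms by (intro compact_Un compact_Times)
  moreover have "usc_map T (\<lambda>p. v (fst p) + - w (snd p))"
  proof (rule usc_map_subset)
    show "usc_map (S \<times> S) (\<lambda>p. v (fst p) + - w (snd p))"
      by (intro usc_map_add usc_map_fst usc_map_snd[of S "\<lambda>x. - w x"] assms)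
    show "T \<subseteq> S \<times> S" using assms(3) by (auto simp: T_def)
  qed
  moreover have "v (fst (x, x)) + - w (snd (x, x)) < - \<gamma>" if "(x, x) \<in> T" for x
  proof -
    have "v x + - w x \<le> v x1 + - w x1" using that x1(2) by (auto simp: T_def)
    also have "\<dots> = - (2 * \<gamma>)" by (simp add: \<gamma>_def field_simps)
    finally show ?thesis using \<open>0 < \<gamma>\<close> by simp
  qed
  ultimately have "\<exists>\<rho>>0. \<forall>x y. (x, y) \<in> T \<longrightarrow> dist x y < \<rho> \<longrightarrow> v (fst (x, y)) + - w (snd (x, y)) < - \<gamma>"
    by (rule usc_map_less_near_diagonal)
  then obtain \<rho> where "0 < \<rho>" "\<forall>x y. (x, y) \<in> T \<longrightarrow> dist x y < \<rho> \<longrightarrow> v (fst (x, y)) + - w (snd (x, y)) < - \<gamma>"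
    by (elim exE conjE)
  then have "\<exists>\<rho>>0. \<forall>z\<in>S. \<forall>y\<in>S. z \<in> F \<or> y \<in> F \<longrightarrow> dist z y < \<rho> \<longrightarrow> v z - w y < - \<gamma>"
    by (intro exI[of _ \<rho>]) (auto simp: T_def)
  then show ?thesis using \<open>0 < \<gamma>\<close> by blast
qed

text \<open>This closeness of values is one-sided: in the opposite direction only a fixed bound is
  available, which is not small compared with the gain.\<close>

lemma ordered_near_diagonal:
  fixes v w :: "'a::euclidean_space \<Rightarrow> real"
  assumes "compact S" "usc_map S v" "usc_map S (\<lambda>x. - w x)"
    and "\<And>x. x \<in> S \<Longrightarrow> v x \<le> w x" "0 < \<tau>"
  shows "\<exists>\<rho>>0. \<forall>z\<in>S. \<forall>y\<in>S. dist z y < \<rho> \<longrightarrow> v z - w y < \<tau>"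
proof -
  have "\<exists>\<rho>>0. \<forall>x y. (x, y) \<in> S \<times> S \<longrightarrow> dist x y < \<rho> \<longrightarrow> v (fst (x, y)) + - w (snd (x, y)) < \<tau>"
  proof (rule usc_map_less_near_diagonal)
    show "compact (S \<times> S)" by (intro compact_Times assms)
    show "usc_map (S \<times> S) (\<lambda>p. v (fst p) + - w (snd p))"
      by (intro usc_map_add usc_map_fst usc_map_snd[of S "\<lambda>x. - w x"] assms)
    show "v (fst (x, x)) + - w (snd (x, x)) < \<tau>" if "(x, x) \<in> S \<times> S" for x
      using that assms(4)[of x] assms(5) by simp
  qed
  then obtain \<rho> where "0 < \<rho>" "\<forall>x y. (x, y) \<in> S \<times> S \<longrightarrow> dist x y < \<rho> \<longrightarrow> v (fst (x, y)) + - w (snd (x, y)) < \<tau>"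
    by (elim exE conjE)
  then show ?thesis by (intro exI[of _ \<rho>]) simp
qed

lemma exponential_perturbation_strict_mono:
  fixes \<mu> k :: real
  assumes "\<And>t. l \<le> t \<Longrightarrow> t \<le> r \<Longrightarrow> 0 < 1 + \<mu> * k * exp (k * t)" "l \<le> t" "t < t'" "t' \<le> r"
  shows "t + \<mu> * exp (k * t) < t' + \<mu> * exp (k * t')"
proof (rule DERIV_pos_imp_increasing[where f="\<lambda>t. t + \<mu> * exp (k * t)"])
  show "t < t'" by fact
  fix x assume "t \<le> x" "x \<le> t'"
  have "((\<lambda>t. t + \<mu> * exp (k * t)) has_real_derivative 1 + \<mu> * k * exp (k * x)) (at x)"
    by (auto intro!: derivative_eq_intros)
  then show "\<exists>y. ((\<lambda>t. t + \<mu> * exp (k * t)) has_real_derivative y) (at x) \<and> 0 < y"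
    using assms \<open>t \<le> x\<close> \<open>x \<le> t'\<close> by (intro exI[of _ "1 + \<mu> * k * exp (k * x)"]) auto
qed

text \<open>With \<open>r = min s t\<close>, passing from \<open>(z, s)\<close> to
  \<open>(y, r)\<close> costs at most \<open>2 * c * \<tau>\<close> for each coefficient, because
  \<open>s\<close> exceeds \<open>r\<close> by at most \<tau>. Passing from \<open>r\<close> up to
  \<open>t\<close>, over a length that is not controlled, is free by monotonicity.\<close>

lemma form_monotone_lipschitz:
  fixes p u z y :: "real ^ 'n"
  assumes mono: "\<And>s t. s \<le> t \<Longrightarrow> matrix_le (L_op \<alpha> \<beta> y s p) (L_op \<alpha> \<beta> y t p)"
    and lip: "\<And>r. r \<in> {s, t} \<Longrightarrow> \<bar>\<alpha> y r - \<alpha> z s\<bar> \<le> c * (dist y z + \<bar>r - s\<bar>)"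
      "\<And>r. r \<in> {s, t} \<Longrightarrow> \<bar>\<beta> y r - \<beta> z s\<bar> \<le> c * (dist y z + \<bar>r - s\<bar>)"
    and "0 \<le> c" "dist y z \<le> \<tau>" "s - t \<le> \<tau>"
  shows "\<alpha> z s * (p \<bullet> u)^2 - \<beta> z s * (norm p)^2 * (norm u)^2 - 4 * c * \<tau> * (norm p)^2 * (norm u)^2
    \<le> \<alpha> y t * (p \<bullet> u)^2 - \<beta> y t * (norm p)^2 * (norm u)^2"
proof -
  define P where "P = (norm p)^2 * (norm u)^2"
  have pu: "(p \<bullet> u)^2 \<le> P"
    using power_mono[OF Cauchy_Schwarz_ineq2[of p u], of 2] by (simp add: P_def power_mult_distrib)
  have "0 \<le> \<tau>" using assms(5) zero_le_dist[of y z] by linarith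
  define r where "r = (if s \<le> t then s else t)"
  have "dist y z + \<bar>r - s\<bar> \<le> 2 * \<tau>" using assms(5,6) \<open>0 \<le> \<tau>\<close> by (auto simp: r_def)
  then have "c * (dist y z + \<bar>r - s\<bar>) \<le> c * (2 * \<tau>)" using \<open>0 \<le> c\<close> by (rule mult_left_mono)
  moreover have "r \<in> {s, t}" by (simp add: r_def)
  ultimately have \<alpha>r: "\<bar>\<alpha> y r - \<alpha> z s\<bar> \<le> c * (2 * \<tau>)" and \<beta>r: "\<bar>\<beta> y r - \<beta> z s\<bar> \<le> c * (2 * \<tau>)"
    using lip[of r] by auto
  have "matrix_le (L_op \<alpha> \<beta> y r p) (L_op \<alpha> \<beta> y t p)" by (rule mono) (simp add: r_def)
  then have "0 \<le> u \<bullet> ((L_op \<alpha> \<beta> y t p - L_op \<alpha> \<beta> y r p) *v u)"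
    unfolding matrix_le_def nonneg_definite_def by blast
  then have 1: "\<alpha> y r * (p \<bullet> u)^2 - \<beta> y r * P \<le> \<alpha> y t * (p \<bullet> u)^2 - \<beta> y t * P"
    by (simp only: quadratic_form_simps) (simp add: P_def mult.assoc)
  have c\<tau>: "0 \<le> c * (2 * \<tau>)" using \<open>0 \<le> c\<close> \<open>0 \<le> \<tau>\<close> by simp
  have "\<bar>(\<alpha> y r - \<alpha> z s) * (p \<bullet> u)^2\<bar> \<le> c * (2 * \<tau>) * P"
    unfolding abs_mult using \<alpha>r pu c\<tau> by (intro mult_mono) auto
  moreover have "0 \<le> P" by (simp add: P_def)
  then have "\<bar>(\<beta> y r - \<beta> z s) * P\<bar> \<le> c * (2 * \<tau>) * P"
    unfolding abs_mult using \<beta>r c\<tau> by (intro mult_mono) auto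
  ultimately have "\<alpha> z s * (p \<bullet> u)^2 - \<beta> z s * P - 4 * c * \<tau> * P \<le> \<alpha> y r * (p \<bullet> u)^2 - \<beta> y r * P"
    by (simp add: algebra_simps)
  with 1 show ?thesis by (simp add: P_def mult.assoc)
qed

text \<open>\<open>P\<close>, \<open>N\<close> and \<open>contra\<close> abstract the closure of
  \<open>U\<close>, the symmetric matrices outside \<open>U\<close>, and the two properties of
  \<open>U\<close>. Jets of \<open>v\<close> and \<open>w\<close> are assumed only where
  \<open>v > - K\<close> and \<open>w < K\<close>, because these functions will be truncations. The
  case \<open>0 < b0\<close> is a \<beta> of one sign bounded away from zero; otherwise
  \<open>\<Lambda> = 0\<close>, and there is no error between the points to absorb.\<close>

theorem no_touching:
  fixes G :: "(real ^ 'n) set" and v w :: "real ^ 'n \<Rightarrow> real"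
  assumes "open G" "bounded G" and S: "S = closure G"
    and usc: "usc_map S v" "usc_map S (\<lambda>x. - w x)"
    and v_range: "\<And>x. x \<in> S \<Longrightarrow> - K \<le> v x \<and> v x \<le> K - 1"
    and w_range: "\<And>x. x \<in> S \<Longrightarrow> - K + 1 \<le> w x \<and> w x \<le> K"
    and le: "\<And>x. x \<in> S \<Longrightarrow> v x \<le> w x"
    and bd: "\<And>x. x \<in> frontier G \<Longrightarrow> v x < w x"
    and x0: "x0 \<in> S" "v x0 = w x0"
    and \<alpha>0: "\<And>x s. x \<in> S \<Longrightarrow> \<bar>s\<bar> \<le> K \<Longrightarrow> \<bar>\<alpha> x s\<bar> \<le> A0"
    and \<beta>0: "\<And>x s. x \<in> S \<Longrightarrow> \<bar>s\<bar> \<le> K \<Longrightarrow> \<bar>\<beta> x s\<bar> \<le> A0"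
    and "0 \<le> \<Lambda>"
    and \<alpha>_lip: "\<And>x y s t. x \<in> S \<Longrightarrow> y \<in> S \<Longrightarrow> \<bar>s\<bar> \<le> K \<Longrightarrow> \<bar>t\<bar> \<le> K \<Longrightarrow> \<bar>\<alpha> x s - \<alpha> y t\<bar> \<le> \<Lambda> * (dist x y + \<bar>s - t\<bar>)"
    and \<beta>_lip: "\<And>x y s t. x \<in> S \<Longrightarrow> y \<in> S \<Longrightarrow> \<bar>s\<bar> \<le> K \<Longrightarrow> \<bar>t\<bar> \<le> K \<Longrightarrow> \<bar>\<beta> x s - \<beta> y t\<bar> \<le> \<Lambda> * (dist x y + \<bar>s - t\<bar>)"
    and mono: "\<And>x s t p. x \<in> S \<Longrightarrow> s \<le> t \<Longrightarrow> matrix_le (L_op \<alpha> \<beta> x s p) (L_op \<alpha> \<beta> x t p)"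
    and \<sigma>: "\<bar>\<sigma>\<bar> = 1" and "0 \<le> b0" and \<beta>_sign: "\<And>x s. x \<in> S \<Longrightarrow> \<bar>s\<bar> \<le> K \<Longrightarrow> b0 \<le> - \<sigma> * \<beta> x s"
    and b0\<Lambda>: "0 < b0 \<or> \<Lambda> = 0"
    and sub: "\<And>z q A d. z \<in> G \<Longrightarrow> - K < v z \<Longrightarrow> A \<in> sym_matrices \<Longrightarrow> 0 < d \<Longrightarrow>
      (\<And>h. norm h < d \<Longrightarrow> z + h \<in> G \<Longrightarrow> v (z + h) \<le> v z + q \<bullet> h + (h \<bullet> (A *v h)) / 2) \<Longrightarrow>
      A + L_op \<alpha> \<beta> z (v z) q \<in> P"
    and super: "\<And>y q A d. y \<in> G \<Longrightarrow> w y < K \<Longrightarrow> A \<in> sym_matrices \<Longrightarrow> 0 < d \<Longrightarrow>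
      (\<And>h. norm h < d \<Longrightarrow> y + h \<in> G \<Longrightarrow> w y + q \<bullet> h + (h \<bullet> (A *v h)) / 2 \<le> w (y + h)) \<Longrightarrow>
      A + L_op \<alpha> \<beta> y (w y) q \<in> N"
    and contra: "\<And>A B c. A \<in> P \<Longrightarrow> B \<in> N \<Longrightarrow> 0 < c \<Longrightarrow> pos_definite (B - c *\<^sub>R A) \<Longrightarrow> False"
  shows False
proof -
  have "compact S" using \<open>bounded G\<close> S by simp
  have "0 < K" using v_range[OF x0(1)] by linarith
  have "0 \<le> A0" using \<alpha>0[OF x0(1), of 0] \<open>0 < K\<close> by simp
  obtain R where "0 < R" and R: "\<And>x. x \<in> S \<Longrightarrow> norm x \<le> R"
    using compact_imp_bounded[OF \<open>compact S\<close>] unfolding bounded_pos by blast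
  have "compact (frontier G)" "frontier G \<subseteq> S"
    using \<open>bounded G\<close> by (auto simp: S frontier_def compact_frontier_bounded[unfolded frontier_def])
  from gap_near_frontier[OF \<open>compact S\<close> this usc bd]
  obtain \<gamma> \<rho>1 where "0 < \<gamma>" "0 < \<rho>1" and
    gap: "\<And>z y. z \<in> S \<Longrightarrow> y \<in> S \<Longrightarrow> z \<in> frontier G \<or> y \<in> frontier G \<Longrightarrow> dist z y < \<rho>1 \<Longrightarrow> v z - w y < - \<gamma>"
    by blast
  \<comment> \<open>At contact \<open>v z - w y\<close> will exceed \<open>- 3 * \<gamma>'\<close>.
    The bound by \<gamma> then excludes the frontier, and the bound by 1/8 keeps both values inside
    the range where jets are assumed.\<close>
  define \<gamma>' where "\<gamma>' = min \<gamma> (1/2) / 4"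
  have \<gamma>': "0 < \<gamma>'" "4 * \<gamma>' \<le> \<gamma>" "\<gamma>' \<le> 1/8" using \<open>0 < \<gamma>\<close> by (auto simp: \<gamma>'_def)
  \<comment> \<open>For \<open>H t = t + \<mu> exp (\<sigma> C t)\<close> the convexity term \<open>\<mu> C^2 exp (\<sigma> C t)\<close> beats \<open>\<alpha>\<close>, and \<open>\<sigma> = - sgn \<beta>\<close> makes the
    \<open>\<beta>\<close>-term a gain proportional to the squared gradient. The constants are fixed in the order \<open>\<mu>\<close>, \<open>\<nu>\<close>, \<open>\<tau>\<close>, \<open>\<eta>\<close>.\<close>
  define C where "C = 2 * A0 + 1"
  have "1 \<le> C" using \<open>0 \<le> A0\<close> by (simp add: C_def)
  define E where "E = exp (C * K)"
  have "0 < E" by (simp add: E_def)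
  define k where "k = \<sigma> * C"
  have "\<bar>k\<bar> = C" using \<sigma> \<open>1 \<le> C\<close> by (simp add: k_def abs_mult)
  have k2: "k^2 = C^2" using \<open>\<bar>k\<bar> = C\<close> power2_abs[of k] by simp
  have expE: "1 / E \<le> exp (k * s)" "exp (k * s) \<le> E" if "\<bar>s\<bar> \<le> K" for s
  proof -
    have "\<bar>k * s\<bar> \<le> C * K"
      unfolding abs_mult \<open>\<bar>k\<bar> = C\<close> using that \<open>1 \<le> C\<close> by (intro mult_left_mono) auto
    then have "- (C * K) \<le> k * s" "k * s \<le> C * K" by linarith+
    moreover have "1 / E = exp (- (C * K))" by (simp add: E_def exp_minus inverse_eq_divide)
    ultimately show "1 / E \<le> exp (k * s)" "exp (k * s) \<le> E" by (simp_all add: E_def)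
  qed
  \<comment> \<open>The first bound keeps the slope of \<open>H\<close> between 1/2 and 3/2, the
    second lets \<open>H\<close> move values by at most \<open>\<gamma>'\<close>.\<close>
  define \<mu> where "\<mu> = min (1 / (2 * C * E)) (\<gamma>' / E)"
  have "0 < \<mu>" using \<open>0 < E\<close> \<open>1 \<le> C\<close> \<gamma>' by (simp add: \<mu>_def)
  have \<mu>E: "\<mu> * E \<le> \<gamma>'"
  proof -
    have "\<mu> \<le> \<gamma>' / E" by (simp add: \<mu>_def)
    then show ?thesis using \<open>0 < E\<close> by (simp add: field_simps)
  qed
  have \<mu>CE: "\<mu> * C * E \<le> 1/2"
  proof -
    have "\<mu> \<le> 1 / (2 * C * E)" by (simp add: \<mu>_def)
    then show ?thesis using \<open>0 < E\<close> \<open>1 \<le> C\<close> by (simp add: field_simps)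
  qed
  \<comment> \<open>A lower bound for the distance of the slope of \<open>H\<close> from 1, the
    factor in both gains.\<close>
  define g0 where "g0 = \<mu> * C / E"
  have "0 < g0" using \<open>0 < \<mu>\<close> \<open>0 < E\<close> \<open>1 \<le> C\<close> by (simp add: g0_def)
  have slope: "g0 \<le> \<mu> * C * exp (k * s)" "\<mu> * C * exp (k * s) \<le> 1/2" "\<mu> * exp (k * s) \<le> \<gamma>'"
    if "\<bar>s\<bar> \<le> K" for s
  proof -
    have "0 \<le> \<mu> * C" using \<open>0 < \<mu>\<close> \<open>1 \<le> C\<close> by simp
    show "g0 \<le> \<mu> * C * exp (k * s)"
      using mult_left_mono[OF expE(1)[OF that] \<open>0 \<le> \<mu> * C\<close>] by (simp add: g0_def)
    show "\<mu> * C * exp (k * s) \<le> 1/2"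
      using mult_left_mono[OF expE(2)[OF that] \<open>0 \<le> \<mu> * C\<close>] \<mu>CE by linarith
    show "\<mu> * exp (k * s) \<le> \<gamma>'"
      using mult_left_mono[OF expE(2)[OF that], of \<mu>] \<open>0 < \<mu>\<close> \<mu>E by linarith
  qed
  define c1 where "c1 = 9 * A0^2 / (4 * g0) + 9 * A0 / g0 + 2 * A0 + 2"
  have "2 \<le> c1" using \<open>0 \<le> A0\<close> \<open>0 < g0\<close> by (simp add: c1_def)
  \<comment> \<open>The second bound is the decisive one: the gradient error \<epsilon> is at most
    \<open>(2 * R + 1) * \<nu>\<close>, so its cost \<open>c1 * (norm \<epsilon>)^2\<close> is
    quadratic in \<nu> and can be kept below \<open>\<nu> / 2\<close>, against a gain of
    \<open>2 * \<nu>\<close>.\<close>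
  define \<nu> where "\<nu> = min (\<gamma>' / R^2) (1 / (2 * c1 * (2 * R + 1)^2))"
  have "0 < (2 * R + 1)^2" using \<open>0 < R\<close> by simp
  then have "0 < \<nu>" using \<gamma>' \<open>0 < R\<close> \<open>2 \<le> c1\<close> by (simp add: \<nu>_def)
  have \<nu>R: "\<nu> * R^2 \<le> \<gamma>'"
  proof -
    have "\<nu> \<le> \<gamma>' / R^2" by (simp add: \<nu>_def)
    then show ?thesis using \<open>0 < R\<close> by (simp add: field_simps)
  qed
  have c1\<nu>: "c1 * (2 * R + 1)^2 * \<nu> \<le> 1/2"
  proof -
    have "\<nu> \<le> 1 / (2 * c1 * (2 * R + 1)^2)" by (simp add: \<nu>_def)
    moreover have "0 < 2 * c1 * (2 * R + 1)^2" using \<open>0 < (2 * R + 1)^2\<close> \<open>2 \<le> c1\<close> by simp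
    ultimately show ?thesis by (simp add: pos_le_divide_eq mult_ac)
  qed
  have "\<exists>\<tau>>0. 4 * \<Lambda> * \<tau> \<le> 1 \<and> 9/2 * (4 * \<Lambda> * \<tau>) \<le> b0 * g0 / 4"
  proof (cases "\<Lambda> = 0")
    case True
    then show ?thesis using \<open>0 \<le> b0\<close> \<open>0 < g0\<close> by (intro exI[of _ 1]) simp
  next
    case False
    then have "0 < b0" "0 < \<Lambda>" using b0\<Lambda> \<open>0 \<le> \<Lambda>\<close> by auto
    \<comment> \<open>\<open>72 = 4 * 18\<close>, and 9/2 divided by 18 is the 1/4 that the gap
      estimate demands.\<close>
    define \<tau> where "\<tau> = min 1 (b0 * g0) / (72 * \<Lambda>)"
    have "0 < \<tau>" using \<open>0 < b0\<close> \<open>0 < \<Lambda>\<close> \<open>0 < g0\<close> by (simp add: \<tau>_def)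
    moreover have "4 * \<Lambda> * \<tau> = min 1 (b0 * g0) / 18" using \<open>0 < \<Lambda>\<close> by (simp add: \<tau>_def)
    ultimately show ?thesis by (intro exI[of _ \<tau>]) auto
  qed
  then obtain \<tau> where "0 < \<tau>" and \<tau>: "4 * \<Lambda> * \<tau> \<le> 1" "9/2 * (4 * \<Lambda> * \<tau>) \<le> b0 * g0 / 4" by blast
  obtain \<rho>2 where "0 < \<rho>2" and near: "\<And>z y. z \<in> S \<Longrightarrow> y \<in> S \<Longrightarrow> dist z y < \<rho>2 \<Longrightarrow> v z - w y < \<tau>"
    using ordered_near_diagonal[OF \<open>compact S\<close> usc le \<open>0 < \<tau>\<close>] by blast
  \<comment> \<open>The two jets cost \<open>4 * \<eta> + 2 * \<eta> = \<nu> / 2\<close>. With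
    \<open>\<nu> / 2\<close> for the gradient error, \<nu> remains of the gain
    \<open>2 * \<nu>\<close>.\<close>
  define \<eta> where "\<eta> = \<nu> / 12"
  define H where "H t = t + \<mu> * exp (k * t)" for t
  have H_slope: "1/2 \<le> 1 + \<mu> * k * exp (k * s)" "1 + \<mu> * k * exp (k * s) \<le> 3/2" if "\<bar>s\<bar> \<le> K" for s
  proof -
    have "\<bar>\<mu> * k * exp (k * s)\<bar> = \<mu> * C * exp (k * s)"
      using \<open>0 < \<mu>\<close> by (simp add: abs_mult \<open>\<bar>k\<bar> = C\<close>)
    then have "\<bar>\<mu> * k * exp (k * s)\<bar> \<le> 1/2" using slope(2)[OF that] by linarith
    then show "1/2 \<le> 1 + \<mu> * k * exp (k * s)" "1 + \<mu> * k * exp (k * s) \<le> 3/2" by linarith+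
  qed
  have H_mono: "H t < H t'" if "- K \<le> t" "t < t'" "t' \<le> K" for t t'
    unfolding H_def
  proof (rule exponential_perturbation_strict_mono[OF _ that])
    show "0 < 1 + \<mu> * k * exp (k * s)" if "- K \<le> s" "s \<le> K" for s
    proof -
      have "\<bar>s\<bar> \<le> K" using that by simp
      then show ?thesis using H_slope(1)[of s] by linarith
    qed
  qed
  define f1 where "f1 x = H (v x) + \<nu> * (norm x)^2" for x
  have vK: "\<bar>v x\<bar> \<le> K" and wK: "\<bar>w x\<bar> \<le> K" if "x \<in> S" for x
    using v_range[OF that] w_range[OF that] by auto
  have \<nu>x: "0 \<le> \<nu> * (norm x)^2 \<and> \<nu> * (norm x)^2 \<le> \<gamma>'" if "x \<in> S" for x
  proof -
    have "\<nu> * (norm x)^2 \<le> \<nu> * R^2" using R[OF that] \<open>0 < \<nu>\<close> by (intro mult_left_mono power_mono) auto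
    then show ?thesis using \<nu>R \<open>0 < \<nu>\<close> by (meson order_trans mult_nonneg_nonneg less_imp_le zero_le_power2)
  qed
  have Hv: "v x \<le> H (v x) \<and> H (v x) \<le> v x + \<gamma>'" if "x \<in> S" for x
    using slope(3)[OF vK[OF that]] \<open>0 < \<mu>\<close> by (simp add: H_def)
  have f1v: "v x \<le> f1 x \<and> f1 x \<le> v x + 2 * \<gamma>'" if "x \<in> S" for x
    using \<nu>x[OF that] Hv[OF that] by (simp add: f1_def)
  have "usc_map S (\<lambda>x. H (v x))"
  proof (rule usc_map_compose_mono[OF usc(1)])
    show "continuous_on UNIV H" unfolding H_def by (intro continuous_intros)
    show "mono_on {- K..K} H"
    proof (rule mono_onI)
      show "H r \<le> H s" if "r \<in> {- K..K}" "s \<in> {- K..K}" "r \<le> s" for r s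
        using H_mono[of r s] that by (cases "r = s") auto
    qed
    show "v ` S \<subseteq> {- K..K}" using vK by (auto simp: abs_le_iff minus_le_iff)
  qed
  then have f1_usc: "usc_map S f1"
    unfolding f1_def by (rule usc_map_add) (intro usc_map_continuous continuous_intros)
  have f1_bound: "\<bar>f1 x\<bar> \<le> K + 1" and f2_bound: "\<bar>- w x\<bar> \<le> K + 1" if "x \<in> S" for x
    using f1v[OF that] vK[OF that] wK[OF that] \<gamma>' by auto
  have "0 < min \<rho>1 (min \<rho>2 \<tau>)" "0 < \<eta>"
    using \<open>0 < \<rho>1\<close> \<open>0 < \<rho>2\<close> \<open>0 < \<tau>\<close> \<open>0 < \<nu>\<close> by (auto simp: \<eta>_def)
  show False
  proof (rule doubled_contact[OF \<open>compact S\<close> f1_usc usc(2) f1_bound f2_bound x0(1) \<open>0 < min \<rho>1 (min \<rho>2 \<tau>)\<close> \<gamma>'(1) \<open>0 < \<nu>\<close> \<open>0 < \<eta>\<close>])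
    fix z y p q D d
    assume zy: "z \<in> S" "y \<in> S" and p: "norm p \<le> \<nu>" and close: "dist z y < min \<rho>1 (min \<rho>2 \<tau>)"
      and val: "f1 x0 + - w x0 - \<gamma>' < f1 z + - w y" and D: "linear D" "0 < d"
      and jet1: "\<And>h. norm h < d \<Longrightarrow> z + h \<in> S \<Longrightarrow> f1 (z + h) \<le> f1 z + q \<bullet> h + (h \<bullet> D h) / 2 + \<eta> * (norm h)^2"
      and jet2: "\<And>h. norm h < d \<Longrightarrow> y + h \<in> S \<Longrightarrow> - w (y + h) \<le> - w y + (p - q) \<bullet> h - (h \<bullet> D h) / 2 + \<eta> * (norm h)^2"
    \<comment> \<open>\<open>f1\<close> exceeds \<open>v\<close> by at most
      \<open>2 * \<gamma>'\<close>, and the doubled value loses less than \<open>\<gamma>'\<close>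
      against the touching point.\<close>
    have vw: "- 3 * \<gamma>' < v z - w y" using val f1v[OF x0(1)] f1v[OF zy(1)] x0(2) by linarith
    have "z \<notin> frontier G \<and> y \<notin> frontier G" using gap[OF zy] close vw \<gamma>' by fastforce
    then have zyG: "z \<in> G" "y \<in> G" using zy by (auto simp: S closure_Un_frontier)
    define s t where "s = v z" and "t = w y"
    have st: "s - t < \<tau>" using near[OF zy] close by (simp add: s_def t_def)
    have sK: "- K < s" "s < K" "\<bar>s\<bar> \<le> K" and tK: "t < K" "\<bar>t\<bar> \<le> K"
      using vw \<gamma>' v_range[OF zy(1)] w_range[OF zy(2)] by (auto simp: s_def t_def)
    obtain X where X: "X \<in> sym_matrices" "\<And>h. h \<bullet> (X *v h) = h \<bullet> D h"
      using symmetric_matrix_of_linear[OF D(1)] by blast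
    define g where "g = \<mu> * C * exp (k * s)"
    define Hp where "Hp = 1 + \<sigma> * g"
    have Hp_eq: "Hp = 1 + \<mu> * k * exp (k * s)" by (simp add: Hp_def g_def k_def)
    have Hp: "1/2 \<le> Hp" "Hp \<le> 3/2" unfolding Hp_eq by (rule H_slope[OF sK(3)])+
    have gg: "g0 \<le> g" unfolding g_def by (rule slope[OF sK(3)])
    have kg: "\<mu> * k^2 * exp (k * s) = C * g"
      unfolding k2 g_def by (simp add: power2_eq_square)
    \<comment> \<open>\<open>a\<close> and \<open>Y\<close> are the gradient and Hessian of
      \<open>v\<close> at \<open>z\<close>, solved from the chain rule for \<open>f1\<close> with
      the surplus \<open>4 * \<eta>\<close>; \<open>C * g\<close> is the second derivative of
      \<open>H\<close> at \<open>s\<close>.\<close>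
    define a where "a = (1 / Hp) *\<^sub>R (q - (2 * \<nu>) *\<^sub>R z)"
    have Hpa: "Hp *\<^sub>R a = q - (2 * \<nu>) *\<^sub>R z" using Hp by (simp add: a_def)
    define Y where "Y = (1 / Hp) *\<^sub>R (X + (4 * \<eta> - 2 * \<nu>) *\<^sub>R mat 1 - (C * g) *\<^sub>R outer_prod a a)"
    have "Y \<in> sym_matrices" unfolding Y_def by (intro sym_matrices_closed_ops X)
    have Yh: "Hp * (h \<bullet> (Y *v h)) = h \<bullet> D h + 4 * \<eta> * (norm h)^2 - 2 * \<nu> * (norm h)^2 - C * g * (a \<bullet> h)^2" for h
      unfolding Y_def using Hp by (simp only: quadratic_form_simps X(2)) (simp add: algebra_simps)
    obtain b' where "0 < b'" and b': "\<And>h. norm (Y *v h) \<le> b' * norm h"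
      using linear_bounded_pos[of "(*v) Y"] by (auto simp: matrix_vector_mul_linear)
    have "\<exists>d'>0. \<forall>h. norm h < d' \<longrightarrow> z + h \<in> S \<longrightarrow> v (z + h) \<le> v z + a \<bullet> h + (h \<bullet> (Y *v h)) / 2"
    proof (rule jet_of_exponential_perturbation[where b="\<lambda>h. h \<bullet> (Y *v h)" and m="\<lambda>h. h \<bullet> D h" and q=q
          and k=k and \<mu>=\<mu> and \<eta>=\<eta> and \<nu>=\<nu> and l="- K" and r=K and d=d and b'=b'])
      show "v (z + h) \<le> K" if "z + h \<in> S" for h using vK[OF that] by simp
      show "v (z + h) + \<mu> * exp (k * v (z + h)) + \<nu> * (norm (z + h))^2
          \<le> v z + \<mu> * exp (k * v z) + \<nu> * (norm z)^2 + q \<bullet> h + (h \<bullet> D h) / 2 + \<eta> * (norm h)^2"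
        if "norm h < d" "z + h \<in> S" for h
        using jet1[OF that] by (simp add: f1_def H_def)
      show "(1 + \<mu> * k * exp (k * v z)) *\<^sub>R a = q - (2 * \<nu>) *\<^sub>R z"
        using Hpa by (simp add: Hp_eq s_def)
      show "(1 + \<mu> * k * exp (k * v z)) * (h \<bullet> (Y *v h)) =
          h \<bullet> D h + 4 * \<eta> * (norm h)^2 - 2 * \<nu> * (norm h)^2 - \<mu> * k^2 * exp (k * v z) * (a \<bullet> h)^2" for h
        using Yh[of h] kg by (simp add: Hp_eq s_def)
      show "\<bar>h \<bullet> (Y *v h)\<bar> \<le> b' * (norm h)^2" for h
        using Cauchy_Schwarz_ineq2[of h "Y *v h"] mult_left_mono[OF b'[of h] norm_ge_zero[of h]]
        by (simp add: power2_eq_square mult_ac)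
      show "t + \<mu> * exp (k * t) < t' + \<mu> * exp (k * t')" if "- K \<le> t" "t < t'" "t' \<le> K" for t t'
        using H_mono[OF that] by (simp add: H_def)
    qed (use \<open>0 < \<mu>\<close> \<open>0 < \<eta>\<close> D sK \<open>0 < b'\<close> in \<open>auto simp: s_def\<close>)
    then obtain d' where "0 < d'" and
      jet_v: "\<And>h. norm h < d' \<Longrightarrow> z + h \<in> S \<Longrightarrow> v (z + h) \<le> v z + a \<bullet> h + (h \<bullet> (Y *v h)) / 2" by blast
    have GS: "x \<in> S" if "x \<in> G" for x using that closure_subset S by blast
    have inP: "Y + L_op \<alpha> \<beta> z s a \<in> P"
      unfolding s_def
      by (rule sub[OF zyG(1) _ \<open>Y \<in> sym_matrices\<close> \<open>0 < d'\<close>]) (use sK GS jet_v in \<open>auto simp: s_def\<close>)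
    have inN: "(X - (2 * \<eta>) *\<^sub>R mat 1) + L_op \<alpha> \<beta> y t (q - p) \<in> N"
      unfolding t_def
    proof (rule super[OF zyG(2) _ _ D(2)])
      show "w y + (q - p) \<bullet> h + (h \<bullet> ((X - (2 * \<eta>) *\<^sub>R mat 1) *v h)) / 2 \<le> w (y + h)"
        if "norm h < d" "y + h \<in> G" for h
      proof -
        have "h \<bullet> ((X - (2 * \<eta>) *\<^sub>R mat 1) *v h) = h \<bullet> D h - 2 * \<eta> * (norm h)^2"
          by (simp only: quadratic_form_simps X(2))
        then show ?thesis using jet2[OF that(1) GS[OF that(2)]] unfolding inner_diff_left by linarith
      qed
      show "X - (2 * \<eta>) *\<^sub>R mat 1 \<in> sym_matrices" by (intro sym_matrices_closed_ops X)
    qed (use tK in \<open>simp add: t_def\<close>)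
    show False
    proof (rule contra[OF inP inN])
      show "0 < Hp" using Hp by simp
      show "pos_definite (X - (2 * \<eta>) *\<^sub>R mat 1 + L_op \<alpha> \<beta> y t (q - p) - Hp *\<^sub>R (Y + L_op \<alpha> \<beta> z s a))"
        unfolding pos_definite_def
      proof (intro allI impI)
        fix u :: "real ^ 'n" assume "u \<noteq> 0"
        \<comment> \<open>The difference between the gradients of \<open>w\<close> at
          \<open>y\<close> and of \<open>H (v)\<close> at \<open>z\<close>: the derivative of
          \<open>\<nu> |x|^2\<close> minus the tilt.\<close>
        define \<epsilon> where "\<epsilon> = (2 * \<nu>) *\<^sub>R z - p"
        have qp: "q - p = Hp *\<^sub>R a + \<epsilon>" unfolding Hpa by (simp add: \<epsilon>_def)
        let ?p = "Hp *\<^sub>R a + \<epsilon>"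
        have "norm \<epsilon> \<le> (2 * R + 1) * \<nu>"
        proof -
          have "norm \<epsilon> \<le> 2 * \<nu> * norm z + norm p"
            using norm_triangle_ineq4[of "(2 * \<nu>) *\<^sub>R z" p] \<open>0 < \<nu>\<close> by (simp add: \<epsilon>_def)
          also have "\<dots> \<le> 2 * \<nu> * R + \<nu>"
            using p R[OF zy(1)] \<open>0 < \<nu>\<close> by (intro add_mono mult_left_mono) auto
          finally show ?thesis by (simp add: algebra_simps)
        qed
        then have "(norm \<epsilon>)^2 \<le> ((2 * R + 1) * \<nu>)^2" by (intro power_mono) auto
        then have "c1 * (norm \<epsilon>)^2 \<le> c1 * ((2 * R + 1) * \<nu>)^2" using \<open>2 \<le> c1\<close> by (intro mult_left_mono) auto
        also have "\<dots> = (c1 * (2 * R + 1)^2 * \<nu>) * \<nu>" by (simp add: power_mult_distrib power2_eq_square)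
        also have "\<dots> \<le> 1/2 * \<nu>" using c1\<nu> \<open>0 < \<nu>\<close> by (intro mult_right_mono) auto
        finally have "c1 * (norm \<epsilon>)^2 * (norm u)^2 \<le> 1/2 * \<nu> * (norm u)^2" by (rule mult_right_mono) simp
        moreover have "- c1 * (norm \<epsilon>)^2 * (norm u)^2 \<le>
          C * g * (a \<bullet> u)^2 + (\<alpha> z s * (?p \<bullet> u)^2 - \<beta> z s * (norm ?p)^2 * (norm u)^2)
          - (4 * \<Lambda> * \<tau>) * (norm ?p)^2 * (norm u)^2
          - Hp * (\<alpha> z s * (a \<bullet> u)^2 - \<beta> z s * (norm a)^2 * (norm u)^2)"
          unfolding c1_def
          by (rule perturbed_form_gap)
            (use \<alpha>0[OF zy(1) sK(3)] \<beta>0[OF zy(1) sK(3)] \<open>0 < g0\<close> gg \<sigma> Hp_def Hp C_def \<open>0 \<le> b0\<close> \<beta>_sign[OF zy(1) sK(3)]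
              \<open>0 \<le> \<Lambda>\<close> \<open>0 < \<tau>\<close> \<tau> in auto)
        moreover have "\<alpha> z s * (?p \<bullet> u)^2 - \<beta> z s * (norm ?p)^2 * (norm u)^2 - 4 * \<Lambda> * \<tau> * (norm ?p)^2 * (norm u)^2
          \<le> \<alpha> y t * (?p \<bullet> u)^2 - \<beta> y t * (norm ?p)^2 * (norm u)^2"
        proof (rule form_monotone_lipschitz[OF mono[OF zy(2)]])
          show "\<bar>\<alpha> y r - \<alpha> z s\<bar> \<le> \<Lambda> * (dist y z + \<bar>r - s\<bar>)" if "r \<in> {s, t}" for r
            using \<alpha>_lip[OF zy(2,1) _ sK(3), of r] sK(3) tK(2) that by auto
          show "\<bar>\<beta> y r - \<beta> z s\<bar> \<le> \<Lambda> * (dist y z + \<bar>r - s\<bar>)" if "r \<in> {s, t}" for r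
            using \<beta>_lip[OF zy(2,1) _ sK(3), of r] sK(3) tK(2) that by auto
          show "dist y z \<le> \<tau>" using close by (simp add: dist_commute)
        qed (use \<open>0 \<le> \<Lambda>\<close> st in auto)
        moreover have "u \<bullet> ((X - (2 * \<eta>) *\<^sub>R mat 1 + L_op \<alpha> \<beta> y t ?p - Hp *\<^sub>R (Y + L_op \<alpha> \<beta> z s a)) *v u) =
          (u \<bullet> D u - 2 * \<eta> * (norm u)^2 + (\<alpha> y t * (?p \<bullet> u)^2 - \<beta> y t * (norm ?p)^2 * (norm u)^2))
          - (u \<bullet> D u + 4 * \<eta> * (norm u)^2 - 2 * \<nu> * (norm u)^2 - C * g * (a \<bullet> u)^2)
          - Hp * (\<alpha> z s * (a \<bullet> u)^2 - \<beta> z s * (norm a)^2 * (norm u)^2)"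
          unfolding Yh[of u, symmetric] by (simp only: quadratic_form_simps X(2)) (simp add: distrib_left)
        moreover have "0 < \<nu> * (norm u)^2" using \<open>0 < \<nu>\<close> \<open>u \<noteq> 0\<close> by simp
        moreover have "\<eta> * (norm u)^2 = \<nu> * (norm u)^2 / 12" by (simp add: \<eta>_def)
        ultimately show "0 < u \<bullet> ((X - (2 * \<eta>) *\<^sub>R mat 1 + L_op \<alpha> \<beta> y t (q - p) - Hp *\<^sub>R (Y + L_op \<alpha> \<beta> z s a)) *v u)"
          unfolding qp by linarith
      qed
    qed
  qed
qed

section \<open>Reduction to real-valued functions\<close>

lemma usc_mapI:
  assumes "\<And>x c. x \<in> S \<Longrightarrow> f x < c \<Longrightarrow> \<forall>\<^sub>F y in at x within S. f y < c"
  shows "usc_map S f"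
  unfolding usc_map_def
proof (intro ballI allI impI)
  fix x c assume x: "x \<in> S" "f x < c"
  obtain T where T: "open T" "x \<in> T" "\<forall>y\<in>T. y \<noteq> x \<longrightarrow> y \<in> S \<longrightarrow> f y < c"
    using assms[OF x] unfolding eventually_at_topological by blast
  have "\<forall>y\<in>T \<inter> S. f y < c"
  proof
    fix y assume "y \<in> T \<inter> S"
    then show "f y < c" using T(3) x(2) by (cases "y = x") auto
  qed
  then show "\<exists>T. open T \<and> x \<in> T \<and> (\<forall>y\<in>T \<inter> S. f y < c)" using T(1,2) by (intro exI conjI)
qed

lemma usc_on_imp_usc_map:
  assumes "usc_on S v"
  shows "usc_map S v"
proof (rule usc_mapI)
  fix x c assume "x \<in> S" "v x < c"
  then have "Limsup (at x within S) v < c" using assms unfolding usc_on_def by (meson le_less_trans)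
  then show "\<forall>\<^sub>F y in at x within S. v y < c" by (rule Limsup_lessD)
qed

lemma lsc_on_imp_usc_map_uminus:
  assumes "lsc_on S w"
  shows "usc_map S (\<lambda>x. - w x)"
proof (rule usc_mapI)
  fix x c assume "x \<in> S" "- w x < c"
  then have "- c < w x" by (metis ereal_minus_less_minus ereal_uminus_uminus)
  then have "- c < Liminf (at x within S) w" using assms \<open>x \<in> S\<close> unfolding lsc_on_def by (meson less_le_trans)
  then have "\<forall>\<^sub>F y in at x within S. - c < w y" by (rule less_LiminfD)
  then show "\<forall>\<^sub>F y in at x within S. - w y < c"
    by (rule eventually_mono) (metis ereal_minus_less_minus ereal_uminus_uminus)
qed

lemma usc_map_bounded_above:
  assumes "compact S" "usc_map S f" and fin: "\<And>x. x \<in> S \<Longrightarrow> f x \<noteq> \<infinity>"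
  shows "\<exists>B. \<forall>x\<in>S. f x \<le> ereal B"
proof -
  have "\<exists>n T. open T \<and> x \<in> T \<and> (\<forall>y\<in>T \<inter> S. f y < ereal (real n))" if xS: "x \<in> S" for x
  proof -
    obtain n :: nat where "f x < ereal (real n)" using fin[OF xS] less_PInf_Ex_of_nat by auto
    then show ?thesis using assms(2) xS unfolding usc_map_def by blast
  qed
  then have "\<forall>x. \<exists>n T. x \<in> S \<longrightarrow> open T \<and> x \<in> T \<and> (\<forall>y\<in>T \<inter> S. f y < ereal (real n))" by blast
  then obtain n T where nT: "\<And>x. x \<in> S \<Longrightarrow> open (T x) \<and> x \<in> T x \<and> (\<forall>y\<in>T x \<inter> S. f y < ereal (real (n x)))"
    by metis
  have "S \<subseteq> (\<Union>x\<in>S. T x)" using nT by auto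
  then obtain C where C: "C \<subseteq> S" "finite C" "S \<subseteq> (\<Union>x\<in>C. T x)"
    using compactE_image[OF assms(1), of S T] nT by metis
  have "f y \<le> ereal (real (\<Sum>x\<in>C. n x))" if yS: "y \<in> S" for y
  proof -
    obtain x where x: "x \<in> C" "y \<in> T x" using C(3) yS by blast
    then have "f y < ereal (real (n x))" using nT C(1) yS by blast
    moreover have "n x \<le> (\<Sum>x\<in>C. n x)" using member_le_sum[of x C n] x(1) C(2) by simp
    ultimately show ?thesis by (meson ereal_less_eq(3) less_imp_le of_nat_mono order_trans)
  qed
  then show ?thesis by blast
qed

text \<open>\<open>g\<close> dominates \<open>f\<close> and agrees with it above the level
  \<open>l\<close>, so a test function that touches \<open>g\<close> from above at such a point
  touches \<open>f\<close> as well. This removes the infinite values.\<close>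

lemma truncate_below:
  fixes f :: "'a::topological_space \<Rightarrow> ereal"
  assumes "usc_map S f" and bound: "\<And>x. x \<in> S \<Longrightarrow> f x \<le> ereal B" and "l \<le> B"
  obtains g where "usc_map S g" "\<And>x. x \<in> S \<Longrightarrow> f x \<le> ereal (g x)" "\<And>x. x \<in> S \<Longrightarrow> l \<le> g x \<and> g x \<le> B"
    "\<And>x. x \<in> S \<Longrightarrow> l < g x \<Longrightarrow> f x = ereal (g x)"
proof -
  define g where "g x = real_of_ereal (max (f x) (ereal l))" for x
  have g: "ereal (g x) = max (f x) (ereal l)" if "x \<in> S" for x
    using bound[OF that] unfolding g_def by (cases "f x") (simp_all add: max_def)
  have "usc_map S g"
    unfolding usc_map_def
  proof (intro ballI allI impI)
    fix x c assume "x \<in> S" "g x < c"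
    then have "max (f x) (ereal l) < ereal c" using g by (metis less_ereal.simps(1))
    then have "f x < ereal c" "ereal l < ereal c" by auto
    then obtain T where T: "open T" "x \<in> T" "\<forall>y\<in>T \<inter> S. f y < ereal c"
      using assms(1) \<open>x \<in> S\<close> unfolding usc_map_def by blast
    have "g y < c" if "y \<in> T \<inter> S" for y
    proof -
      have "max (f y) (ereal l) < ereal c" using T(3) that \<open>ereal l < ereal c\<close> by simp
      then have "ereal (g y) < ereal c" using g[of y] that by simp
      then show ?thesis by simp
    qed
    then show "\<exists>T. open T \<and> x \<in> T \<and> (\<forall>y\<in>T \<inter> S. g y < c)" using T(1,2) by (intro exI conjI) auto
  qed
  moreover have "f x \<le> ereal (g x)" "l \<le> g x \<and> g x \<le> B" "l < g x \<Longrightarrow> f x = ereal (g x)" if "x \<in> S" for x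
  proof -
    show "f x \<le> ereal (g x)" unfolding g[OF that] by simp
    have "ereal l \<le> ereal (g x)" "ereal (g x) \<le> ereal B" unfolding g[OF that] using bound[OF that] \<open>l \<le> B\<close> by simp_all
    then show "l \<le> g x \<and> g x \<le> B" by simp
    show "f x = ereal (g x)" if "l < g x" using g[OF \<open>x \<in> S\<close>] that by (simp add: max_def split: if_splits)
  qed
  ultimately show thesis using that by blast
qed

section \<open>Stability of positive definiteness, the set U and regularity of the
  coefficients\<close>

lemma norm_matrix_vector_mult_le:
  fixes A :: "real ^ 'n ^ 'm"
  shows "norm (A *v x) \<le> real CARD('m) * norm A * norm x"
proof -
  have "norm (A *v x) \<le> (\<Sum>i\<in>(UNIV :: 'm set). \<bar>(A *v x) $ i\<bar>)" by (rule norm_le_l1_cart)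
  also have "\<dots> \<le> (\<Sum>i\<in>(UNIV :: 'm set). norm A * norm x)"
  proof (rule sum_mono)
    fix i :: 'm
    have "\<bar>(A *v x) $ i\<bar> \<le> norm (A $ i) * norm x"
      unfolding matrix_vector_mul_component by (rule Cauchy_Schwarz_ineq2)
    also have "\<dots> \<le> norm A * norm x"
      by (intro mult_right_mono Finite_Cartesian_Product.norm_nth_le) simp
    finally show "\<bar>(A *v x) $ i\<bar> \<le> norm A * norm x" .
  qed
  finally show ?thesis by simp
qed

lemma pos_definite_coercive:
  fixes M :: "real ^ 'n ^ 'n"
  assumes "pos_definite M"
  shows "\<exists>\<delta>>0. \<forall>x. \<delta> * (norm x)^2 \<le> x \<bullet> (M *v x)"
proof -
  let ?S = "sphere (0 :: real ^ 'n) 1"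
  have "continuous_on ?S (\<lambda>x. x \<bullet> (M *v x))"
    by (intro continuous_intros linear_continuous_on matrix_vector_mul_bounded_linear)
  moreover have "?S \<noteq> {}" by simp
  ultimately obtain x0 where x0: "x0 \<in> ?S" "\<forall>x\<in>?S. x0 \<bullet> (M *v x0) \<le> x \<bullet> (M *v x)"
    using continuous_attains_inf[OF compact_sphere] by blast
  have "x0 \<noteq> 0" using x0(1) by auto
  then have "0 < x0 \<bullet> (M *v x0)" using assms unfolding pos_definite_def by blast
  moreover have "(x0 \<bullet> (M *v x0)) * (norm x)^2 \<le> x \<bullet> (M *v x)" for x
  proof (cases "x = 0")
    case False
    define e where "e = (1 / norm x) *\<^sub>R x"
    have "e \<in> ?S" using False by (simp add: e_def)
    then have "x0 \<bullet> (M *v x0) \<le> e \<bullet> (M *v e)" using x0(2) by blast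
    moreover have x: "x = norm x *\<^sub>R e" using False by (simp add: e_def)
    have "x \<bullet> (M *v x) = (norm x)^2 * (e \<bullet> (M *v e))"
      by (subst (1 2) x) (simp add: matrix_vector_mult_scaleR power2_eq_square)
    ultimately show ?thesis
      using mult_right_mono[of "x0 \<bullet> (M *v x0)" "e \<bullet> (M *v e)" "(norm x)^2"] by (simp only: mult.commute zero_le_power2)
  qed simp
  ultimately show ?thesis by blast
qed

text \<open>Coercivity of the positive definite difference leaves room to replace \<open>A\<close>
  by a nearby \<open>A'\<close> in \<open>U\<close> itself; then \<open>B\<close> is
  \<open>c *\<^sub>R A'\<close> plus a positive definite matrix.\<close>

lemma closure_dominated_mem:
  fixes U :: "(real ^ 'n ^ 'n) set"
  assumes sym: "U \<subseteq> sym_matrices"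
    and up: "\<And>A B. A \<in> U \<Longrightarrow> B \<in> sym_matrices \<Longrightarrow> pos_definite B \<Longrightarrow> A + B \<in> U"
    and cone: "\<And>A c. A \<in> U \<Longrightarrow> 0 < c \<Longrightarrow> c *\<^sub>R A \<in> U"
    and "A \<in> closure U" "B \<in> sym_matrices" "0 < c" and pd: "pos_definite (B - c *\<^sub>R A)"
  shows "B \<in> U"
proof -
  obtain \<delta> where "0 < \<delta>" and \<delta>: "\<And>x. \<delta> * (norm x)^2 \<le> x \<bullet> ((B - c *\<^sub>R A) *v x)"
    using pos_definite_coercive[OF pd] by blast
  \<comment> \<open>\<open>CARD('n)\<close> comes from bounding the action of a matrix by its norm;
    the replacement then costs at most half of \<delta>.\<close>
  define e where "e = \<delta> / (2 * c * CARD('n))"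
  have "0 < e" using \<open>0 < \<delta>\<close> \<open>0 < c\<close> by (simp add: e_def)
  then obtain A' where A': "A' \<in> U" "dist A' A < e"
    using \<open>A \<in> closure U\<close> unfolding closure_approachable by blast
  have "pos_definite (B - c *\<^sub>R A')"
    unfolding pos_definite_def
  proof (intro allI impI)
    fix x :: "real ^ 'n" assume "x \<noteq> 0"
    have "\<bar>x \<bullet> ((A' - A) *v x)\<bar> \<le> norm x * norm ((A' - A) *v x)" by (rule Cauchy_Schwarz_ineq2)
    also have "\<dots> \<le> norm x * (real CARD('n) * norm (A' - A) * norm x)"
      by (intro mult_left_mono norm_matrix_vector_mult_le) simp
    also have "\<dots> = (real CARD('n) * (norm x)^2) * norm (A' - A)" by (simp add: power2_eq_square mult_ac)
    also have "\<dots> \<le> (real CARD('n) * (norm x)^2) * e"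
      using A'(2) by (intro mult_left_mono) (auto simp: dist_norm)
    finally have "c * (x \<bullet> ((A' - A) *v x)) \<le> c * ((real CARD('n) * (norm x)^2) * e)"
      using \<open>0 < c\<close> by (intro mult_left_mono) auto
    also have "\<dots> = \<delta> / 2 * (norm x)^2" using \<open>0 < c\<close> by (simp add: e_def)
    finally have "c * (x \<bullet> (A' *v x)) - c * (x \<bullet> (A *v x)) \<le> \<delta> / 2 * (norm x)^2"
      by (simp add: quadratic_form_diff right_diff_distrib)
    moreover have "\<delta> * (norm x)^2 \<le> x \<bullet> (B *v x) - c * (x \<bullet> (A *v x))"
      using \<delta>[of x] by (simp add: quadratic_form_diff quadratic_form_scaleR)
    moreover have "0 < \<delta> * (norm x)^2" using \<open>0 < \<delta>\<close> \<open>x \<noteq> 0\<close> by simp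
    ultimately show "0 < x \<bullet> ((B - c *\<^sub>R A') *v x)"
      by (simp add: quadratic_form_diff quadratic_form_scaleR)
  qed
  moreover have "B - c *\<^sub>R A' \<in> sym_matrices" using assms(5) A'(1) sym by (intro sym_matrices_closed_ops) auto
  ultimately have "c *\<^sub>R A' + (B - c *\<^sub>R A') \<in> U" using up cone A'(1) \<open>0 < c\<close> by blast
  then show ?thesis by simp
qed

lemma loc_lipschitz_on_slab:
  fixes f :: "'a::euclidean_space \<Rightarrow> real \<Rightarrow> real"
  assumes "loc_lipschitz_on (S \<times> UNIV) (\<lambda>(x, s). f x s)" "compact S"
  shows "\<exists>L A. 0 \<le> L \<and> (\<forall>x\<in>S. \<forall>y\<in>S. \<forall>s t. \<bar>s\<bar> \<le> K \<longrightarrow> \<bar>t\<bar> \<le> K \<longrightarrow> \<bar>f x s - f y t\<bar> \<le> L * (dist x y + \<bar>s - t\<bar>)) \<and>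
    (\<forall>x\<in>S. \<forall>s. \<bar>s\<bar> \<le> K \<longrightarrow> \<bar>f x s\<bar> \<le> A)"
proof -
  let ?T = "S \<times> {- K..K}"
  have "compact ?T" using assms(2) by (intro compact_Times) auto
  then obtain L where L: "L-lipschitz_on ?T (\<lambda>(x, s). f x s)"
    using assms(1) unfolding loc_lipschitz_on_def by blast
  have "0 \<le> L" using L by (rule lipschitz_on_nonneg)
  have "\<bar>f x s - f y t\<bar> \<le> L * (dist x y + \<bar>s - t\<bar>)" if "x \<in> S" "y \<in> S" "\<bar>s\<bar> \<le> K" "\<bar>t\<bar> \<le> K" for x y s t
  proof -
    have "(x, s) \<in> ?T" "(y, t) \<in> ?T" using that by auto
    from lipschitz_onD[OF L this] have "\<bar>f x s - f y t\<bar> \<le> L * dist (x, s) (y, t)" by (simp add: dist_real_def)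
    also have "\<dots> \<le> L * (dist x y + \<bar>s - t\<bar>)"
      using \<open>0 \<le> L\<close> sqrt_sum_squares_le_sum_abs[of "dist x y" "s - t"]
      by (intro mult_left_mono) (simp_all add: dist_Pair_Pair dist_real_def)
    finally show ?thesis .
  qed
  moreover have "bounded ((\<lambda>(x, s). f x s) ` ?T)"
    by (intro compact_imp_bounded compact_continuous_image lipschitz_on_continuous_on[OF L]) fact
  then obtain A where "\<forall>p\<in>?T. \<bar>case p of (x, s) \<Rightarrow> f x s\<bar> \<le> A" unfolding bounded_iff by auto
  then have "\<bar>f x s\<bar> \<le> A" if "x \<in> S" "\<bar>s\<bar> \<le> K" for x s
    using that by (auto simp: abs_le_iff minus_le_iff)
  ultimately show ?thesis using \<open>0 \<le> L\<close> by blast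
qed

lemma loc_lipschitz_on_imp_continuous_slices:
  fixes f :: "'a::euclidean_space \<Rightarrow> real \<Rightarrow> real"
  assumes "loc_lipschitz_on (S \<times> UNIV) (\<lambda>(x, s). f x s)" "compact S"
  shows "continuous_on S (\<lambda>x. f x s)" "x \<in> S \<Longrightarrow> continuous_on UNIV (f x)"
proof -
  have cont: "continuous_on (S \<times> {- K..K}) (\<lambda>(x, s). f x s)" for K
  proof -
    have "compact (S \<times> {- K..K})" using assms(2) by (intro compact_Times) auto
    then show ?thesis using assms(1) unfolding loc_lipschitz_on_def by (metis lipschitz_on_continuous_on subset_UNIV Sigma_mono subset_refl)
  qed
  show "continuous_on S (\<lambda>x. f x s)"
    using continuous_on_compose2[OF cont[of "\<bar>s\<bar>"], of S "\<lambda>x. (x, s)"]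
    by (force intro: continuous_intros)
  assume "x \<in> S"
  have "continuous_on {- K<..<K} (f x)" for K
    using continuous_on_compose2[OF cont[of K], of "{- K<..<K}" "\<lambda>s. (x, s)"] \<open>x \<in> S\<close>
    by (force intro: continuous_intros)
  then have "continuous_on (\<Union>K. {- K<..<K}) (f x)"
    by (intro continuous_on_open_UN) auto
  moreover have "(\<Union>K. {- K<..<K}) = (UNIV :: real set)"
  proof -
    have "s \<in> {- (\<bar>s\<bar> + 1)<..<\<bar>s\<bar> + 1}" for s :: real by auto
    then show ?thesis by blast
  qed
  ultimately show "continuous_on UNIV (f x)" by simp
qed

lemma sign_constant_on_line:
  fixes f :: "real \<Rightarrow> real"
  assumes "continuous_on UNIV f" "\<And>s. f s \<noteq> 0"
  shows "0 < f s * f t"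
proof (rule ccontr)
  assume "\<not> 0 < f s * f t"
  then have "f s * f t < 0" using assms(2) by (simp add: not_less order_le_less)
  then have "(f s < 0 \<and> 0 < f t) \<or> (0 < f s \<and> f t < 0)" by (auto simp: mult_less_0_iff)
  then have "0 \<in> f ` UNIV"
    using connectedD_interval[OF connected_continuous_image[OF assms(1) connected_UNIV], of "f s" "f t" 0]
      connectedD_interval[OF connected_continuous_image[OF assms(1) connected_UNIV], of "f t" "f s" 0] by auto
  then show False using assms(2) by force
qed

text \<open>Both parts at once: the maximum \<open>m\<close> of the difference is removed by moving
  \<open>v\<close> down and \<open>w\<close> up by \<open>m / 2\<close>. For the strict statement
  \<open>m = 0\<close> and nothing moves; otherwise the coefficients are constant and
  \<open>L_op\<close> does not see the shift. In either case the maximum is not attained on the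
  frontier.\<close>

lemma no_interior_contact:
  fixes \<Omega> :: "(real ^ 'n) set" and \<alpha> \<beta> :: "real ^ 'n \<Rightarrow> real \<Rightarrow> real"
    and U :: "(real ^ 'n ^ 'n) set" and w v :: "real ^ 'n \<Rightarrow> ereal"
  defines "const \<equiv> (\<lambda>(x, s). \<alpha> x s) constant_on (closure \<Omega> \<times> UNIV) \<and> (\<lambda>(x, s). \<beta> x s) constant_on (closure \<Omega> \<times> UNIV)"
  assumes \<Omega>: "bounded \<Omega>" "open \<Omega>"
    and \<alpha>_lip: "loc_lipschitz_on (closure \<Omega> \<times> UNIV) (\<lambda>(x, s). \<alpha> x s)"
    and \<beta>_lip: "loc_lipschitz_on (closure \<Omega> \<times> UNIV) (\<lambda>(x, s). \<beta> x s)"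
    and mono: "\<And>x s t p. x \<in> closure \<Omega> \<Longrightarrow> s \<le> t \<Longrightarrow> matrix_le (L_op \<alpha> \<beta> x s p) (L_op \<alpha> \<beta> x t p)"
    and cases: "(\<exists>\<beta>0>0. \<forall>x\<in>closure \<Omega>. \<forall>s. \<bar>\<beta> x s\<bar> > \<beta>0) \<or> const"
    and U_sym: "U \<subseteq> sym_matrices"
    and up: "\<And>A B. A \<in> U \<Longrightarrow> B \<in> sym_matrices \<Longrightarrow> pos_definite B \<Longrightarrow> A + B \<in> U"
    and cone: "\<And>A c. A \<in> U \<Longrightarrow> c > 0 \<Longrightarrow> c *\<^sub>R A \<in> U"
    and w: "lsc_on (closure \<Omega>) w" "visc_supersolution (F_op \<alpha> \<beta>) U \<Omega> w"
    and v: "usc_on (closure \<Omega>) v" "visc_subsolution (F_op \<alpha> \<beta>) U \<Omega> v"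
    and x1: "x1 \<in> closure \<Omega>"
    and contact: "(\<forall>x\<in>closure \<Omega>. v x \<le> w x) \<and> (\<forall>x\<in>frontier \<Omega>. v x < w x) \<and> w x1 \<le> v x1 \<or>
      const \<and> (\<forall>x\<in>frontier \<Omega>. v x \<le> w x) \<and> w x1 < v x1"
  shows False
proof -
  define S where "S = closure \<Omega>"
  have "compact S" using \<Omega>(1) by (simp add: S_def)
  have \<Omega>S: "\<Omega> \<subseteq> S" "frontier \<Omega> \<subseteq> S" by (auto simp: S_def closure_subset frontier_def)
  have "x1 \<in> S" using x1 by (simp add: S_def)
  have v_fin: "v x \<noteq> \<infinity>" and w_fin: "- w x \<noteq> \<infinity>" if "x \<in> S" for x
    using v(1) w(1) that unfolding usc_on_def lsc_on_def S_def by (auto simp: ereal_uminus_eq_reorder)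
  have v_usc: "usc_map S v" and w_usc: "usc_map S (\<lambda>x. - w x)"
    using usc_on_imp_usc_map[OF v(1)] lsc_on_imp_usc_map_uminus[OF w(1)] by (auto simp: S_def)
  obtain B1 where B1: "\<forall>x\<in>S. v x \<le> ereal B1"
    using usc_map_bounded_above[OF \<open>compact S\<close> v_usc v_fin] by blast
  obtain B2 where B2: "\<forall>x\<in>S. - w x \<le> ereal B2"
    using usc_map_bounded_above[OF \<open>compact S\<close> w_usc w_fin] by blast
  \<comment> \<open>Where \<open>vr + nr\<close> is non-negative, each summand is at least minus the
    upper bound of the other and hence above \<open>- k\<close>, so neither truncation is active
    there.\<close>
  define k where "k = \<bar>B1\<bar> + \<bar>B2\<bar> + 1"
  obtain vr where vr_usc: "usc_map S vr" and v_le: "\<And>x. x \<in> S \<Longrightarrow> v x \<le> ereal (vr x)"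
    and vr: "\<And>x. x \<in> S \<Longrightarrow> - k \<le> vr x \<and> vr x \<le> B1" and v_eq: "\<And>x. x \<in> S \<Longrightarrow> - k < vr x \<Longrightarrow> v x = ereal (vr x)"
    by (rule truncate_below[OF v_usc bspec[OF B1], of "- k"]) (assumption | rule that | simp add: k_def)+
  obtain nr where nr_usc: "usc_map S nr" and nr_ge: "\<And>x. x \<in> S \<Longrightarrow> - w x \<le> ereal (nr x)"
    and nr: "\<And>x. x \<in> S \<Longrightarrow> - k \<le> nr x \<and> nr x \<le> B2" and nr_eq: "\<And>x. x \<in> S \<Longrightarrow> - k < nr x \<Longrightarrow> - w x = ereal (nr x)"
    by (rule truncate_below[OF w_usc bspec[OF B2], of "- k"]) (assumption | rule that | simp add: k_def)+
  have w_ge: "ereal (- nr x) \<le> w x" if "x \<in> S" for x using nr_ge[OF that] by (cases "w x") simp_all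
  have w_eq: "w x = ereal (- nr x)" if "x \<in> S" "- k < nr x" for x using nr_eq[OF that] by (cases "w x") simp_all
  have "S \<noteq> {}" using \<open>x1 \<in> S\<close> by blast
  from usc_map_attains_max[OF \<open>compact S\<close> this usc_map_add[OF vr_usc nr_usc]]
  obtain x0 where x0: "x0 \<in> S" "\<forall>x\<in>S. vr x + nr x \<le> vr x0 + nr x0" by (elim bexE)
  define m where "m = vr x0 + nr x0"
  have "w x1 \<le> v x1" using contact by auto
  have "ereal (- nr x1) \<le> ereal (vr x1)"
    using w_ge[OF \<open>x1 \<in> S\<close>] v_le[OF \<open>x1 \<in> S\<close>] \<open>w x1 \<le> v x1\<close> by (meson order_trans)
  then have "0 \<le> m" using bspec[OF x0(2) \<open>x1 \<in> S\<close>] by (simp add: m_def)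
  have untruncated: "v x = ereal (vr x) \<and> w x = ereal (- nr x)" if "x \<in> S" "0 \<le> vr x + nr x" for x
    using that vr[OF that(1)] nr[OF that(1)] by (intro conjI v_eq w_eq) (auto simp: k_def)
  have shift: "m = 0 \<and> (\<forall>x\<in>frontier \<Omega>. v x < w x) \<or> 0 < m \<and> const \<and> (\<forall>x\<in>frontier \<Omega>. v x \<le> w x)"
    using contact
  proof (elim disjE conjE)
    assume "\<forall>x\<in>closure \<Omega>. v x \<le> w x" "\<forall>x\<in>frontier \<Omega>. v x < w x"
    moreover from this have "m \<le> 0" using untruncated[OF x0(1)] x0(1) \<open>0 \<le> m\<close> by (auto simp: m_def S_def)
    ultimately show ?thesis using \<open>0 \<le> m\<close> by simp
  next
    assume "const" "\<forall>x\<in>frontier \<Omega>. v x \<le> w x" "w x1 < v x1"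
    moreover from this have "ereal (- nr x1) < ereal (vr x1)"
      using w_ge[OF \<open>x1 \<in> S\<close>] v_le[OF \<open>x1 \<in> S\<close>] by (meson le_less_trans less_le_trans)
    then have "0 < m" using bspec[OF x0(2) \<open>x1 \<in> S\<close>] by (simp add: m_def)
    ultimately show ?thesis by simp
  qed
  have bd: "vr x + nr x < m" if "x \<in> frontier \<Omega>" for x
  proof (rule ccontr)
    assume ge: "\<not> ?thesis"
    then have "v x = ereal (vr x) \<and> w x = ereal (- nr x)"
      using that \<Omega>S(2) \<open>0 \<le> m\<close> by (intro untruncated) auto
    then show False using shift ge that by force
  qed
  have "x0 \<in> \<Omega>"
    using x0(1) bd[of x0] closure_Un_frontier[of \<Omega>] by (auto simp: S_def m_def)
  \<comment> \<open>The even split leaves both functions in one symmetric range, with a margin of 1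
    on the side where they were not cut.\<close>
  define va wa where "va x = vr x - m / 2" and "wa x = m / 2 - nr x" for x
  define K where "K = k + m / 2"
  have "0 < K" using \<open>0 \<le> m\<close> by (simp add: K_def k_def)
  have v_eq': "v x = ereal (va x + m / 2)" if "x \<in> S" "- K < va x" for x
    using v_eq[OF that(1)] that(2) by (simp add: va_def K_def)
  have w_eq': "w x = ereal (wa x - m / 2)" if "x \<in> S" "wa x < K" for x
    using w_eq[OF that(1)] that(2) by (simp add: wa_def K_def)
  have va_range: "- K \<le> va x \<and> va x \<le> K - 1" and wa_range: "- K + 1 \<le> wa x \<and> wa x \<le> K" if "x \<in> S" for x
    using vr[OF that] nr[OF that] \<open>0 \<le> m\<close> by (auto simp: va_def wa_def K_def k_def)
  have le': "va x \<le> wa x" if "x \<in> S" for x using bspec[OF x0(2) that] by (simp add: va_def wa_def m_def field_simps)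
  have bd': "va x < wa x" if "x \<in> frontier \<Omega>" for x using bd[OF that] by (simp add: va_def wa_def)
  have touch: "va x0 = wa x0" by (simp add: va_def wa_def m_def field_simps)
  obtain L1 A1 where "0 \<le> L1" and
    L1: "\<And>x y s t. x \<in> S \<Longrightarrow> y \<in> S \<Longrightarrow> \<bar>s\<bar> \<le> K \<Longrightarrow> \<bar>t\<bar> \<le> K \<Longrightarrow> \<bar>\<alpha> x s - \<alpha> y t\<bar> \<le> L1 * (dist x y + \<bar>s - t\<bar>)" and
    A1: "\<And>x s. x \<in> S \<Longrightarrow> \<bar>s\<bar> \<le> K \<Longrightarrow> \<bar>\<alpha> x s\<bar> \<le> A1"
    using loc_lipschitz_on_slab[OF \<alpha>_lip, of K] \<open>compact S\<close> unfolding S_def by blast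
  obtain L2 A2 where "0 \<le> L2" and
    L2: "\<And>x y s t. x \<in> S \<Longrightarrow> y \<in> S \<Longrightarrow> \<bar>s\<bar> \<le> K \<Longrightarrow> \<bar>t\<bar> \<le> K \<Longrightarrow> \<bar>\<beta> x s - \<beta> y t\<bar> \<le> L2 * (dist x y + \<bar>s - t\<bar>)" and
    A2: "\<And>x s. x \<in> S \<Longrightarrow> \<bar>s\<bar> \<le> K \<Longrightarrow> \<bar>\<beta> x s\<bar> \<le> A2"
    using loc_lipschitz_on_slab[OF \<beta>_lip, of K] \<open>compact S\<close> unfolding S_def by blast
  have L_shift: "L_op \<alpha> \<beta> x s q = L_op \<alpha> \<beta> x t q" if "x \<in> S" "m = 0 \<longrightarrow> s = t" for x s t q
    using shift that unfolding const_def constant_on_def S_def[symmetric] L_op_def by force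
  \<comment> \<open>\<open>G\<close> may be smaller than \<Omega>, but its frontier must lie in that
    of \<Omega>, where the strict inequality is known.\<close>
  have core: False if G: "open G" "G \<subseteq> \<Omega>" "x0 \<in> G" "frontier G \<subseteq> frontier \<Omega>"
    and \<sigma>: "\<bar>\<sigma>\<bar> = 1" "0 \<le> b0" "\<And>x s. x \<in> closure G \<Longrightarrow> \<bar>s\<bar> \<le> K \<Longrightarrow> b0 \<le> - \<sigma> * \<beta> x s"
    and \<Lambda>: "0 \<le> \<Lambda>" "0 < b0 \<or> \<Lambda> = 0"
      "\<And>x y s t. x \<in> S \<Longrightarrow> y \<in> S \<Longrightarrow> \<bar>s\<bar> \<le> K \<Longrightarrow> \<bar>t\<bar> \<le> K \<Longrightarrow> \<bar>\<alpha> x s - \<alpha> y t\<bar> \<le> \<Lambda> * (dist x y + \<bar>s - t\<bar>)"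
      "\<And>x y s t. x \<in> S \<Longrightarrow> y \<in> S \<Longrightarrow> \<bar>s\<bar> \<le> K \<Longrightarrow> \<bar>t\<bar> \<le> K \<Longrightarrow> \<bar>\<beta> x s - \<beta> y t\<bar> \<le> \<Lambda> * (dist x y + \<bar>s - t\<bar>)"
    for G \<sigma> b0 \<Lambda>
  proof -
    have GS: "x \<in> S" if "x \<in> closure G" for x
      using closure_mono[OF G(2)] that by (auto simp: S_def)
    have GS': "closure G \<subseteq> S" using GS by blast
    have near: "\<exists>d'>0. d' \<le> d \<and> (\<forall>h. norm h < d' \<longrightarrow> z + h \<in> G)" if "z \<in> G" "0 < d" for z d
    proof -
      obtain e where "0 < e" "ball z e \<subseteq> G" using openE[OF G(1) \<open>z \<in> G\<close>] by blast
      moreover have "z + h \<in> ball z e" if "norm h < e" for h using that by (simp add: dist_norm)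
      ultimately show ?thesis using \<open>0 < d\<close> by (intro exI[of _ "min d e"]) auto
    qed
    show False
    proof (rule no_touching[of G "closure G" va wa K x0 \<alpha> "max A1 A2" \<beta> \<Lambda> \<sigma> b0 "closure U" "sym_matrices - U"])
      show "usc_map (closure G) va" unfolding va_def
        using usc_map_subset[OF usc_map_add[OF vr_usc usc_map_continuous[of S "\<lambda>_. - (m / 2)"]] GS'] by simp
      have "usc_map S (\<lambda>x. nr x + - (m / 2))"
        by (intro usc_map_add nr_usc usc_map_continuous continuous_intros)
      from usc_map_subset[OF this GS'] show "usc_map (closure G) (\<lambda>x. - wa x)" by (simp add: wa_def)
      show "- K \<le> va x \<and> va x \<le> K - 1" "- K + 1 \<le> wa x \<and> wa x \<le> K" "va x \<le> wa x" if "x \<in> closure G" for x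
        using va_range[OF GS[OF that]] wa_range[OF GS[OF that]] le'[OF GS[OF that]] by simp_all
      show "va x < wa x" if "x \<in> frontier G" for x using bd' G(4) that by blast
      show "x0 \<in> closure G" using G(3) closure_subset by blast
      show "\<bar>\<alpha> x s\<bar> \<le> max A1 A2" "\<bar>\<beta> x s\<bar> \<le> max A1 A2" if "x \<in> closure G" "\<bar>s\<bar> \<le> K" for x s
        using A1[OF GS[OF that(1)] that(2)] A2[OF GS[OF that(1)] that(2)] by simp_all
      show "\<bar>\<alpha> x s - \<alpha> y t\<bar> \<le> \<Lambda> * (dist x y + \<bar>s - t\<bar>)" "\<bar>\<beta> x s - \<beta> y t\<bar> \<le> \<Lambda> * (dist x y + \<bar>s - t\<bar>)"
        if "x \<in> closure G" "y \<in> closure G" "\<bar>s\<bar> \<le> K" "\<bar>t\<bar> \<le> K" for x y s t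
        by (rule \<Lambda>(3,4)[OF GS[OF that(1)] GS[OF that(2)] that(3,4)])+
      show "bounded G" using \<Omega>(1) G(2) by (rule bounded_subset)
      fix z q A d
      assume z: "z \<in> G" "- K < va z" and A: "A \<in> sym_matrices" "0 < d"
        and jet: "\<And>h. norm h < d \<Longrightarrow> z + h \<in> G \<Longrightarrow> va (z + h) \<le> va z + q \<bullet> h + (h \<bullet> (A *v h)) / 2"
      obtain d' where d': "0 < d'" "d' \<le> d" "\<forall>h. norm h < d' \<longrightarrow> z + h \<in> G" using near[OF z(1) A(2)] by blast
      have "z \<in> \<Omega>" "z \<in> S" using z(1) G(2) \<Omega>S by auto
      have "A + L_op \<alpha> \<beta> z (va z + m / 2) q \<in> closure U"
      proof (rule visc_subsolution_jet[OF v(2) \<open>z \<in> \<Omega>\<close> A(1) v_eq'[OF \<open>z \<in> S\<close> z(2)] d'(1)])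
        fix h :: "real ^ 'n" assume h: "norm h < d'" "z + h \<in> \<Omega>"
        then have "v (z + h) \<le> ereal (va (z + h) + m / 2)" using \<Omega>S v_le[of "z + h"] by (auto simp: va_def)
        also have "\<dots> \<le> ereal (va z + m / 2 + q \<bullet> h + (h \<bullet> (A *v h)) / 2)" using jet[of h] h(1) d' by simp
        finally show "v (z + h) \<le> ereal (va z + m / 2 + q \<bullet> h + (h \<bullet> (A *v h)) / 2)" .
      qed
      then show "A + L_op \<alpha> \<beta> z (va z) q \<in> closure U"
        by (subst L_shift[OF \<open>z \<in> S\<close>, of _ "va z + m / 2"]) simp_all
    next
      fix z q A d
      assume z: "z \<in> G" "wa z < K" and A: "A \<in> sym_matrices" "0 < d"
        and jet: "\<And>h. norm h < d \<Longrightarrow> z + h \<in> G \<Longrightarrow> wa z + q \<bullet> h + (h \<bullet> (A *v h)) / 2 \<le> wa (z + h)"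
      obtain d' where d': "0 < d'" "d' \<le> d" "\<forall>h. norm h < d' \<longrightarrow> z + h \<in> G" using near[OF z(1) A(2)] by blast
      have "z \<in> \<Omega>" "z \<in> S" using z(1) G(2) \<Omega>S by auto
      have "A + L_op \<alpha> \<beta> z (wa z - m / 2) q \<in> sym_matrices - U"
      proof (rule visc_supersolution_jet[OF w(2) \<open>z \<in> \<Omega>\<close> A(1) w_eq'[OF \<open>z \<in> S\<close> z(2)] d'(1)])
        fix h :: "real ^ 'n" assume h: "norm h < d'" "z + h \<in> \<Omega>"
        have "ereal (wa z - m / 2 + q \<bullet> h + (h \<bullet> (A *v h)) / 2) \<le> ereal (wa (z + h) - m / 2)"
          using jet[of h] h(1) d' by simp
        also have "\<dots> \<le> w (z + h)" using h \<Omega>S w_ge[of "z + h"] by (auto simp: wa_def)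
        finally show "ereal (wa z - m / 2 + q \<bullet> h + (h \<bullet> (A *v h)) / 2) \<le> w (z + h)" .
      qed
      then show "A + L_op \<alpha> \<beta> z (wa z) q \<in> sym_matrices - U"
        by (subst L_shift[OF \<open>z \<in> S\<close>, of _ "wa z - m / 2"]) simp_all
    next
      show "matrix_le (L_op \<alpha> \<beta> x s p) (L_op \<alpha> \<beta> x t p)" if "x \<in> closure G" "s \<le> t" for x s t p
        using GS[OF that(1)] that(2) by (intro mono) (simp_all add: S_def)
    next
      fix A B :: "real ^ 'n ^ 'n" and c :: real
      assume "A \<in> closure U" "B \<in> sym_matrices - U" "0 < c" "pos_definite (B - c *\<^sub>R A)"
      then show False using closure_dominated_mem[OF U_sym up cone, of A B c] by blast
    qed (fact G(1) \<sigma> \<Lambda>(1,2) touch refl)+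
  qed
  show False
  proof (cases "\<exists>\<beta>0>0. \<forall>x\<in>S. \<forall>s. \<beta>0 < \<bar>\<beta> x s\<bar>")
    case True
    then obtain b0 where "0 < b0" and b0: "\<And>x s. x \<in> S \<Longrightarrow> b0 < \<bar>\<beta> x s\<bar>" by blast
    have nz: "\<beta> x s \<noteq> 0" if "x \<in> S" for x s using b0[OF that, of s] \<open>0 < b0\<close> by auto
    have cont0: "continuous_on S (\<lambda>x. \<beta> x 0)" and conts: "\<And>x. x \<in> S \<Longrightarrow> continuous_on UNIV (\<beta> x)"
      using loc_lipschitz_on_imp_continuous_slices[OF \<beta>_lip] \<open>compact S\<close> unfolding S_def by blast+
    define f where "f x = sgn (\<beta> x0 0) * \<beta> x 0" for x
    have f_cont: "continuous_on S f" unfolding f_def by (intro continuous_intros cont0)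
    have f_nz: "f x \<noteq> 0" if "x \<in> S" for x using nz[OF that] nz[OF x0(1)] by (simp add: f_def sgn_zero_iff)
    \<comment> \<open>Only the part of \<open>\<Omega>\<close> where \<open>\<beta>\<close> has the same sign as at \<open>x0\<close> matters: it is relatively clopen.\<close>
    define G where "G = {x \<in> \<Omega>. 0 < f x}"
    have "open G"
    proof -
      have "G = f -` {0<..} \<inter> \<Omega>" by (auto simp: G_def)
      then show ?thesis
        using continuous_on_open_vimage[OF \<Omega>(2), of f] continuous_on_subset[OF f_cont \<Omega>S(1)] open_greaterThan by blast
    qed
    have G_closure: "0 < f x" if "x \<in> closure G" for x
    proof -
      have "closure G \<subseteq> S" unfolding S_def by (rule closure_mono) (auto simp: G_def)
      then have "continuous_on (closure G) f" using f_cont by (rule continuous_on_subset[rotated])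
      then have "0 \<le> f x" using that by (rule continuous_ge_on_closure) (auto simp: G_def)
      then show ?thesis using f_nz[of x] that \<open>closure G \<subseteq> S\<close> by force
    qed
    have G_frontier: "frontier G \<subseteq> frontier \<Omega>"
    proof
      fix x assume x: "x \<in> frontier G"
      then have "x \<in> closure G" "x \<notin> G" using \<open>open G\<close> by (simp_all add: frontier_def interior_open)
      then have "x \<notin> \<Omega>" using G_closure[OF \<open>x \<in> closure G\<close>] by (simp add: G_def)
      moreover have "closure G \<subseteq> closure \<Omega>" by (rule closure_mono) (auto simp: G_def)
      ultimately show "x \<in> frontier \<Omega>" using subsetD[OF _ \<open>x \<in> closure G\<close>] \<Omega>(2) by (simp add: frontier_def interior_open)
    qed
    show False
    proof (rule core[OF \<open>open G\<close> _ _ G_frontier, of "- sgn (\<beta> x0 0)" b0 "max L1 L2"])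
      show "G \<subseteq> \<Omega>" by (auto simp: G_def)
      have "f x0 = \<bar>\<beta> x0 0\<bar>" by (simp add: f_def abs_sgn mult.commute)
      then show "x0 \<in> G" using \<open>x0 \<in> \<Omega>\<close> nz[OF x0(1), of 0] by (simp add: G_def)
      show "\<bar>- sgn (\<beta> x0 0)\<bar> = 1" using nz[OF x0(1), of 0] by (simp add: abs_sgn_eq)
      show "b0 \<le> - (- sgn (\<beta> x0 0)) * \<beta> x s" if "x \<in> closure G" for x s
      proof -
        have "x \<in> S" using that closure_mono[of G \<Omega>] by (auto simp: G_def S_def)
        \<comment> \<open>\<open>G\<close> is defined by the sign at \<open>s = 0\<close>;
          continuity in \<open>s\<close> without zeros carries this sign to all
          \<open>s\<close>.\<close>
        have "0 < \<beta> x 0 * \<beta> x s" using conts[OF \<open>x \<in> S\<close>] nz[OF \<open>x \<in> S\<close>] by (rule sign_constant_on_line)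
        then show ?thesis
          using G_closure[OF that] b0[OF \<open>x \<in> S\<close>, of s] by (auto simp: f_def zero_less_mult_iff sgn_if split: if_splits)
      qed
      fix x y s t assume *: "x \<in> S" "y \<in> S" "\<bar>s\<bar> \<le> K" "\<bar>t\<bar> \<le> K"
      have "0 \<le> dist x y + \<bar>s - t\<bar>" by simp
      then have "L1 * (dist x y + \<bar>s - t\<bar>) \<le> max L1 L2 * (dist x y + \<bar>s - t\<bar>)"
        "L2 * (dist x y + \<bar>s - t\<bar>) \<le> max L1 L2 * (dist x y + \<bar>s - t\<bar>)" by (auto intro: mult_right_mono)
      then show "\<bar>\<alpha> x s - \<alpha> y t\<bar> \<le> max L1 L2 * (dist x y + \<bar>s - t\<bar>)"
        "\<bar>\<beta> x s - \<beta> y t\<bar> \<le> max L1 L2 * (dist x y + \<bar>s - t\<bar>)"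
        using L1[OF *] L2[OF *] by linarith+
    qed (use \<open>0 < b0\<close> \<open>0 \<le> L1\<close> in auto)
  next
    case False
    then have const: "(\<lambda>(x, s). \<alpha> x s) constant_on (S \<times> UNIV)" "(\<lambda>(x, s). \<beta> x s) constant_on (S \<times> UNIV)"
      using cases by (auto simp: S_def const_def)
    obtain a where a: "\<And>x s. x \<in> S \<Longrightarrow> \<alpha> x s = a" using const(1) unfolding constant_on_def by auto
    obtain b where b: "\<And>x s. x \<in> S \<Longrightarrow> \<beta> x s = b" using const(2) unfolding constant_on_def by auto
    \<comment> \<open>A nonzero constant belongs to the first case. With \<open>\<beta> = 0\<close>
      and constant \<alpha>, \<open>core\<close> applies with \<open>b0 = 0\<close> and
      \<open>\<Lambda> = 0\<close>, and either sign \<sigma> would do.\<close>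
    have "b = 0"
    proof (rule ccontr)
      assume "b \<noteq> 0"
      then have "\<exists>\<beta>0>0. \<forall>x\<in>S. \<forall>s. \<beta>0 < \<bar>\<beta> x s\<bar>" by (intro exI[of _ "\<bar>b\<bar> / 2"]) (simp add: b)
      then show False using False by blast
    qed
    show False
    proof (rule core[OF \<Omega>(2) subset_refl \<open>x0 \<in> \<Omega>\<close> subset_refl, of 1 0 0])
      show "0 \<le> - 1 * \<beta> x s" if "x \<in> closure \<Omega>" for x s
        using b[of x s] \<open>b = 0\<close> that by (simp add: S_def)
    qed (simp_all add: a b)
  qed
qed

theorem theorem1p7:
  fixes \<Omega> :: "(real ^ 'n) set"
    and \<alpha> \<beta> :: "real ^ 'n \<Rightarrow> real \<Rightarrow> real"
    and U :: "(real ^ 'n ^ 'n) set"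
    and w v :: "real ^ 'n \<Rightarrow> ereal"
  assumes "CARD('n) \<ge> 2"
    and "\<Omega> \<noteq> {}" and "bounded \<Omega>" and "open \<Omega>"
    and "loc_lipschitz_on (closure \<Omega> \<times> UNIV) (\<lambda>(x, s). \<alpha> x s)"
    and "loc_lipschitz_on (closure \<Omega> \<times> UNIV) (\<lambda>(x, s). \<beta> x s)"
    and "\<And>x s t p. x \<in> closure \<Omega> \<Longrightarrow> s \<le> t \<Longrightarrow>
           matrix_le (L_op \<alpha> \<beta> x s p) (L_op \<alpha> \<beta> x t p)"
    and "(\<exists>\<beta>0>0. \<forall>x\<in>closure \<Omega>. \<forall>s. \<bar>\<beta> x s\<bar> > \<beta>0) \<or>
         ((\<lambda>(x, s). \<alpha> x s) constant_on (closure \<Omega> \<times> UNIV) \<and>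
          (\<lambda>(x, s). \<beta> x s) constant_on (closure \<Omega> \<times> UNIV))"
    and "U \<noteq> {}" and "openin (top_of_set sym_matrices) U"
    and "\<And>A B. A \<in> U \<Longrightarrow> B \<in> sym_matrices \<Longrightarrow> pos_definite B \<Longrightarrow> A + B \<in> U"
    and "\<And>A c. A \<in> U \<Longrightarrow> c > 0 \<Longrightarrow> c *\<^sub>R A \<in> U"
    and "lsc_on (closure \<Omega>) w" and "usc_on (closure \<Omega>) v"
    and "visc_supersolution (F_op \<alpha> \<beta>) U \<Omega> w"
    and "visc_subsolution (F_op \<alpha> \<beta>) U \<Omega> v"
  shows "((\<forall>x\<in>\<Omega>. w x \<ge> v x) \<and> (\<forall>x\<in>frontier \<Omega>. w x > v x) \<longrightarrow> (\<forall>x\<in>\<Omega>. w x > v x))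
    \<and> ((\<lambda>(x, s). \<alpha> x s) constant_on (closure \<Omega> \<times> UNIV) \<and>
       (\<lambda>(x, s). \<beta> x s) constant_on (closure \<Omega> \<times> UNIV) \<longrightarrow>
       (\<forall>x\<in>frontier \<Omega>. w x \<ge> v x) \<longrightarrow> (\<forall>x\<in>\<Omega>. w x \<ge> v x))"
proof (intro conjI impI ballI)
  have U_sym: "U \<subseteq> sym_matrices" using assms(10) openin_imp_subset by blast
  note no_contact = no_interior_contact[OF assms(3,4,5,6,7,8) U_sym assms(11,12,13,15,14,16), rotated 7]
  have closure: "x \<in> closure \<Omega>" if "x \<in> \<Omega>" for x using that closure_subset by blast
  {
    fix x assume *: "(\<forall>x\<in>\<Omega>. w x \<ge> v x) \<and> (\<forall>x\<in>frontier \<Omega>. w x > v x)" and "x \<in> \<Omega>"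
    have "v y \<le> w y" if "y \<in> closure \<Omega>" for y
      using * that closure_Un_frontier[of \<Omega>] by (auto simp: less_imp_le)
    then show "w x > v x"
      using no_contact[OF closure[OF \<open>x \<in> \<Omega>\<close>]] * by (force simp: not_less[symmetric])
  next
    fix x assume const: "(\<lambda>(x, s). \<alpha> x s) constant_on (closure \<Omega> \<times> UNIV) \<and>
       (\<lambda>(x, s). \<beta> x s) constant_on (closure \<Omega> \<times> UNIV)"
      and bd: "\<forall>x\<in>frontier \<Omega>. w x \<ge> v x" and "x \<in> \<Omega>"
    then show "w x \<ge> v x"
      using no_contact[OF closure[OF \<open>x \<in> \<Omega>\<close>]] by (force simp: not_less[symmetric])
  }
qed

end
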